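(* Consider the network model, the algorithm, and the conditions C1), C2), C3), C4) described in the context. Assume that C1)--C4) hold. Then for every agent $i\in\mathcal V$ the estimates $\{\theta_{i,k}\}_{k\ge1}$ generated by the algorithm achieve both consensus and convergence, i.e., $$\lim_{k\to\infty}\theta_{i,k}=\theta^*\quad\text{almost surely},\qquad \forall\, i\in\mathcal V .$$
   Context: All random variables live on one probability space; $\|\cdot\|$ is the Euclidean ($L_2$) norm; $\mathbb I_{[\cdot]}$ is the indicator of an event. Network. $\mathcal V=\{1,\dots,N\}$ is a set of agents; at each time $k$ there is a digraph $\mathcal G(k)=(\mathcal V,\mathcal E(k))$, $\mathcal E(k)\subset\mathcal V\times\mathcal V$, with $(i,i)\in\mathcal E(k)$ for all $i$; $(i,j)\in\mathcal E(k)$ means that $j$ receives information from $i$ at time $k$. Neighbours: $N_i(k)=\{j\in\mathcal V:(j,i)\in\mathcal E(k)\}$. The nonnegative matrix $W(k)=[w_{ij}(k)]_{i,j=1}^N$ satisfies $w_{ij}(k)>0$ iff $(j,i)\in\mathcal E(k)$, and $w_{ij}(k)=0$ otherwise. Model. $\theta^*\in\mathbb R^l$ is a fixed (unknown) vector. For each agent $i$ and $k\ge1$, $y_{i,k+1}=\phi_{i,k}^T\theta^*+d_{i,k+1}$, with random regressor $\phi_{i,k}\in\mathbb R^l$ and scalar noise $d_{i,k+1}$. (Agent $i$ only observes $\phi_{i,k}$ and the binary output $z_{i,k+1}=\mathbb I_{[y_{i,k+1}<c_{i,k}]}$ with threshold $c_{i,k}=\phi_{i,k}^T\theta_{i,k}$.)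 Algorithm. The initial values $\theta_{i,1}\in\mathbb R^l$ are arbitrary and the truncation counters start at $\sigma_{i,1}=0$. For $k\ge1$ and all $i\in\mathcal V$: $$\hat\sigma_{i,k}=\max_{j\in N_i(k)}\sigma_{j,k},$$ $$\theta'_{i,k+1}=\Big\{\sum_{j\in N_i(k)}w_{ij}(k)\theta_{j,k}\mathbb I_{[\sigma_{j,k}=\hat\sigma_{i,k}]}+\tfrac1k\phi_{i,k}\big(1-2\mathbb I_{[y_{i,k+1}<\phi_{i,k}^T\theta_{i,k}]}\big)\Big\}\,\mathbb I_{[\sigma_{i,k}=\hat\sigma_{i,k}]},$$ $$\theta_{i,k+1}=\theta'_{i,k+1}\mathbb I_{[\|\theta'_{i,k+1}\|\le\hat\sigma_{i,k}]},\qquad \sigma_{i,k+1}=\hat\sigma_{i,k}+\mathbb I_{[\|\theta'_{i,k+1}\|>\hat\sigma_{i,k}]}.$$ Conditions. C1) For each $i\in\mathcal V$, $\{\phi_{i,k}\}_{k\ge1}$ is strictly stationary with density function $q_i(\cdot)$ and is $\alpha$-mixing with mixing coefficients satisfying $\alpha(k)\le C\rho_1^k$ for some $C>0$, $0<\rho_1<1$; further $\sup_k\|\phi_{i,k}\|\le M<\infty$ almost surely for some constant $M>0$. C2) The matrix $\mathbb E[\sum_{i=1}^N\phi_{i,k}\phi_{i,k}^T]$ is positive definite for all $k$. C3) For each $i\in\mathcal V$, $\{d_{i,k}\}$ is i.i.d. with distribution function $F_{i,d}$ and density $f_{i,d}$; $F_{i,d}(0)=\frac12$, $f_{i,d}$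 is continuous, $f_{i,d}(0)>0$; and the sequences $\{\phi_{i,k}\}$ and $\{d_{i,k+1}\}$ are mutually independent. C4) a) $W(k)$ is doubly stochastic for each $k$; b) there is a constant $0<\kappa<1$ with $w_{ij}(k)\ge\kappa$ whenever $j\in N_i(k)$, for all $i\in\mathcal V$ and all $k$; c) the digraph $(\mathcal V,\mathcal E_\infty)$ is strongly connected, where $\mathcal E_\infty=\{(j,i):(j,i)\in\mathcal E(k)\text{ for infinitely many }k\}$; d) there is a positive integer $B$ such that $(j,i)\in\mathcal E(k)\cup\mathcal E(k+1)\cup\dots\cup\mathcal E(k+B-1)$ for every $(j,i)\in\mathcal E_\infty$ and every $k\ge1$. *)

theory Defs
  imports "HOL-Probability.Probability"
begin

text \<open>
  Processes and the network are indexed by \<^typ>\<open>nat\<close>, but time starts at 1; values at index 0 are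
  never constrained. An edge \<open>(i, j)\<close> means that \<open>j\<close> receives information from \<open>i\<close>.
\<close>

definition nbrs :: "(nat \<Rightarrow> ('n \<times> 'n) set) \<Rightarrow> 'n \<Rightarrow> nat \<Rightarrow> 'n set" where
  "nbrs E i k = {j. (j, i) \<in> E k}"

definition persistent_edges :: "(nat \<Rightarrow> ('n \<times> 'n) set) \<Rightarrow> ('n \<times> 'n) set" where
  "persistent_edges E = {e. infinite {k. 1 \<le> k \<and> e \<in> E k}}"

definition strongly_connected :: "('n \<times> 'n) set \<Rightarrow> bool" where
  "strongly_connected R \<longleftrightarrow> (\<forall>u v. (u, v) \<in> R\<^sup>*)"

definition doubly_stochastic :: "real ^ 'n ^ 'n \<Rightarrow> bool" where
  "doubly_stochastic A \<longleftrightarrow>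
     (\<forall>i j. 0 \<le> A $ i $ j) \<and>
     (\<forall>i. (\<Sum>j\<in>UNIV. A $ i $ j) = 1) \<and>
     (\<forall>j. (\<Sum>i\<in>UNIV. A $ i $ j) = 1)"

definition outer_prod :: "real ^ 'l \<Rightarrow> real ^ 'l \<Rightarrow> real ^ 'l ^ 'l" where
  "outer_prod x y = (\<chi> a b. x $ a * y $ b)"

definition positive_definite :: "real ^ 'l ^ 'l \<Rightarrow> bool" where
  "positive_definite A \<longleftrightarrow> transpose A = A \<and> (\<forall>x. x \<noteq> 0 \<longrightarrow> 0 < x \<bullet> (A *v x))"

text \<open>All finite-dimensional distributions are invariant under time shifts.\<close>

definition strictly_stationary ::
  "'a measure \<Rightarrow> (nat \<Rightarrow> 'a \<Rightarrow> 'b :: topological_space) \<Rightarrow> bool" where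
  "strictly_stationary M X \<longleftrightarrow>
     (\<forall>J h. finite J \<and> J \<subseteq> {1..} \<longrightarrow>
        distr M (\<Pi>\<^sub>M j\<in>J. borel) (\<lambda>\<omega>. \<lambda>j\<in>J. X (j + h) \<omega>) =
        distr M (\<Pi>\<^sub>M j\<in>J. borel) (\<lambda>\<omega>. \<lambda>j\<in>J. X j \<omega>))"

text \<open>The \<open>\<sigma>\<close>-algebra generated by the variables \<open>X j\<close> with \<open>j \<in> J\<close>.\<close>

definition generated_events ::
  "'a measure \<Rightarrow> (nat \<Rightarrow> 'a \<Rightarrow> 'b :: topological_space) \<Rightarrow> nat set \<Rightarrow> 'a set set" where
  "generated_events M X J =
     sigma_sets (space M) {X j -` S \<inter> space M | j S. j \<in> J \<and> S \<in> sets borel}"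

text \<open>
  On a probability space the supremum ranges over a nonempty set bounded by 1, so the real-valued
  \<open>SUP\<close> is the genuine supremum.
\<close>

definition alpha_coeff ::
  "'a measure \<Rightarrow> (nat \<Rightarrow> 'a \<Rightarrow> 'b :: topological_space) \<Rightarrow> nat \<Rightarrow> real" where
  "alpha_coeff M X k =
     (SUP (A, B) \<in> (\<Union>n\<in>{1..}. generated_events M X {1..n} \<times> generated_events M X {n + k..}).
        \<bar>measure M (A \<inter> B) - measure M A * measure M B\<bar>)"

definition alpha_mixing ::
  "'a measure \<Rightarrow> (nat \<Rightarrow> 'a \<Rightarrow> 'b :: topological_space) \<Rightarrow> bool" where
  "alpha_mixing M X \<longleftrightarrow> alpha_coeff M X \<longlonglongrightarrow> 0"

end

theory Submission
  imports Defs
begin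

text \<open>
  Put \<open>x = \<theta> - \<theta>star\<close>. As long as no truncation occurs, the errors follow a gossip recursion with
  perturbations \<open>\<plusminus> \<phi> / k\<close>. Nothing is assumed about the dependence between different agents, so \<open>\<theta> i k\<close>
  may depend on the future noise of agent \<open>i\<close> and no martingale argument is available. The probabilistic
  input is instead pathwise. For each agent, bounded functions of \<open>(\<phi> i k, d i (k + 1))\<close> obey a law of
  large numbers, because mixing makes the variance of the partial sums linear. Compactness makes the
  resulting estimate uniform over windows in which the iterates stay near a point \<open>x\<close>: the average increment
  has negative inner product with \<open>x\<close> as long as \<open>x\<close> stays in an annulus around 0. Here the median
  condition makes the contribution of each agent nonpositive, and the excitation condition makes one of
  them negative.

  Double stochasticity and connectivity contract the disagreement of the agents, and the network average
  then has the Lyapunov function \<open>(norm x)\<^sup>2\<close>. Whenever a new truncation level is reached, the whole network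
  restarts near 0 after a bounded time, and from there, for high levels, the recursion without truncation never
  leaves a fixed ball. Hence there are finitely many truncations, and the same Lyapunov argument gives
  convergence.
\<close>

section \<open>Laws of large numbers under mixing\<close>

text \<open>The order of choices shapes the estimates. With weights 1/k the law of large numbers has
  error e * (1 + s) on a window of harmonic length s. Its additive part is harmless only when s is
  at least T, while the second-order term of the squared norm grows like s^2 and forces s to be
  small against the drift rate. So the rate and the radius come first, then T, and only then the
  starting time, which makes e / T small. The sign makes the drift discontinuous in the iterate,
  which itself moves within a window. A majorant over a small ball replaces continuity; its mean is
  close to the mean drift at the centre because the noise has a density. Restart times depend on the
  outcome, so the bounds used at a restart are deterministic and hold for all paths from any late
  starting time. At the restart a virtual untruncated path is launched; its bound is fixed before
  the truncation level is chosen, and an induction shows that the algorithm follows it.\<close>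

context prob_space
begin

text \<open>Fubini for the joint law, which the product rule on rectangles identifies as a product
  measure. Independence enters as this rule because it is obtained below in two ways: from
  independent generated \<sigma>-algebras, and from independence of two noise variables.\<close>

lemma expectation_indep_pair:
  fixes f :: "'b \<times> 'c \<Rightarrow> real"
  assumes U[measurable]: "U \<in> measurable M S" and V[measurable]: "V \<in> measurable M T"
    and ind: "\<And>A B. A \<in> sets S \<Longrightarrow> B \<in> sets T \<Longrightarrow>
      prob ((U -` A \<inter> space M) \<inter> (V -` B \<inter> space M)) = prob (U -` A \<inter> space M) * prob (V -` B \<inter> space M)"
    and f[measurable]: "f \<in> borel_measurable (S \<Otimes>\<^sub>M T)"
    and bound: "\<And>z. \<bar>f z\<bar> \<le> C"
  shows "expectation (\<lambda>\<omega>. f (U \<omega>, V \<omega>)) = expectation (\<lambda>\<omega>. \<integral>v. f (U \<omega>, v) \<partial>distr M T V)"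
proof -
  interpret U: prob_space "distr M S U" by (rule prob_space_distr) fact
  interpret V: prob_space "distr M T V" by (rule prob_space_distr) fact
  interpret UV: pair_prob_space "distr M S U" "distr M T V" ..
  have int: "integrable (distr M S U \<Otimes>\<^sub>M distr M T V) f"
    by (rule UV.integrable_const_bound[where B=C]) (use bound in auto)
  have eq: "distr M S U \<Otimes>\<^sub>M distr M T V = distr M (S \<Otimes>\<^sub>M T) (\<lambda>\<omega>. (U \<omega>, V \<omega>))"
  proof (rule pair_measure_eqI)
    fix A B assume "A \<in> sets (distr M S U)" "B \<in> sets (distr M T V)"
    then have AB[measurable]: "A \<in> sets S" "B \<in> sets T" by auto
    have "(\<lambda>\<omega>. (U \<omega>, V \<omega>)) -` (A \<times> B) \<inter> space M = (U -` A \<inter> space M) \<inter> (V -` B \<inter> space M)"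
      by auto
    then show "emeasure (distr M S U) A * emeasure (distr M T V) B =
        emeasure (distr M (S \<Otimes>\<^sub>M T) (\<lambda>\<omega>. (U \<omega>, V \<omega>))) (A \<times> B)"
      using ind[OF AB] by (simp add: emeasure_distr emeasure_eq_measure ennreal_mult)
  qed (auto intro: U.sigma_finite_measure_axioms V.sigma_finite_measure_axioms)
  have "expectation (\<lambda>\<omega>. f (U \<omega>, V \<omega>)) = integral\<^sup>L (distr M (S \<Otimes>\<^sub>M T) (\<lambda>\<omega>. (U \<omega>, V \<omega>))) f"
    by (subst integral_distr) auto
  also have "\<dots> = integral\<^sup>L (distr M S U \<Otimes>\<^sub>M distr M T V) f"
    by (simp add: eq)
  also have "\<dots> = (\<integral>u. \<integral>v. f (u, v) \<partial>distr M T V \<partial>distr M S U)"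
    using UV.integral_fst'[OF int] by simp
  also have "\<dots> = expectation (\<lambda>\<omega>. \<integral>v. f (U \<omega>, v) \<partial>distr M T V)"
    by (subst integral_distr) auto
  finally show ?thesis .
qed

text \<open>
  Both variables are replaced by \<open>\<lfloor>n X\<rfloor> / n\<close>, an average of \<open>n\<close> level-set indicators, so that the covariance
  becomes an average of covariances of events.
\<close>

lemma covariance_unit_bound:
  fixes X Y :: "'a \<Rightarrow> real"
  assumes X[measurable]: "X \<in> borel_measurable M" and Y[measurable]: "Y \<in> borel_measurable M"
    and X01: "\<And>\<omega>. \<omega> \<in> space M \<Longrightarrow> 0 \<le> X \<omega> \<and> X \<omega> \<le> 1"
    and Y01: "\<And>\<omega>. \<omega> \<in> space M \<Longrightarrow> 0 \<le> Y \<omega> \<and> Y \<omega> \<le> 1"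
    and lev: "\<And>s t. \<bar>prob ({\<omega>\<in>space M. s \<le> X \<omega>} \<inter> {\<omega>\<in>space M. t \<le> Y \<omega>})
        - prob {\<omega>\<in>space M. s \<le> X \<omega>} * prob {\<omega>\<in>space M. t \<le> Y \<omega>}\<bar> \<le> \<alpha>"
  shows "\<bar>expectation (\<lambda>\<omega>. X \<omega> * Y \<omega>) - expectation X * expectation Y\<bar> \<le> \<alpha>"
proof -
  define A where "A = (\<lambda>n m. {\<omega>\<in>space M. real m / real n \<le> X \<omega>})"
  define B where "B = (\<lambda>n m. {\<omega>\<in>space M. real m / real n \<le> Y \<omega>})"
  define app where "app = (\<lambda>(n::nat) C \<omega>. (\<Sum>m\<in>{1..n}. indicator (C n m :: 'a set) \<omega>) / real n)"
  have Am[measurable]: "A n m \<in> events" "B n m \<in> events" for n m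
    by (auto simp: A_def B_def)
  have count: "\<bar>u - (\<Sum>m\<in>{1..n}. of_bool (real m / real n \<le> u)) / real n\<bar> \<le> 1 / real n"
    if n: "n \<ge> 1" and u: "0 \<le> u" "u \<le> 1" for u :: real and n :: nat
  proof -
    have n0: "real n > 0" using n by simp
    have iff: "real m / real n \<le> u \<longleftrightarrow> m \<le> nat \<lfloor>u * n\<rfloor>" for m
    proof -
      have "real m / real n \<le> u \<longleftrightarrow> real m \<le> u * n"
        using n0 by (simp add: field_simps)
      also have "\<dots> \<longleftrightarrow> int m \<le> \<lfloor>u * n\<rfloor>" by (simp add: le_floor_iff)
      also have "\<dots> \<longleftrightarrow> m \<le> nat \<lfloor>u * n\<rfloor>" using u by (simp add: le_nat_iff)
      finally show ?thesis .
    qed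
    have "nat \<lfloor>u * n\<rfloor> \<le> n"
    proof -
      have "u * n \<le> n" using u n0 by (simp add: mult_left_le_one_le)
      then have "\<lfloor>u * n\<rfloor> \<le> int n" by linarith
      then show ?thesis by linarith
    qed
    then have eq: "{1..n} \<inter> {m. m \<le> nat \<lfloor>u * n\<rfloor>} = {1..nat \<lfloor>u * n\<rfloor>}" by auto
    have "(\<Sum>m\<in>{1..n}. of_bool (real m / real n \<le> u) :: real) = real (nat \<lfloor>u * n\<rfloor>)"
      unfolding iff by (subst sum_of_bool_eq) (use eq in \<open>simp_all add: Int_def\<close>)
    moreover have "\<bar>u * n - real (nat \<lfloor>u * n\<rfloor>)\<bar> \<le> 1"
    proof -
      have "0 \<le> \<lfloor>u * n\<rfloor>" using u by simp
      then show ?thesis by (simp add: of_nat_nat) linarith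
    qed
    ultimately have "\<bar>u * n - (\<Sum>m\<in>{1..n}. of_bool (real m / real n \<le> u))\<bar> / n \<le> 1 / n"
      using n0 by (intro divide_right_mono) auto
    moreover have "\<bar>u * n - c\<bar> / n = \<bar>u - c / n\<bar>" for c
    proof -
      have "u - c / n = (u * n - c) / n" using n0 by (simp add: diff_divide_distrib)
      then show ?thesis using n0 by (simp add: abs_divide)
    qed
    ultimately show ?thesis by metis
  qed
  have appX: "\<bar>X \<omega> - app n A \<omega>\<bar> \<le> 1 / real n" if "n \<ge> 1" "\<omega> \<in> space M" for n \<omega>
    using count[OF that(1), of "X \<omega>"] X01[OF that(2)] that(2)
    by (simp add: app_def A_def indicator_def of_bool_def)
  have appY: "\<bar>Y \<omega> - app n B \<omega>\<bar> \<le> 1 / real n" if "n \<ge> 1" "\<omega> \<in> space M" for n \<omega>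
    using count[OF that(1), of "Y \<omega>"] Y01[OF that(2)] that(2)
    by (simp add: app_def B_def indicator_def of_bool_def)
  have app01: "0 \<le> app n C \<omega> \<and> app n C \<omega> \<le> 1" for n C \<omega>
  proof -
    have "(\<Sum>m\<in>{1..n}. indicator (C n m) \<omega> :: real) \<le> (\<Sum>m\<in>{1..n}. 1)"
      by (intro sum_mono) (simp add: indicator_def)
    then show ?thesis unfolding app_def
      by (auto simp: divide_le_eq_1 sum_nonneg)
  qed
  have appm[measurable]: "app n A \<in> borel_measurable M" "app n B \<in> borel_measurable M" for n
    unfolding app_def by measurable
  have bd: "integrable M f" if "f \<in> borel_measurable M" "\<And>\<omega>. \<omega> \<in> space M \<Longrightarrow> 0 \<le> f \<omega> \<and> f \<omega> \<le> 1"
    for f :: "'a \<Rightarrow> real"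
    by (rule integrable_const_bound[where B=1]) (use that in \<open>auto intro!: AE_I2\<close>)
  have mult01: "0 \<le> u * v \<and> u * v \<le> 1" if "0 \<le> u \<and> u \<le> 1" "0 \<le> v \<and> v \<le> 1" for u v :: real
    using that mult_mono[of u 1 v 1] by auto
  have prod_diff: "\<bar>u * v - u' * v'\<bar> \<le> 2 * e"
    if "0 \<le> v \<and> v \<le> 1" "0 \<le> u' \<and> u' \<le> 1" "\<bar>u - u'\<bar> \<le> e" "\<bar>v - v'\<bar> \<le> e" for u v u' v' e :: real
  proof -
    have "u * v - u' * v' = (u - u') * v + u' * (v - v')" by (simp add: algebra_simps)
    also have "\<bar>\<dots>\<bar> \<le> \<bar>u - u'\<bar> * v + u' * \<bar>v - v'\<bar>"
      using that abs_triangle_ineq[of "(u - u') * v" "u' * (v - v')"] by (simp add: abs_mult)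
    also have "\<dots> \<le> e * 1 + 1 * e"
      using that by (intro add_mono mult_mono) auto
    finally show ?thesis by simp
  qed
  have Ediff: "\<bar>expectation f - expectation g\<bar> \<le> e"
    if "integrable M f" "integrable M g" "\<And>\<omega>. \<omega> \<in> space M \<Longrightarrow> \<bar>f \<omega> - g \<omega>\<bar> \<le> e" for f g :: "'a \<Rightarrow> real" and e
  proof -
    have "\<bar>expectation f - expectation g\<bar> = \<bar>expectation (\<lambda>\<omega>. f \<omega> - g \<omega>)\<bar>" using that by simp
    also have "\<dots> \<le> expectation (\<lambda>\<omega>. \<bar>f \<omega> - g \<omega>\<bar>)" by (rule integral_abs_bound)
    also have "\<dots> \<le> expectation (\<lambda>_. e)" by (rule integral_mono) (use that in auto)
    finally show ?thesis by (simp add: prob_space)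
  qed
  have E01: "0 \<le> expectation f \<and> expectation f \<le> 1"
    if "f \<in> borel_measurable M" "\<And>\<omega>. \<omega> \<in> space M \<Longrightarrow> 0 \<le> f \<omega> \<and> f \<omega> \<le> 1"
    for f :: "'a \<Rightarrow> real"
  proof -
    have "integrable M f" using that by (rule bd)
    then have "expectation f \<le> expectation (\<lambda>_. 1)" by (rule integral_mono) (use that in auto)
    moreover have "0 \<le> expectation f" using that by (intro integral_nonneg_AE AE_I2) auto
    ultimately show ?thesis by (simp add: prob_space)
  qed
  \<comment> \<open>The \<open>n * n\<close> pairs of level sets each contribute at most \<alpha>,
    and the two normalisations divide by exactly this number.\<close>
  have disc: "\<bar>expectation (\<lambda>\<omega>. app n A \<omega> * app n B \<omega>) - expectation (app n A) * expectation (app n B)\<bar> \<le> \<alpha>"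
    if n: "n \<ge> 1" for n
  proof -
    have ind: "expectation (\<lambda>\<omega>. (\<Sum>m\<in>I. indicator (C m) \<omega>) / c) = (\<Sum>m\<in>I. prob (C m)) / c"
      if "\<And>m. C m \<in> events" for I :: "'i set" and C and c :: real
      using that by (simp add: Bochner_Integration.integral_sum emeasure_eq_measure)
    have EA: "expectation (app n A) = (\<Sum>m\<in>{1..n}. prob (A n m)) / n"
      unfolding app_def by (rule ind) measurable
    have EB: "expectation (app n B) = (\<Sum>m\<in>{1..n}. prob (B n m)) / n"
      unfolding app_def by (rule ind) measurable
    have "app n A \<omega> * app n B \<omega> = (\<Sum>(i, j)\<in>{1..n}\<times>{1..n}. indicator (A n i \<inter> B n j) \<omega>) / (n * n)" for \<omega>
      unfolding app_def by (simp only: times_divide_times_eq sum_product sum.cartesian_product indicator_inter_arith of_nat_mult)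
    then have "expectation (\<lambda>\<omega>. app n A \<omega> * app n B \<omega>) =
        (\<Sum>(i, j)\<in>{1..n}\<times>{1..n}. prob (A n i \<inter> B n j)) / (n * n)"
      using ind[of "\<lambda>(i, j). A n i \<inter> B n j" "{1..n}\<times>{1..n}" "n * n"] by (simp add: split_beta)
    then have EAB: "expectation (\<lambda>\<omega>. app n A \<omega> * app n B \<omega>) =
        (\<Sum>i\<in>{1..n}. \<Sum>j\<in>{1..n}. prob (A n i \<inter> B n j)) / (n * n)"
      by (simp add: sum.cartesian_product)
    have "\<bar>expectation (\<lambda>\<omega>. app n A \<omega> * app n B \<omega>) - expectation (app n A) * expectation (app n B)\<bar>
       = \<bar>(\<Sum>i\<in>{1..n}. \<Sum>j\<in>{1..n}. prob (A n i \<inter> B n j) - prob (A n i) * prob (B n j))\<bar> / (n * n)"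
      by (simp add: EA EB EAB sum_product sum_subtractf diff_divide_distrib[symmetric] abs_divide)
    also have "\<dots> \<le> (\<Sum>i\<in>{1..n}. \<Sum>j\<in>{1..n}. \<alpha>) / (n * n)"
      by (intro divide_right_mono order.trans[OF sum_abs] sum_mono)
         (use lev in \<open>auto simp: A_def B_def\<close>)
    also have "\<dots> = \<alpha>" using n by simp
    finally show ?thesis .
  qed
  \<comment> \<open>Discretisation costs \<open>2 / n\<close> in the mean of the product and
    \<open>2 / n\<close> in the product of the means; both vanish in the limit.\<close>
  have "\<bar>expectation (\<lambda>\<omega>. X \<omega> * Y \<omega>) - expectation X * expectation Y\<bar> \<le> \<alpha> + 4 / n" if n: "n \<ge> 1" for n :: nat
  proof -
    have 1: "\<bar>expectation (\<lambda>\<omega>. X \<omega> * Y \<omega>) - expectation (\<lambda>\<omega>. app n A \<omega> * app n B \<omega>)\<bar> \<le> 2 * (1 / n)"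
    proof (rule Ediff)
      show "integrable M (\<lambda>\<omega>. X \<omega> * Y \<omega>)" by (rule bd) (measurable, intro mult01 X01 Y01)
      show "integrable M (\<lambda>\<omega>. app n A \<omega> * app n B \<omega>)" by (rule bd) (measurable, intro mult01 app01)
      show "\<bar>X \<omega> * Y \<omega> - app n A \<omega> * app n B \<omega>\<bar> \<le> 2 * (1 / n)" if "\<omega> \<in> space M" for \<omega>
        by (intro prod_diff Y01 app01 appX appY that n)
    qed
    have 2: "\<bar>expectation X * expectation Y - expectation (app n A) * expectation (app n B)\<bar> \<le> 2 * (1 / n)"
      by (intro prod_diff E01 Ediff bd X01 Y01 app01 appX appY n X Y appm)
    show ?thesis using 1 2 disc[OF n] by linarith
  qed
  moreover have "(\<lambda>n. \<alpha> + 4 / real n) \<longlonglongrightarrow> \<alpha> + 0"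
    by (intro tendsto_add tendsto_const lim_const_over_n)
  ultimately show ?thesis
    by (intro tendsto_lowerbound[where F=sequentially])
       (auto simp: eventually_sequentially intro!: exI[of _ 1])
qed

text \<open>The split at \<open>n = j\<close> makes time \<open>k\<close> the start of the future at
  distance \<open>k - j\<close>. The supremum is real-valued, so using it requires the bound 1 on
  the whole family.\<close>

lemma alpha_coeff_upper:
  fixes X :: "nat \<Rightarrow> 'a \<Rightarrow> 'b :: topological_space"
  assumes meas: "\<And>j. 1 \<le> j \<Longrightarrow> X j \<in> borel_measurable M"
    and jk: "1 \<le> j" "j < k" and S: "S \<in> sets borel" and T: "T \<in> sets borel"
  shows "\<bar>prob ((X j -` S \<inter> space M) \<inter> (X k -` T \<inter> space M)) -
     prob (X j -` S \<inter> space M) * prob (X k -` T \<inter> space M)\<bar> \<le> alpha_coeff M X (k - j)"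
proof -
  let ?I = "\<Union>n\<in>{1..}. generated_events M X {1..n} \<times> generated_events M X {n + (k - j)..}"
  let ?f = "\<lambda>(A, B). \<bar>prob (A \<inter> B) - prob A * prob B\<bar>"
  let ?p = "(X j -` S \<inter> space M, X k -` T \<inter> space M)"
  have "?p \<in> ?I"
  proof (rule UN_I[of j])
    show "j \<in> {1..}" using jk by simp
    have "X j -` S \<inter> space M \<in> generated_events M X {1..j}"
      unfolding generated_events_def using jk S by (intro sigma_sets.Basic) auto
    moreover have "X k -` T \<inter> space M \<in> generated_events M X {j + (k - j)..}"
      unfolding generated_events_def using jk T by (intro sigma_sets.Basic) auto
    ultimately show "?p \<in> generated_events M X {1..j} \<times> generated_events M X {j + (k - j)..}" by simp
  qed
  moreover have "bdd_above (?f ` ?I)"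
  proof (rule bdd_aboveI[of _ 1])
    fix v assume "v \<in> ?f ` ?I"
    then obtain A B where v: "v = \<bar>prob (A \<inter> B) - prob A * prob B\<bar>" by auto
    have "0 \<le> prob (A \<inter> B) \<and> prob (A \<inter> B) \<le> 1" "0 \<le> prob A * prob B \<and> prob A * prob B \<le> 1"
      using mult_mono[of "prob A" 1 "prob B" 1] by auto
    then show "v \<le> 1" unfolding v by linarith
  qed
  ultimately have "?f ?p \<le> (SUP p\<in>?I. ?f p)" by (rule cSUP_upper)
  then show ?thesis by (simp add: alpha_coeff_def)
qed

text \<open>Superlevel sets of \<open>g (X j)\<close> are preimages of Borel sets under
  \<open>X j\<close>, so the mixing coefficient bounds all level covariances at once.\<close>

lemma alpha_coeff_covariance:
  fixes X :: "nat \<Rightarrow> 'a \<Rightarrow> 'b :: topological_space"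
  assumes meas: "\<And>j. 1 \<le> j \<Longrightarrow> X j \<in> borel_measurable M"
    and jk: "1 \<le> j" "j < k" and g[measurable]: "g \<in> borel_measurable borel"
    and g01: "\<And>x. 0 \<le> g x \<and> g x \<le> (1::real)"
  shows "\<bar>expectation (\<lambda>\<omega>. g (X j \<omega>) * g (X k \<omega>)) - expectation (\<lambda>\<omega>. g (X j \<omega>)) * expectation (\<lambda>\<omega>. g (X k \<omega>))\<bar>
     \<le> alpha_coeff M X (k - j)"
proof -
  have [measurable]: "X j \<in> borel_measurable M" "X k \<in> borel_measurable M" using meas jk by auto
  show ?thesis
  proof (rule covariance_unit_bound)
    fix s t
    have *: "{\<omega> \<in> space M. s \<le> g (X j \<omega>)} = X j -` {x. s \<le> g x} \<inter> space M" for s j by auto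
    show "\<bar>prob ({\<omega> \<in> space M. s \<le> g (X j \<omega>)} \<inter> {\<omega> \<in> space M. t \<le> g (X k \<omega>)}) -
           prob {\<omega> \<in> space M. s \<le> g (X j \<omega>)} * prob {\<omega> \<in> space M. t \<le> g (X k \<omega>)}\<bar>
          \<le> alpha_coeff M X (k - j)"
      unfolding * by (rule alpha_coeff_upper[OF meas jk]) measurable
  qed (use g01 in auto)
qed

section \<open>Strong law from summable covariances, and its version for weights 1/k\<close>

text \<open>One-sided bounds on the mixed second moments keep the second moment of the
  \<open>n\<close>-th partial sum below \<open>A * n\<close>, which is summable along squares after
  division by the squared index.\<close>

lemma slln_of_summable_covariance:
  fixes Y :: "nat \<Rightarrow> 'a \<Rightarrow> real"
  assumes Y[measurable]: "\<And>k. Y k \<in> borel_measurable M"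
    and bound: "\<And>k \<omega>. \<omega> \<in> space M \<Longrightarrow> \<bar>Y k \<omega>\<bar> \<le> 1"
    and cov: "\<And>j k. j < k \<Longrightarrow> expectation (\<lambda>\<omega>. Y j \<omega> * Y k \<omega>) \<le> a (k - j)"
    and a: "summable a" "\<And>k. 0 \<le> a k"
  shows "AE \<omega> in M. (\<lambda>n. (\<Sum>k<n. Y k \<omega>) / n) \<longlonglongrightarrow> 0"
proof -
  define S where "S = (\<lambda>n \<omega>. \<Sum>k<n. Y k \<omega>)"
  \<comment> \<open>Passing from \<open>n\<close> to \<open>Suc n\<close> adds the square of one
    bounded variable, at most 1, and twice a cross term, which is at most
    \<open>suminf a\<close>.\<close>
  define A where "A = 1 + 2 * suminf a"
  have Sm[measurable]: "S n \<in> borel_measurable M" for n unfolding S_def by measurable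
  have intYY: "integrable M (\<lambda>\<omega>. Y j \<omega> * Y k \<omega>)" for j k
    by (rule integrable_const_bound[where B=1])
       (auto intro!: AE_I2 simp: abs_mult mult_le_one bound)
  have intS: "integrable M (\<lambda>\<omega>. (S n \<omega>)\<^sup>2)" for n
    unfolding S_def power2_eq_square sum_product using intYY by (intro Bochner_Integration.integrable_sum)
  have var: "expectation (\<lambda>\<omega>. (S n \<omega>)\<^sup>2) \<le> A * n" for n
  proof (induction n)
    case 0 then show ?case by (simp add: S_def)
  next
    case (Suc n)
    have intc: "integrable M (\<lambda>\<omega>. S n \<omega> * Y n \<omega>)"
      unfolding S_def sum_distrib_right using intYY by (intro Bochner_Integration.integrable_sum)
    have "expectation (\<lambda>\<omega>. S n \<omega> * Y n \<omega>) = (\<Sum>k<n. expectation (\<lambda>\<omega>. Y k \<omega> * Y n \<omega>))"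
      unfolding S_def sum_distrib_right using intYY by (intro Bochner_Integration.integral_sum)
    also have "\<dots> \<le> (\<Sum>k<n. a (n - k))" by (intro sum_mono cov) auto
    also have "\<dots> = (\<Sum>k\<in>{1..n}. a k)"
      by (rule sum.reindex_bij_witness[of _ "\<lambda>k. n - k" "\<lambda>k. n - k"]) auto
    also have "\<dots> \<le> suminf a" using a by (intro sum_le_suminf) auto
    finally have c: "expectation (\<lambda>\<omega>. S n \<omega> * Y n \<omega>) \<le> suminf a" .
    have "expectation (\<lambda>\<omega>. (Y n \<omega>)\<^sup>2) \<le> expectation (\<lambda>_. 1)"
      using intYY[of n n] bound by (intro integral_mono) (auto simp: power2_eq_square[symmetric] abs_square_le_1)
    then have y: "expectation (\<lambda>\<omega>. (Y n \<omega>)\<^sup>2) \<le> 1" by (simp add: prob_space)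
    have "(S (Suc n) \<omega>)\<^sup>2 = (S n \<omega>)\<^sup>2 + 2 * (S n \<omega> * Y n \<omega>) + (Y n \<omega>)\<^sup>2" for \<omega>
      by (simp add: S_def power2_sum)
    then have "expectation (\<lambda>\<omega>. (S (Suc n) \<omega>)\<^sup>2) =
        expectation (\<lambda>\<omega>. (S n \<omega>)\<^sup>2) + 2 * expectation (\<lambda>\<omega>. S n \<omega> * Y n \<omega>) + expectation (\<lambda>\<omega>. (Y n \<omega>)\<^sup>2)"
      using intS intc intYY[of n n] by (simp add: power2_eq_square)
    also have "\<dots> \<le> A * n + 2 * suminf a + 1" using Suc c y by linarith
    also have "\<dots> = A * Suc n" by (simp add: A_def algebra_simps)
    finally show ?case .
  qed
  have A0: "0 \<le> A" unfolding A_def using a by (simp add: suminf_nonneg)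
  \<comment> \<open>Chebyshev along the squares, where the variances are summable; bounded increments fill the gaps.\<close>
  define Z where "Z = (\<lambda>n \<omega>. (S ((Suc n)\<^sup>2) \<omega> / (Suc n)\<^sup>2)\<^sup>2)"
  have Zm[measurable]: "Z n \<in> borel_measurable M" for n unfolding Z_def by measurable
  have intZ: "integrable M (Z n)" for n
    unfolding Z_def using intS[of "(Suc n)\<^sup>2"] by (simp add: power_divide)
  have EZ: "expectation (Z n) \<le> A * inverse ((Suc n)\<^sup>2)" for n
  proof -
    have "expectation (Z n) = expectation (\<lambda>\<omega>. (S ((Suc n)\<^sup>2) \<omega>)\<^sup>2) / ((Suc n)\<^sup>2)\<^sup>2"
      unfolding Z_def by (simp add: power_divide)
    also have "\<dots> \<le> A * (Suc n)\<^sup>2 / ((Suc n)\<^sup>2)\<^sup>2" using var[of "(Suc n)\<^sup>2"] by (intro divide_right_mono) simp_all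
    also have "\<dots> = A * inverse ((Suc n)\<^sup>2)"
    proof -
      have "A * x / x\<^sup>2 = A * inverse x" if "x > 0" for x :: real
        using that by (simp add: field_simps power2_eq_square)
      from this[of "real ((Suc n)\<^sup>2)"] show ?thesis by simp
    qed
    finally show ?thesis .
  qed
  have "(\<Sum>n. \<integral>\<^sup>+\<omega>. ennreal (Z n \<omega>) \<partial>M) \<noteq> \<infinity>"
  proof -
    have "(\<integral>\<^sup>+\<omega>. ennreal (Z n \<omega>) \<partial>M) = ennreal (expectation (Z n))" for n
      by (rule nn_integral_eq_integral[OF intZ]) (simp add: Z_def)
    then have "(\<Sum>n. \<integral>\<^sup>+\<omega>. ennreal (Z n \<omega>) \<partial>M) \<le> (\<Sum>n. ennreal (A * inverse ((Suc n)\<^sup>2)))"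
      using EZ by (intro suminf_le) (auto intro!: ennreal_leI)
    also have "\<dots> = ennreal (\<Sum>n. A * inverse ((Suc n)\<^sup>2))"
    proof (rule suminf_ennreal2)
      have "summable (\<lambda>n. inverse (real (Suc n) ^ 2))"
        using inverse_power_summable[of 2, where ?'a=real]
        by (subst summable_Suc_iff[where f="\<lambda>n. inverse (real n ^ 2)"]) simp
      then show "summable (\<lambda>n. A * inverse (real ((Suc n)\<^sup>2)))"
        by (intro summable_mult) (simp only: of_nat_power)
    qed (use A0 in simp)
    finally show ?thesis by (auto simp: top_unique)
  qed
  then have "(\<integral>\<^sup>+\<omega>. (\<Sum>n. ennreal (Z n \<omega>)) \<partial>M) \<noteq> \<infinity>"
    by (subst nn_integral_suminf) auto
  then have "AE \<omega> in M. (\<Sum>n. ennreal (Z n \<omega>)) \<noteq> \<infinity>"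
    by (intro nn_integral_noteq_infinite) auto
  then have "AE \<omega> in M. (\<Sum>n. ennreal (Z n \<omega>)) \<noteq> \<infinity> \<and> \<omega> \<in> space M" by (auto intro: AE_conjI)
  then show ?thesis
  proof (rule AE_mp, intro AE_I2 impI)
    fix \<omega> assume fin: "(\<Sum>n. ennreal (Z n \<omega>)) \<noteq> \<infinity> \<and> \<omega> \<in> space M"
    have "summable (\<lambda>n. Z n \<omega>)"
      using fin by (intro summable_suminf_not_top) (auto simp: Z_def)
    then have "(\<lambda>n. sqrt (Z n \<omega>)) \<longlonglongrightarrow> sqrt 0"
      by (intro tendsto_real_sqrt summable_LIMSEQ_zero)
    then have lim: "(\<lambda>n. \<bar>S ((Suc n)\<^sup>2) \<omega> / (Suc n)\<^sup>2\<bar>) \<longlonglongrightarrow> 0"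
      unfolding Z_def by (simp add: real_sqrt_abs del: of_nat_Suc of_nat_power)
    have lim2: "(\<lambda>n. 2 / real (Suc n)) \<longlonglongrightarrow> 0"
      using LIMSEQ_Suc[OF lim_const_over_n[of 2]] .
    have lim3: "(\<lambda>n. \<bar>S ((Suc n)\<^sup>2) \<omega> / (Suc n)\<^sup>2\<bar> + 2 / real (Suc n)) \<longlonglongrightarrow> 0"
      using tendsto_add[OF lim lim2] by simp
    show "(\<lambda>n. (\<Sum>k<n. Y k \<omega>) / n) \<longlonglongrightarrow> 0"
      unfolding LIMSEQ_iff
    proof (intro allI impI)
      fix e :: real assume "0 < e"
      with lim3 obtain n0 where n0: "\<And>n. n \<ge> n0 \<Longrightarrow>
          \<bar>S ((Suc n)\<^sup>2) \<omega> / (Suc n)\<^sup>2\<bar> + 2 / real (Suc n) < e"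
        unfolding LIMSEQ_iff by fastforce
      show "\<exists>no. \<forall>m\<ge>no. norm ((\<Sum>k<m. Y k \<omega>) / real m - 0) < e"
      proof (intro exI[of _ "(Suc n0)\<^sup>2"] allI impI)
        fix m assume m: "(Suc n0)\<^sup>2 \<le> m"
        \<comment> \<open>\<open>p\<close> is the integer square root of \<open>m\<close>, so at
          most \<open>2 * p\<close> summands lie beyond the last square. The index of
          \<open>Z\<close> is shifted by one, hence \<open>p = Suc n\<close>.\<close>
        define p where "p = (LEAST p. m < (Suc p)\<^sup>2)"
        have "m < (Suc m)\<^sup>2" by (simp add: power2_eq_square)
        then have p1: "m < (Suc p)\<^sup>2" unfolding p_def by (rule LeastI)
        have "Suc n0 < Suc p"
          using le_less_trans[OF m p1] by (rule power_less_imp_less_base) simp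
        then obtain n where p: "p = Suc n" and n: "n \<ge> n0" by (cases p) auto
        have p2: "p\<^sup>2 \<le> m"
        proof (rule ccontr)
          assume "\<not> p\<^sup>2 \<le> m"
          then have "m < (Suc n)\<^sup>2" using p by simp
          then have "p \<le> n" unfolding p_def by (rule Least_le)
          then show False using p by simp
        qed
        have "(\<Sum>k<m. Y k \<omega>) = S (p\<^sup>2) \<omega> + (\<Sum>k\<in>{p\<^sup>2..<m}. Y k \<omega>)"
          unfolding S_def using sum.atLeastLessThan_concat[of 0 "p\<^sup>2" m "\<lambda>k. Y k \<omega>"] p2
          by (simp add: atLeast0LessThan)
        moreover have "\<bar>\<Sum>k\<in>{p\<^sup>2..<m}. Y k \<omega>\<bar> \<le> 2 * p"
        proof -
          have "\<bar>\<Sum>k\<in>{p\<^sup>2..<m}. Y k \<omega>\<bar> \<le> (\<Sum>k\<in>{p\<^sup>2..<m}. 1)"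
            by (intro order.trans[OF sum_abs] sum_mono bound) (use fin in auto)
          also have "\<dots> \<le> 2 * p"
          proof -
            have "m \<le> p\<^sup>2 + 2 * p" using p1 by (simp add: power2_eq_square)
            then have "real m \<le> real (p\<^sup>2 + 2 * p)" by (simp only: of_nat_le_iff)
            then show ?thesis using p2 by simp
          qed
          finally show ?thesis .
        qed
        ultimately have "\<bar>\<Sum>k<m. Y k \<omega>\<bar> \<le> \<bar>S (p\<^sup>2) \<omega>\<bar> + 2 * p" by linarith
        then have "\<bar>\<Sum>k<m. Y k \<omega>\<bar> / m \<le> (\<bar>S (p\<^sup>2) \<omega>\<bar> + 2 * p) / real (p\<^sup>2)"
          using p p2 by (intro frac_le) (auto simp del: of_nat_power)
        also have "\<dots> = \<bar>S (p\<^sup>2) \<omega> / real (p\<^sup>2)\<bar> + 2 / real p"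
        proof -
          have "real p > 0" using p by simp
          then have "2 * real p / real (p\<^sup>2) = 2 / real p" by (simp add: power2_eq_square)
          then show ?thesis by (simp only: add_divide_distrib abs_divide abs_of_nat)
        qed
        also have "\<dots> < e" using n0[OF n] p by simp
        finally show "norm ((\<Sum>k<m. Y k \<omega>) / real m - 0) < e" by simp
      qed
    qed
  qed
qed

end

text \<open>Summation by parts trades Cesaro averages for the weights 1/k. The two boundary terms,
  \<open>e / 2\<close> each, give the summand 1, and the remaining sum is at most
  \<open>e / 2\<close> times the harmonic one. The threshold is uniform in both ends of the
  window.\<close>

lemma weighted_window_of_slln:
  fixes v :: "nat \<Rightarrow> real"
  assumes lim: "(\<lambda>n. (\<Sum>k<n. v k) / n) \<longlonglongrightarrow> 0" and e: "0 < e"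
  shows "\<exists>n0. \<forall>a\<ge>n0. \<forall>b\<ge>a. \<bar>\<Sum>k\<in>{a..<b}. v k / k\<bar> \<le> e * (1 + (\<Sum>k\<in>{a..<b}. 1 / real k))"
proof -
  define S where "S = (\<lambda>n. \<Sum>k<n. v k)"
  obtain n1 where n1: "\<And>n. n \<ge> n1 \<Longrightarrow> \<bar>S n / n\<bar> < e / 2"
    using lim e unfolding LIMSEQ_iff S_def by (metis half_gt_zero diff_zero real_norm_def)
  show ?thesis
  proof (intro exI[of _ "max 1 n1"] allI impI)
    fix a b assume a: "max 1 n1 \<le> a" and ab: "a \<le> b"
    \<comment> \<open>Abel summation\<close>
    have "(\<Sum>k\<in>{a..<b}. v k / k) = S b / b - S a / a + (\<Sum>k\<in>{a..<b}. S (Suc k) / Suc k / k)"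
      using ab
    proof (induction b rule: dec_induct)
      case (step b)
      have "v b = S (Suc b) - S b" by (simp add: S_def)
      moreover have "s / x = s / (x + 1) + s / (x + 1) / x" if "x > 0" for s x :: real
        using that by (simp add: divide_simps distrib_left)
      note this[of "real b" "S (Suc b)"]
      ultimately have "v b / b = S (Suc b) / (real b + 1) - S b / b + S (Suc b) / (real b + 1) / b"
        using step a by (simp only: diff_divide_distrib)
      moreover have "real (Suc b) = real b + 1" by simp
      moreover note step
      ultimately show ?case by (simp only: sum.atLeastLessThan_Suc)
    qed simp
    moreover have "\<bar>\<Sum>k\<in>{a..<b}. S (Suc k) / Suc k / k\<bar> \<le> (\<Sum>k\<in>{a..<b}. e / 2 / real k)"
    proof (intro order.trans[OF sum_abs] sum_mono)
      fix k assume "k \<in> {a..<b}"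
      then have "\<bar>S (Suc k) / Suc k\<bar> \<le> e / 2" using n1[of "Suc k"] a by simp
      then have "\<bar>S (Suc k) / Suc k\<bar> / k \<le> e / 2 / k" by (intro divide_right_mono) auto
      then show "\<bar>S (Suc k) / Suc k / k\<bar> \<le> e / 2 / k" by (simp add: abs_divide)
    qed
    moreover have "(\<Sum>k\<in>{a..<b}. e / 2 / real k) = e / 2 * (\<Sum>k\<in>{a..<b}. 1 / real k)"
      by (simp add: sum_distrib_left)
    moreover have "\<bar>S b / b\<bar> \<le> e / 2" using n1[of b] a ab by simp
    moreover have "\<bar>S a / a\<bar> \<le> e / 2" using n1[of a] a by simp
    moreover have "e / 2 * (\<Sum>k\<in>{a..<b}. 1 / real k) \<le> e * (\<Sum>k\<in>{a..<b}. 1 / real k)"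
      using e by (intro mult_right_mono sum_nonneg) auto
    ultimately have "\<bar>\<Sum>k\<in>{a..<b}. v k / k\<bar> \<le> e + e * (\<Sum>k\<in>{a..<b}. 1 / real k)"
      by linarith
    then show "\<bar>\<Sum>k\<in>{a..<b}. v k / k\<bar> \<le> e * (1 + (\<Sum>k\<in>{a..<b}. 1 / real k))"
      by (simp add: distrib_left)
  qed
qed

section \<open>Law of large numbers for functions of regressor and noise\<close>

context prob_space
begin

text \<open>On the space \<open>N\<close> whose measurable sets are the generated events each
  coordinate is measurable, hence so is the pair. This reaches every set of the product
  \<sigma>-algebra and not only rectangles.\<close>

lemma generated_events_pair:
  fixes X :: "nat \<Rightarrow> 'a \<Rightarrow> 'b :: topological_space"
  assumes jk: "j \<in> J" "k \<in> J" and A: "A \<in> sets (borel \<Otimes>\<^sub>M borel)"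
  shows "(\<lambda>\<omega>. (X j \<omega>, X k \<omega>)) -` A \<inter> space M \<in> generated_events M X J"
proof -
  define G where "G = {X j -` S \<inter> space M | j S. j \<in> J \<and> S \<in> sets borel}"
  define N where "N = sigma (space M) G"
  have G: "G \<subseteq> Pow (space M)" by (auto simp: G_def)
  have N: "space N = space M" "sets N = generated_events M X J"
    using G by (simp_all add: N_def generated_events_def G_def[symmetric] space_measure_of sets_measure_of)
  have Xm: "X i \<in> measurable N borel" if "i \<in> J" for i
  proof (rule measurableI)
    fix S :: "'b set" assume "S \<in> sets borel"
    then have "X i -` S \<inter> space M \<in> G" using that by (auto simp: G_def)
    then show "X i -` S \<inter> space N \<in> sets N"
      unfolding N by (simp add: generated_events_def G_def sigma_sets.Basic)
  qed simp
  have "(\<lambda>\<omega>. (X j \<omega>, X k \<omega>)) \<in> measurable N (borel \<Otimes>\<^sub>M borel)"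
    using Xm jk by (intro measurable_Pair)
  from measurable_sets[OF this A] show ?thesis by (simp add: N)
qed

text \<open>Integrating out the noise reduces everything to the regressors: for \<open>j < k\<close>
  the noises at \<open>j + 1\<close> and \<open>k + 1\<close> are independent of each other, and
  jointly of the regressors. The mixed moment of \<open>h\<close> thus equals that of the averaged
  function \<open>hb\<close> at \<open>X j\<close> and \<open>X k\<close>, to which the mixing rate
  of \<open>X\<close> applies.\<close>

lemma regression_slln_unit:
  fixes X :: "nat \<Rightarrow> 'a \<Rightarrow> 'b :: topological_space" and D :: "nat \<Rightarrow> 'a \<Rightarrow> real"
    and h :: "'b \<times> real \<Rightarrow> real"
  assumes Xm: "\<And>j. 1 \<le> j \<Longrightarrow> X j \<in> borel_measurable M"
    and Xlaw: "\<And>k. 1 \<le> k \<Longrightarrow> distr M borel (X k) = \<mu>"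
    and Dlaw: "\<And>k. 2 \<le> k \<Longrightarrow> distr M borel (D k) = \<nu>"
    and Dind: "indep_vars (\<lambda>_. borel) D {2..}"
    and XD: "indep_set (generated_events M X {1..}) (generated_events M D {2..})"
    and rate: "0 < C" "0 < \<rho>" "\<rho> < 1" "\<And>k. 1 \<le> k \<Longrightarrow> alpha_coeff M X k \<le> C * \<rho> ^ k"
    and hm[measurable]: "h \<in> borel_measurable (borel \<Otimes>\<^sub>M borel)"
    and h01: "\<And>z. 0 \<le> h z \<and> h z \<le> 1"
  defines "m \<equiv> \<integral>x. \<integral>t. h (x, t) \<partial>\<nu> \<partial>\<mu>"
  shows "AE \<omega> in M. (\<lambda>n. (\<Sum>k<n. of_bool (1 \<le> k) * (h (X k \<omega>, D (k + 1) \<omega>) - m)) / n) \<longlonglongrightarrow> 0"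
proof -
  have Dm: "D j \<in> borel_measurable M" if "2 \<le> j" for j
    using Dind that by (auto simp: indep_vars_def)
  interpret \<nu>: prob_space \<nu>
    using Dlaw[of 2] Dm[of 2] by (metis order_refl prob_space_distr)
  interpret \<mu>: prob_space \<mu>
    using Xlaw[of 1] Xm[of 1] by (metis order_refl prob_space_distr)
  have s\<nu>[measurable_cong, simp]: "sets \<nu> = sets borel" using Dlaw[of 2] by (metis order_refl sets_distr)
  have s\<mu>[measurable_cong, simp]: "sets \<mu> = sets borel" using Xlaw[of 1] by (metis order_refl sets_distr)
  define hb where "hb = (\<lambda>x. \<integral>t. h (x, t) \<partial>\<nu>)"
  have hbm[measurable]: "hb \<in> borel_measurable borel" unfolding hb_def by measurable
  have hint: "integrable \<nu> (\<lambda>t. h (x, t))" for x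
    by (rule \<nu>.integrable_const_bound[where B=1]) (use h01 in auto)
  have hb01: "0 \<le> hb x \<and> hb x \<le> 1" for x
  proof -
    have "hb x \<le> (\<integral>t. 1 \<partial>\<nu>)" unfolding hb_def by (rule integral_mono) (use h01 hint in auto)
    then show ?thesis using h01 by (auto simp: hb_def \<nu>.prob_space intro!: integral_nonneg_AE)
  qed
  have Ehb: "expectation (\<lambda>\<omega>. hb (X k \<omega>)) = m" if "1 \<le> k" for k
    using Xlaw[OF that] Xm[OF that] by (simp add: m_def hb_def[symmetric] integral_distr[symmetric])
  have XDprod: "prob (A \<inter> B) = prob A * prob B"
    if "A \<in> generated_events M X {1..}" "B \<in> generated_events M D {2..}" for A B
    using indep_setD[OF XD that] .
  have gX: "X k -` S \<inter> space M \<in> generated_events M X {1..}" if "1 \<le> k" "S \<in> sets borel" for k S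
    using that unfolding generated_events_def by (intro sigma_sets.Basic) auto
  have gD: "D k -` S \<inter> space M \<in> generated_events M D {2..}" if "2 \<le> k" "S \<in> sets borel" for k S
    using that unfolding generated_events_def by (intro sigma_sets.Basic) auto
  have habs: "\<bar>h z\<bar> \<le> 1" for z using h01[of z] by auto
  have Eh: "expectation (\<lambda>\<omega>. h (X k \<omega>, D (k + 1) \<omega>)) = m" if k: "1 \<le> k" for k
  proof -
    have "expectation (\<lambda>\<omega>. h (X k \<omega>, D (k + 1) \<omega>)) =
        expectation (\<lambda>\<omega>. \<integral>v. h (X k \<omega>, v) \<partial>distr M borel (D (k + 1)))"
      using k by (intro expectation_indep_pair[where C=1 and S=borel] Xm Dm XDprod gX gD hm habs) auto
    then show ?thesis using k Dlaw[of "k + 1"] Ehb[OF k] by (simp add: hb_def)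
  qed
  have Ehh: "expectation (\<lambda>\<omega>. h (X j \<omega>, D (j + 1) \<omega>) * h (X k \<omega>, D (k + 1) \<omega>)) =
      expectation (\<lambda>\<omega>. hb (X j \<omega>) * hb (X k \<omega>))" if j: "1 \<le> j" and jk: "j < k" for j k
  proof -
    have k: "1 \<le> k" using j jk by simp
    have [measurable]: "X j \<in> borel_measurable M" "X k \<in> borel_measurable M"
      "D (j + 1) \<in> borel_measurable M" "D (k + 1) \<in> borel_measurable M"
      "D (Suc j) \<in> borel_measurable M" "D (Suc k) \<in> borel_measurable M"
      using Xm[OF j] Xm[OF k] Dm[of "j + 1"] Dm[of "k + 1"] j k by auto
    let ?U = "\<lambda>\<omega>. (X j \<omega>, X k \<omega>)" and ?V = "\<lambda>\<omega>. (D (j + 1) \<omega>, D (k + 1) \<omega>)"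
    let ?f = "\<lambda>z. h (fst (fst z), fst (snd z)) * h (snd (fst z), snd (snd z))"
    \<comment> \<open>For frozen regressors the two noises sit at the distinct times
      \<open>j + 1\<close> and \<open>k + 1\<close>, so the mean of the product factors.\<close>
    have inner: "(\<integral>v. h (x, fst v) * h (x', snd v) \<partial>distr M (borel \<Otimes>\<^sub>M borel) ?V) = hb x * hb x'" for x x'
    proof -
      have "(\<integral>v. h (x, fst v) * h (x', snd v) \<partial>distr M (borel \<Otimes>\<^sub>M borel) ?V) =
          expectation (\<lambda>\<omega>. h (x, D (j + 1) \<omega>) * h (x', D (k + 1) \<omega>))"
        by (subst integral_distr) simp_all
      also have "\<dots> = expectation (\<lambda>\<omega>. (\<lambda>z. h (x, fst z) * h (x', snd z)) (D (j + 1) \<omega>, D (k + 1) \<omega>))"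
        by simp
      also have "\<dots> = expectation (\<lambda>\<omega>. \<integral>t. (\<lambda>z. h (x, fst z) * h (x', snd z)) (D (j + 1) \<omega>, t) \<partial>distr M borel (D (k + 1)))"
      proof (rule expectation_indep_pair[where C=1 and S=borel])
        fix A B :: "real set" assume AB: "A \<in> sets borel" "B \<in> sets borel"
        define Y where "Y = (\<lambda>i. if i = j + 1 then A else B)"
        have "prob (\<Inter>i\<in>{j+1,k+1}. D i -` Y i \<inter> space M) = (\<Prod>i\<in>{j+1,k+1}. prob (D i -` Y i \<inter> space M))"
          by (rule indep_varsD[OF Dind]) (use AB j jk in \<open>auto simp: Y_def\<close>)
        then show "prob ((D (j + 1) -` A \<inter> space M) \<inter> (D (k + 1) -` B \<inter> space M)) =
            prob (D (j + 1) -` A \<inter> space M) * prob (D (k + 1) -` B \<inter> space M)"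
          using jk by (simp add: Y_def)
      qed (use habs in \<open>auto simp: abs_mult mult_le_one\<close>)
      also have "\<dots> = expectation (\<lambda>\<omega>. h (x, D (j + 1) \<omega>) * hb x')"
        using Dlaw[of "k + 1"] k by (simp add: hb_def)
      also have "\<dots> = expectation (\<lambda>\<omega>. h (x, D (j + 1) \<omega>)) * hb x'" by simp
      also have "expectation (\<lambda>\<omega>. h (x, D (j + 1) \<omega>)) = hb x"
        unfolding hb_def using j by (subst Dlaw[of "j + 1", symmetric]) (simp_all add: integral_distr)
      finally show ?thesis .
    qed
    have "expectation (\<lambda>\<omega>. h (X j \<omega>, D (j + 1) \<omega>) * h (X k \<omega>, D (k + 1) \<omega>)) = expectation (\<lambda>\<omega>. ?f (?U \<omega>, ?V \<omega>))"
      by simp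
    also have "\<dots> = expectation (\<lambda>\<omega>. \<integral>v. ?f (?U \<omega>, v) \<partial>distr M (borel \<Otimes>\<^sub>M borel) ?V)"
    proof (rule expectation_indep_pair[where C=1 and S="borel \<Otimes>\<^sub>M borel"])
      fix A B assume AB: "A \<in> sets (borel \<Otimes>\<^sub>M borel :: ('b \<times> 'b) measure)" "B \<in> sets (borel \<Otimes>\<^sub>M borel :: (real \<times> real) measure)"
      show "prob ((?U -` A \<inter> space M) \<inter> (?V -` B \<inter> space M)) = prob (?U -` A \<inter> space M) * prob (?V -` B \<inter> space M)"
        by (intro XDprod generated_events_pair AB) (use j k in auto)
    qed (use habs in \<open>auto simp: abs_mult mult_le_one\<close>)
    also have "\<dots> = expectation (\<lambda>\<omega>. hb (X j \<omega>) * hb (X k \<omega>))" by (simp only: inner fst_conv snd_conv)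
    finally show ?thesis .
  qed
  have m01: "0 \<le> m \<and> m \<le> 1"
  proof -
    have "integrable \<mu> hb" by (rule \<mu>.integrable_const_bound[where B=1]) (use hb01 in auto)
    then have "m \<le> (\<integral>x. 1 \<partial>\<mu>)" unfolding m_def hb_def[symmetric] by (rule integral_mono) (use hb01 in auto)
    then show ?thesis using hb01 by (auto simp: m_def hb_def[symmetric] \<mu>.prob_space intro!: integral_nonneg_AE)
  qed
  \<comment> \<open>Index 0 is unconstrained; the factor \<open>of_bool\<close> replaces its summand
    by 0.\<close>
  let ?Y = "\<lambda>k \<omega>. of_bool (1 \<le> k) * (h (X k \<omega>, D (k + 1) \<omega>) - m)"
  let ?a = "\<lambda>k. C * \<rho> ^ k"
  show ?thesis
  proof (rule slln_of_summable_covariance[where a="?a"])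
    show "?Y k \<in> borel_measurable M" for k
    proof (cases "1 \<le> k")
      case True
      then have [measurable]: "X k \<in> borel_measurable M" "D (k + 1) \<in> borel_measurable M"
        using Xm Dm[of "k + 1"] by auto
      show ?thesis by measurable
    qed simp
    show "\<bar>?Y k \<omega>\<bar> \<le> 1" for k \<omega> using h01[of "(X k \<omega>, D (k + 1) \<omega>)"] m01 by (cases "1 \<le> k") auto
    show "summable ?a" using rate by (intro summable_mult summable_geometric) auto
    show "0 \<le> ?a k" for k using rate by simp
    show "expectation (\<lambda>\<omega>. ?Y j \<omega> * ?Y k \<omega>) \<le> ?a (k - j)" if jk: "j < k" for j k
    proof (cases "1 \<le> j")
      case True
      then have k: "1 \<le> k" using jk by simp
      have m: "(\<lambda>\<omega>. h (X i \<omega>, D (i + 1) \<omega>)) \<in> borel_measurable M" if "1 \<le> i" for i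
      proof -
        have [measurable]: "X i \<in> borel_measurable M" "D (i + 1) \<in> borel_measurable M"
          using Xm Dm[of "i + 1"] that by auto
        show ?thesis by measurable
      qed
      have i1: "integrable M (\<lambda>\<omega>. h (X i \<omega>, D (i + 1) \<omega>))" if "1 \<le> i" for i
        by (rule integrable_const_bound[where B=1]) (use habs m[OF that] in auto)
      have i2: "integrable M (\<lambda>\<omega>. h (X j \<omega>, D (j + 1) \<omega>) * h (X k \<omega>, D (k + 1) \<omega>))"
        by (rule integrable_const_bound[where B=1])
          (use habs m[OF k] m[OF True] in \<open>auto simp: abs_mult mult_le_one\<close>)
      have "expectation (\<lambda>\<omega>. ?Y j \<omega> * ?Y k \<omega>) = expectation (\<lambda>\<omega>. h (X j \<omega>, D (j + 1) \<omega>) * h (X k \<omega>, D (k + 1) \<omega>)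
          - m * h (X j \<omega>, D (j + 1) \<omega>) - m * h (X k \<omega>, D (k + 1) \<omega>) + m * m)"
        using True k by (simp add: algebra_simps)
      also have "\<dots> = expectation (\<lambda>\<omega>. h (X j \<omega>, D (j + 1) \<omega>) * h (X k \<omega>, D (k + 1) \<omega>)) - m * m"
        using i1[OF k] i1[OF True] i2 Eh[OF k] Eh[OF True] by (simp add: prob_space)
      also have "\<dots> = expectation (\<lambda>\<omega>. hb (X j \<omega>) * hb (X k \<omega>)) - expectation (\<lambda>\<omega>. hb (X j \<omega>)) * expectation (\<lambda>\<omega>. hb (X k \<omega>))"
        using Ehh[OF True jk] Ehb True k by simp
      also have "\<dots> \<le> alpha_coeff M X (k - j)"
        using alpha_coeff_covariance[where X=X, OF Xm True jk hbm hb01] by linarith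
      also have "\<dots> \<le> ?a (k - j)" using jk by (intro rate) simp
      finally show ?thesis .
    qed (use rate in simp)
  qed
qed

text \<open>An affine change of \<open>h\<close> maps it into the unit interval; the constant
  \<open>c + 1\<close> keeps the divisor positive also for \<open>c = 0\<close>. The null set
  depends on \<open>h\<close> but not on \<open>e\<close> or the window.\<close>

lemma regression_window_law:
  fixes X :: "nat \<Rightarrow> 'a \<Rightarrow> 'b :: topological_space" and D :: "nat \<Rightarrow> 'a \<Rightarrow> real"
    and h :: "'b \<times> real \<Rightarrow> real"
  assumes Xm: "\<And>j. 1 \<le> j \<Longrightarrow> X j \<in> borel_measurable M"
    and Xlaw: "\<And>k. 1 \<le> k \<Longrightarrow> distr M borel (X k) = \<mu>"
    and Dlaw: "\<And>k. 2 \<le> k \<Longrightarrow> distr M borel (D k) = \<nu>"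
    and Dind: "indep_vars (\<lambda>_. borel) D {2..}"
    and XD: "indep_set (generated_events M X {1..}) (generated_events M D {2..})"
    and rate: "0 < C" "0 < \<rho>" "\<rho> < 1" "\<And>k. 1 \<le> k \<Longrightarrow> alpha_coeff M X k \<le> C * \<rho> ^ k"
    and hm[measurable]: "h \<in> borel_measurable (borel \<Otimes>\<^sub>M borel)"
    and hb: "\<And>z. \<bar>h z\<bar> \<le> c"
  defines "m \<equiv> \<integral>x. \<integral>t. h (x, t) \<partial>\<nu> \<partial>\<mu>"
  shows "AE \<omega> in M. \<forall>e>0. \<exists>n0\<ge>1. \<forall>a\<ge>n0. \<forall>b\<ge>a.
    \<bar>\<Sum>k\<in>{a..<b}. (h (X k \<omega>, D (k + 1) \<omega>) - m) / k\<bar> \<le> e * (1 + (\<Sum>k\<in>{a..<b}. 1 / real k))"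
proof -
  define c' where "c' = c + 1"
  have "0 \<le> c" using hb[of undefined] by linarith
  then have c': "0 < c'" by (simp add: c'_def)
  define g where "g = (\<lambda>z. (h z + c') / (2 * c'))"
  have gm: "g \<in> borel_measurable (borel \<Otimes>\<^sub>M borel)" unfolding g_def by measurable
  have g01: "0 \<le> g z \<and> g z \<le> 1" for z
    using hb[of z] c' unfolding g_def c'_def by (auto simp: divide_simps)
  have Dm: "D 2 \<in> borel_measurable M"
    using Dind by (auto simp: indep_vars_def)
  interpret \<nu>: prob_space \<nu>
    using Dlaw[of 2] Dm by (metis order_refl prob_space_distr)
  interpret \<mu>: prob_space \<mu>
    using Xlaw[of 1] Xm[of 1] by (metis order_refl prob_space_distr)
  have s\<nu>[measurable_cong, simp]: "sets \<nu> = sets borel" using Dlaw[of 2] by (metis order_refl sets_distr)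
  have s\<mu>[measurable_cong, simp]: "sets \<mu> = sets borel" using Xlaw[of 1] by (metis order_refl sets_distr)
  have hint: "integrable \<nu> (\<lambda>t. h (x, t))" for x
    by (rule \<nu>.integrable_const_bound[where B=c]) (use hb in auto)
  have bd: "\<bar>\<integral>t. h (x, t) \<partial>\<nu>\<bar> \<le> c" for x
  proof -
    have "\<bar>\<integral>t. h (x, t) \<partial>\<nu>\<bar> \<le> (\<integral>t. \<bar>h (x, t)\<bar> \<partial>\<nu>)" by (rule integral_abs_bound)
    also have "\<dots> \<le> (\<integral>t. c \<partial>\<nu>)" by (rule integral_mono) (use hint hb in auto)
    finally show ?thesis by (simp add: \<nu>.prob_space)
  qed
  have int2: "integrable \<mu> (\<lambda>x. \<integral>t. h (x, t) \<partial>\<nu>)"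
    by (rule \<mu>.integrable_const_bound[where B=c]) (use bd in auto)
  have mg: "(\<integral>x. \<integral>t. g (x, t) \<partial>\<nu> \<partial>\<mu>) = (m + c') / (2 * c')"
    unfolding g_def m_def using hint int2 by (simp add: \<nu>.prob_space \<mu>.prob_space)
  have "AE \<omega> in M. (\<lambda>n. (\<Sum>k<n. of_bool (1 \<le> k) * (g (X k \<omega>, D (k + 1) \<omega>) - (m + c') / (2 * c'))) / n) \<longlonglongrightarrow> 0"
    using regression_slln_unit[where X=X and D=D, OF Xm Xlaw Dlaw Dind XD rate gm g01] unfolding mg .
  then show ?thesis
  proof (rule AE_mp, intro AE_I2 impI allI)
    fix \<omega> and e :: real
    let ?v = "\<lambda>k. of_bool (1 \<le> k) * (g (X k \<omega>, D (k + 1) \<omega>) - (m + c') / (2 * c'))"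
    assume lim: "(\<lambda>n. (\<Sum>k<n. ?v k) / n) \<longlonglongrightarrow> 0" and e: "0 < e"
    obtain n0 where n0: "\<And>a b. a \<ge> n0 \<Longrightarrow> b \<ge> a \<Longrightarrow>
        \<bar>\<Sum>k\<in>{a..<b}. ?v k / k\<bar> \<le> e / (2 * c') * (1 + (\<Sum>k\<in>{a..<b}. 1 / real k))"
      using weighted_window_of_slln[OF lim, of "e / (2 * c')"] e c' by auto
    show "\<exists>n0\<ge>1. \<forall>a\<ge>n0. \<forall>b\<ge>a.
       \<bar>\<Sum>k\<in>{a..<b}. (h (X k \<omega>, D (k + 1) \<omega>) - m) / k\<bar> \<le> e * (1 + (\<Sum>k\<in>{a..<b}. 1 / real k))"
    proof (intro exI[of _ "max 1 n0"] conjI allI impI)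
      fix a b assume a: "max 1 n0 \<le> a" and ab: "a \<le> b"
      have "(\<Sum>k\<in>{a..<b}. (h (X k \<omega>, D (k + 1) \<omega>) - m) / k) = (\<Sum>k\<in>{a..<b}. 2 * c' * (?v k / k))"
      proof (rule sum.cong)
        fix k assume "k \<in> {a..<b}"
        then have "1 \<le> k" using a by simp
        have "g z - (m + c') / (2 * c') = (h z - m) / (2 * c')" for z
          by (simp add: g_def diff_divide_distrib[symmetric])
        then show "(h (X k \<omega>, D (k + 1) \<omega>) - m) / k = 2 * c' * (?v k / k)"
          using \<open>1 \<le> k\<close> c' by simp
      qed simp
      also have "\<dots> = 2 * c' * (\<Sum>k\<in>{a..<b}. ?v k / k)" by (simp add: sum_distrib_left)
      also have "\<bar>\<dots>\<bar> = 2 * c' * \<bar>\<Sum>k\<in>{a..<b}. ?v k / k\<bar>" using c' by (simp add: abs_mult)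
      also have "\<dots> \<le> 2 * c' * (e / (2 * c') * (1 + (\<Sum>k\<in>{a..<b}. 1 / real k)))"
        using n0[of a b] a ab c' by (intro mult_left_mono) auto
      also have "\<dots> = e * (1 + (\<Sum>k\<in>{a..<b}. 1 / real k))" using c' by simp
      finally show "\<bar>\<Sum>k\<in>{a..<b}. (h (X k \<omega>, D (k + 1) \<omega>) - m) / k\<bar> \<le> e * (1 + (\<Sum>k\<in>{a..<b}. 1 / real k))" .
    qed simp
  qed
qed

end

section \<open>Averaged drift of the sign score\<close>

text \<open>For \<open>z = (\<phi>, d)\<close> and the error
  \<open>x = \<theta> - \<theta>star\<close> this is the correction sign of the algorithm. The
  threshold equals the prediction, so the true parameter drops out in these coordinates.\<close>

definition sign_score :: "'b::real_inner \<times> real \<Rightarrow> 'b \<Rightarrow> real" where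
  "sign_score z x = 1 - 2 * of_bool (snd z < fst z \<bullet> x)"

text \<open>The signs at \<open>z\<close> and \<open>x0\<close> can differ only if \<open>t\<close>
  lies between \<open>p \<bullet> z\<close> and \<open>p \<bullet> x0\<close>, hence within
  \<open>2 * K * \<delta>\<close> of the latter; the change then costs at most
  \<open>2 * K * R\<close>. Moving the factor from \<open>x0\<close> to \<open>x\<close> costs
  \<open>K * \<delta>\<close>.\<close>

lemma sign_score_perturb:
  fixes p x z x0 :: "'b::real_inner"
  assumes p: "norm p \<le> K" and x0: "norm x0 \<le> R" and x: "norm (x - x0) \<le> \<delta>" and z: "norm (z - x) \<le> \<delta>"
  shows "(p \<bullet> x) * sign_score (p, t) z \<le>
    (p \<bullet> x0) * sign_score (p, t) x0 + K * \<delta> + 2 * K * R * of_bool (\<bar>t - p \<bullet> x0\<bar> \<le> 2 * K * \<delta>)"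
proof -
  have K0: "0 \<le> K" using p norm_ge_zero order_trans by blast
  have cs: "\<bar>p \<bullet> v\<bar> \<le> K * c" if "norm v \<le> c" for v c
    using Cauchy_Schwarz_ineq2[of p v] mult_mono[OF p that K0 norm_ge_zero] by linarith
  have 1: "\<bar>p \<bullet> x - p \<bullet> x0\<bar> \<le> K * \<delta>" using cs[OF x] by (simp add: inner_diff_right)
  have 2: "\<bar>p \<bullet> z - p \<bullet> x\<bar> \<le> K * \<delta>" using cs[OF z] by (simp add: inner_diff_right)
  have 3: "\<bar>p \<bullet> x0\<bar> \<le> K * R" using cs[OF x0] .
  show ?thesis
  proof (cases "\<bar>t - p \<bullet> x0\<bar> \<le> 2 * K * \<delta>")
    case True
    then show ?thesis using 1 3 unfolding sign_score_def by (simp add: of_bool_def) linarith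
  next
    case False
    then have "t < p \<bullet> z \<longleftrightarrow> t < p \<bullet> x0" using 1 2 by linarith
    then show ?thesis using 1 False unfolding sign_score_def by (simp add: of_bool_def) linarith
  qed
qed

text \<open>
  By \<open>sign_score_perturb\<close>, this single function of the data dominates the discontinuous drift
  \<open>(p \<bullet> x') * sign_score (p, t) z\<close> for all \<open>x'\<close> and \<open>z\<close> near \<open>x\<close>, so that the law of large numbers
  for it controls the drift uniformly along a moving iterate.
\<close>

definition score_majorant :: "real \<Rightarrow> real \<Rightarrow> 'b::real_inner \<Rightarrow> real \<Rightarrow> 'b \<times> real \<Rightarrow> real" where
  "score_majorant K R x \<delta> = (\<lambda>(p, t). of_bool (norm p \<le> K) *
     ((p \<bullet> x) * sign_score (p, t) x + K * \<delta> + 2 * K * R * of_bool (\<bar>t - p \<bullet> x\<bar> \<le> 2 * K * \<delta>)))"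

lemma borel_measurable_sign_score[measurable]:
  "(\<lambda>z. sign_score z x) \<in> borel_measurable (borel \<Otimes>\<^sub>M (borel :: real measure))" for x :: "real ^ 'l"
  unfolding sign_score_def by measurable

lemma borel_measurable_score_majorant[measurable]:
  "score_majorant K R x \<delta> \<in> borel_measurable (borel \<Otimes>\<^sub>M borel)" for x :: "real ^ 'l"
  unfolding score_majorant_def by measurable

lemma score_majorant_bound:
  assumes "0 \<le> K" "norm x \<le> R" "0 \<le> \<delta>"
  shows "\<bar>score_majorant K R x \<delta> z\<bar> \<le> 3 * (K * R) + K * \<delta>"
proof (cases z)
  case (Pair p t)
  have R: "0 \<le> R" using assms(2) norm_ge_zero order_trans by blast
  have KR: "0 \<le> K * R" "0 \<le> K * \<delta>" using assms R by auto
  show ?thesis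
  proof (cases "norm p \<le> K")
    case True
    then have "\<bar>p \<bullet> x\<bar> \<le> K * R"
      using Cauchy_Schwarz_ineq2[of p x] mult_mono[OF True assms(2) assms(1) norm_ge_zero] by linarith
    then show ?thesis using KR unfolding Pair score_majorant_def sign_score_def
      by (simp add: of_bool_def) linarith
  next
    case False
    then show ?thesis using KR unfolding Pair score_majorant_def by simp
  qed
qed

text \<open>As \<delta> tends to 0, dominated convergence takes the mean of the majorant to the mean
  drift at \<open>x\<close>: the boundary indicator dies out because the noise has no atoms. The
  limit is strictly negative, so some positive \<delta> already works.\<close>

lemma mean_score_negative:
  fixes x :: "real ^ 'l" and \<mu> :: "'n::finite \<Rightarrow> (real ^ 'l) measure" and \<nu> :: "'n \<Rightarrow> real measure"
  assumes p\<mu>: "\<And>i. prob_space (\<mu> i)" and s\<mu>: "\<And>i. sets (\<mu> i) = sets borel"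
    and p\<nu>: "\<And>i. prob_space (\<nu> i)" and s\<nu>: "\<And>i. sets (\<nu> i) = sets borel"
    and noatom: "\<And>i u. AE t in \<nu> i. t \<noteq> u"
    and median_pos: "\<And>i u. 0 < u \<Longrightarrow> 1 / 2 < measure (\<nu> i) {..<u}"
    and median_neg: "\<And>i u. u < 0 \<Longrightarrow> measure (\<nu> i) {..<u} < 1 / 2"
    and bdd: "\<And>i. AE p in \<mu> i. norm p \<le> K" and K: "0 \<le> K"
    and exc: "\<exists>i. \<not> (AE p in \<mu> i. p \<bullet> x = 0)"
    and xR: "norm x \<le> R"
  shows "\<exists>\<delta>>0. (\<Sum>i\<in>UNIV. \<integral>p. \<integral>t. score_majorant K R x \<delta> (p, t) \<partial>\<nu> i \<partial>\<mu> i) < 0"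
proof -
  define \<delta> where "\<delta> = (\<lambda>n. 1 / real (Suc n))"
  have \<delta>lim: "\<delta> \<longlonglongrightarrow> 0" unfolding \<delta>_def by (rule LIMSEQ_Suc[OF lim_const_over_n])
  have \<delta>01: "0 < \<delta> n \<and> \<delta> n \<le> 1" for n by (simp add: \<delta>_def)
  define C where "C = 3 * (K * R) + K"
  have hC: "\<bar>score_majorant K R x (\<delta> n) z\<bar> \<le> C" for n z
    using score_majorant_bound[of K x R "\<delta> n" z] K xR \<delta>01[of n] mult_left_mono[of "\<delta> n" 1 K] by (auto simp: C_def)
  define g where "g = (\<lambda>p t. of_bool (norm p \<le> K) * ((p \<bullet> x) * sign_score (p, t) x))"
  define G where "G = (\<lambda>i p. \<integral>t. g p t \<partial>\<nu> i)"
  define H where "H = (\<lambda>i n p. \<integral>t. score_majorant K R x (\<delta> n) (p, t) \<partial>\<nu> i)"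
  have gm[measurable]: "(\<lambda>(p, t). g p t) \<in> borel_measurable (borel \<Otimes>\<^sub>M borel)"
    unfolding g_def sign_score_def by measurable
  have gm1[measurable]: "g p \<in> borel_measurable borel" for p
    unfolding g_def sign_score_def by measurable
  have fact: "(\<lambda>n. \<integral>p. H i n p \<partial>\<mu> i) \<longlonglongrightarrow> (\<integral>p. G i p \<partial>\<mu> i) \<and> (\<integral>p. G i p \<partial>\<mu> i) \<le> 0 \<and>
     ((\<integral>p. G i p \<partial>\<mu> i) = 0 \<longrightarrow> (AE p in \<mu> i. p \<bullet> x = 0))" for i
  proof -
    interpret \<mu>: prob_space "\<mu> i" by fact
    interpret \<nu>: prob_space "\<nu> i" by fact
    note [measurable_cong] = s\<mu>[of i] s\<nu>[of i]
    have Hm[measurable]: "H i n \<in> borel_measurable borel" for n unfolding H_def by measurable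
    have Gm[measurable]: "G i \<in> borel_measurable borel" unfolding G_def by measurable
    have C0: "0 \<le> C" using hC[of 0 undefined] by linarith
    have Hint: "integrable (\<nu> i) (\<lambda>t. score_majorant K R x (\<delta> n) (p, t))" for n p
      by (rule \<nu>.integrable_const_bound[where B=C]) (use hC in auto)
    have Hb: "\<bar>H i n p\<bar> \<le> C" for n p
    proof -
      have "\<bar>H i n p\<bar> \<le> (\<integral>t. \<bar>score_majorant K R x (\<delta> n) (p, t)\<bar> \<partial>\<nu> i)"
        unfolding H_def by (rule integral_abs_bound)
      also have "\<dots> \<le> (\<integral>t. C \<partial>\<nu> i)" by (rule integral_mono) (use Hint hC in auto)
      finally show ?thesis by (simp add: \<nu>.prob_space)
    qed
    have HG: "(\<lambda>n. H i n p) \<longlonglongrightarrow> G i p" for p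
      unfolding H_def G_def
    proof (rule integral_dominated_convergence[where w="\<lambda>_. C"])
      show "AE t in \<nu> i. (\<lambda>n. score_majorant K R x (\<delta> n) (p, t)) \<longlonglongrightarrow> g p t"
        using noatom[of "p \<bullet> x" i]
      proof (eventually_elim)
        fix t assume t: "t \<noteq> p \<bullet> x"
        have "(\<lambda>n. 2 * K * \<delta> n) \<longlonglongrightarrow> 2 * K * 0" by (intro tendsto_intros \<delta>lim)
        then have "\<forall>\<^sub>F n in sequentially. 2 * K * \<delta> n < \<bar>t - p \<bullet> x\<bar>"
          using t by (intro order_tendstoD) auto
        then have ev: "\<forall>\<^sub>F n in sequentially. (of_bool (\<bar>t - p \<bullet> x\<bar> \<le> 2 * K * \<delta> n) :: real) = 0"
          by eventually_elim auto
        have "(\<lambda>n. score_majorant K R x (\<delta> n) (p, t)) \<longlonglongrightarrow>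
            of_bool (norm p \<le> K) * ((p \<bullet> x) * sign_score (p, t) x + K * 0 + 2 * K * R * 0)"
          unfolding score_majorant_def prod.case
          by (intro tendsto_intros \<delta>lim tendsto_eventually[OF ev])
        then show "(\<lambda>n. score_majorant K R x (\<delta> n) (p, t)) \<longlonglongrightarrow> g p t"
          by (simp add: g_def)
      qed
    qed (use hC in auto)
    have lim: "(\<lambda>n. \<integral>p. H i n p \<partial>\<mu> i) \<longlonglongrightarrow> (\<integral>p. G i p \<partial>\<mu> i)"
      by (rule integral_dominated_convergence[where w="\<lambda>_. C"]) (use HG Hb in auto)
    \<comment> \<open>Averaging over the noise turns the sign into
      \<open>1 - 2 * \<nu>.prob {..<p \<bullet> x}\<close>, whose sign is opposite to that of
      \<open>p \<bullet> x\<close> by the strict median conditions.\<close>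
    have Gform: "G i p = of_bool (norm p \<le> K) * ((p \<bullet> x) * (1 - 2 * \<nu>.prob {..<p \<bullet> x}))" for p
    proof -
      have eq: "g p t = of_bool (norm p \<le> K) * ((p \<bullet> x) * (1 - 2 * indicator {..<p \<bullet> x} t))" for t
        by (simp add: g_def sign_score_def indicator_def of_bool_def)
      show ?thesis unfolding G_def eq by (simp add: \<nu>.prob_space \<nu>.emeasure_eq_measure)
    qed
    have Gneg: "G i p \<le> 0 \<and> (G i p = 0 \<longrightarrow> norm p \<le> K \<longrightarrow> p \<bullet> x = 0)" for p
    proof -
      consider "p \<bullet> x = 0" | "0 < p \<bullet> x" | "p \<bullet> x < 0" by linarith
      then have "p \<bullet> x = 0 \<or> (p \<bullet> x) * (1 - 2 * \<nu>.prob {..<p \<bullet> x}) < 0"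
      proof cases
        case 2
        then show ?thesis using median_pos[OF 2, of i] by (intro disjI2 mult_pos_neg) auto
      next
        case 3
        then show ?thesis using median_neg[OF 3, of i] by (intro disjI2 mult_neg_pos) auto
      qed simp
      then show ?thesis unfolding Gform by auto
    qed
    have Gb: "\<bar>G i p\<bar> \<le> C" for p
      using tendsto_upperbound[OF tendsto_rabs[OF HG[of p]], of C] Hb by simp
    have Gint: "integrable (\<mu> i) (G i)" by (rule \<mu>.integrable_const_bound[where B=C]) (use Gb in auto)
    have "(\<integral>p. - G i p \<partial>\<mu> i) \<ge> 0" using Gneg by (intro integral_nonneg_AE) auto
    then have neg: "(\<integral>p. G i p \<partial>\<mu> i) \<le> 0" by simp
    moreover have "AE p in \<mu> i. p \<bullet> x = 0" if z: "(\<integral>p. G i p \<partial>\<mu> i) = 0"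
    proof -
      have "AE p in \<mu> i. - G i p = 0"
        using integral_nonneg_eq_0_iff_AE[of "\<mu> i" "\<lambda>p. - G i p"] Gint Gneg z by simp
      then show ?thesis using bdd[of i] by eventually_elim (use Gneg in auto)
    qed
    ultimately show ?thesis using lim by blast
  qed
  have "(\<Sum>i\<in>UNIV. \<integral>p. G i p \<partial>\<mu> i) < 0"
  proof -
    obtain i where "\<not> (AE p in \<mu> i. p \<bullet> x = 0)" using exc by blast
    then have i: "(\<integral>p. G i p \<partial>\<mu> i) < 0" using fact[of i] by linarith
    have "(\<Sum>i\<in>UNIV. \<integral>p. G i p \<partial>\<mu> i) < (\<Sum>i\<in>(UNIV::'n set). 0)"
      by (rule sum_strict_mono_ex1) (use fact i in auto)
    then show ?thesis by simp
  qed
  moreover have "(\<lambda>n. \<Sum>i\<in>UNIV. \<integral>p. H i n p \<partial>\<mu> i) \<longlonglongrightarrow> (\<Sum>i\<in>UNIV. \<integral>p. G i p \<partial>\<mu> i)"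
    by (intro tendsto_sum) (use fact in blast)
  ultimately have "\<forall>\<^sub>F n in sequentially. (\<Sum>i\<in>UNIV. \<integral>p. H i n p \<partial>\<mu> i) < 0"
    by (intro order_tendstoD)
  then obtain n where "(\<Sum>i\<in>UNIV. \<integral>p. H i n p \<partial>\<mu> i) < 0"
    by (auto simp: eventually_sequentially)
  then show ?thesis using \<delta>01[of n] unfolding H_def by (intro exI[of _ "\<delta> n"]) auto
qed

text \<open>
  Here \<open>z i k\<close> stands for the moving iterate of agent \<open>i\<close>, and \<open>x\<close> for its approximate location during
  a window of harmonic length at least \<open>T\<close>. The rate \<open>c\<close> and the radius \<open>\<rho>\<close> must not depend on \<open>T\<close>, since
  \<open>T\<close> is later chosen small in terms of both.
\<close>

definition drift_window :: "('n::finite \<Rightarrow> nat \<Rightarrow> 'b::real_inner) \<Rightarrow> ('n \<Rightarrow> nat \<Rightarrow> real) \<Rightarrow> real \<Rightarrow> real \<Rightarrow> bool" where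
  "drift_window p e r R \<longleftrightarrow> (\<exists>c>0. \<exists>\<rho>>0. \<forall>T>0. \<forall>\<^sub>F a in sequentially. \<forall>b\<ge>a. \<forall>x z.
     T \<le> (\<Sum>k\<in>{a..<b}. 1 / real k) \<longrightarrow> r \<le> norm x \<longrightarrow> norm x \<le> R \<longrightarrow>
     (\<forall>i. \<forall>k\<in>{a..<b}. norm (z i k - x) \<le> \<rho>) \<longrightarrow>
     (\<Sum>k\<in>{a..<b}. (\<Sum>i\<in>UNIV. (p i k \<bullet> x) * sign_score (p i k, e i (k + 1)) (z i k)) / real k)
       \<le> - c * (\<Sum>k\<in>{a..<b}. 1 / real k))"

text \<open>Compactness of the annulus leaves finitely many centres \<open>x0\<close>, each with a
  majorant of negative total mean. The strong law is invoked for these only, so one null set serves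
  all points, iterates and windows. Since \<rho> is at most every radius of the cover,
  \<open>x\<close> is within \<open>\<delta> x0\<close> of \<open>x0\<close> and the iterates within
  \<open>\<delta> x0\<close> of \<open>x\<close>, as the majorant requires.\<close>

lemma (in prob_space) drift_window_AE:
  fixes \<phi> :: "'n::finite \<Rightarrow> nat \<Rightarrow> 'a \<Rightarrow> real ^ 'l" and d :: "'n \<Rightarrow> nat \<Rightarrow> 'a \<Rightarrow> real"
    and \<mu> :: "'n \<Rightarrow> (real ^ 'l) measure" and \<nu> :: "'n \<Rightarrow> real measure"
  assumes \<phi>m: "\<And>i j. 1 \<le> j \<Longrightarrow> \<phi> i j \<in> borel_measurable M"
    and \<phi>law: "\<And>i k. 1 \<le> k \<Longrightarrow> distr M borel (\<phi> i k) = \<mu> i"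
    and dlaw: "\<And>i k. 2 \<le> k \<Longrightarrow> distr M borel (d i k) = \<nu> i"
    and dind: "\<And>i. indep_vars (\<lambda>_. borel) (d i) {2..}"
    and \<phi>d: "\<And>i. indep_set (generated_events M (\<phi> i) {1..}) (generated_events M (d i) {2..})"
    and rate: "\<And>i. \<exists>C \<rho>. 0 < C \<and> 0 < \<rho> \<and> \<rho> < 1 \<and> (\<forall>k\<ge>1. alpha_coeff M (\<phi> i) k \<le> C * \<rho> ^ k)"
    and noatom: "\<And>i u. AE t in \<nu> i. t \<noteq> u"
    and median_pos: "\<And>i u. 0 < u \<Longrightarrow> 1 / 2 < measure (\<nu> i) {..<u}"
    and median_neg: "\<And>i u. u < 0 \<Longrightarrow> measure (\<nu> i) {..<u} < 1 / 2"
    and bdd: "AE \<omega> in M. \<forall>i. \<forall>k\<ge>1. norm (\<phi> i k \<omega>) \<le> K" and K: "0 \<le> K"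
    and exc: "\<And>x. x \<noteq> 0 \<Longrightarrow> \<exists>i. \<not> (AE p in \<mu> i. p \<bullet> x = 0)"
    and r: "0 < r"
  shows "AE \<omega> in M. drift_window (\<lambda>i k. \<phi> i k \<omega>) (\<lambda>i k. d i k \<omega>) r R"
proof -
  have dm: "d i 2 \<in> borel_measurable M" for i
    using dind[of i] by (auto simp: indep_vars_def)
  have p\<nu>: "prob_space (\<nu> i)" for i
    using dlaw[of 2 i] dm[of i] by (metis order_refl prob_space_distr)
  have p\<mu>: "prob_space (\<mu> i)" for i
    using \<phi>law[of 1 i] \<phi>m[of 1 i] by (metis order_refl prob_space_distr)
  have s\<nu>: "sets (\<nu> i) = sets borel" for i using dlaw[of 2 i] by (metis order_refl sets_distr)
  have s\<mu>: "sets (\<mu> i) = sets borel" for i using \<phi>law[of 1 i] by (metis order_refl sets_distr)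
  have bdd\<mu>: "AE p in \<mu> i. norm p \<le> K" for i
  proof -
    have m: "\<phi> i 1 \<in> borel_measurable M" by (rule \<phi>m) simp
    have "AE \<omega> in M. norm (\<phi> i 1 \<omega>) \<le> K" using bdd by eventually_elim auto
    then have "AE p in distr M borel (\<phi> i 1). norm p \<le> K"
      by (subst AE_distr_iff[OF m]) measurable
    then show ?thesis by (simp only: \<phi>law[OF order_refl])
  qed
  define A where "A = {x :: real ^ 'l. r \<le> norm x \<and> norm x \<le> R}"
  define m where "m = (\<lambda>i x \<delta>. \<integral>p. \<integral>t. score_majorant K R x \<delta> (p, t) \<partial>\<nu> i \<partial>\<mu> i)"
  have "\<exists>\<delta>>0. (\<Sum>i\<in>UNIV. m i x \<delta>) < 0" if "x \<in> A" for x
    unfolding m_def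
  proof (rule mean_score_negative[where \<mu>=\<mu> and \<nu>=\<nu> and K=K and R=R])
    have "x \<noteq> 0" using that r by (auto simp: A_def)
    then show "\<exists>i. \<not> (AE p in \<mu> i. p \<bullet> x = 0)" by (rule exc)
  qed (use that p\<mu> s\<mu> p\<nu> s\<nu> noatom median_pos median_neg bdd\<mu> K in \<open>auto simp: A_def\<close>)
  then obtain \<delta> where \<delta>: "\<And>x. x \<in> A \<Longrightarrow> 0 < \<delta> x \<and> (\<Sum>i\<in>UNIV. m i x (\<delta> x)) < 0"
    by metis
  have "compact A"
  proof -
    have "A = cball 0 R \<inter> norm -` {r..}" by (auto simp: A_def)
    then show ?thesis by (auto intro!: compact_Int_closed closed_vimage continuous_intros)
  qed
  then obtain F where F: "F \<subseteq> A" "finite F" "A \<subseteq> (\<Union>x\<in>F. ball x (\<delta> x))"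
    by (rule compactE_image[of A A "\<lambda>x. ball x (\<delta> x)"]) (use \<delta> in force)+
  \<comment> \<open>\<open>insert 1\<close> keeps the minimum meaningful when the annulus, and with
    it \<open>F\<close>, is empty. Halving reserves one half of the mean drift for the error of the
    strong law.\<close>
  define c where "c = Min (insert 1 ((\<lambda>x. - (\<Sum>i\<in>UNIV. m i x (\<delta> x))) ` F)) / 2"
  define \<rho> where "\<rho> = Min (insert 1 (\<delta> ` F))"
  have c0: "0 < c" unfolding c_def using F \<delta> by (subst zero_less_divide_iff) (auto simp: subset_iff)
  have \<rho>0: "0 < \<rho>" unfolding \<rho>_def using F \<delta> by (auto simp: subset_iff)
  have cF: "(\<Sum>i\<in>UNIV. m i x (\<delta> x)) \<le> - 2 * c" if "x \<in> F" for x
  proof -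
    have "2 * c \<le> - (\<Sum>i\<in>UNIV. m i x (\<delta> x))" unfolding c_def using F that by (auto intro!: Min_le)
    then show ?thesis by simp
  qed
  have \<rho>F: "\<rho> \<le> \<delta> x" if "x \<in> F" for x
    unfolding \<rho>_def using F that by (auto intro!: Min_le)
  let ?h = "\<lambda>x \<omega> i k. score_majorant K R x (\<delta> x) (\<phi> i k \<omega>, d i (k + 1) \<omega>)"
  have "AE \<omega> in M. \<forall>e>0. \<exists>n0\<ge>1. \<forall>a\<ge>n0. \<forall>b\<ge>a.
      \<bar>\<Sum>k\<in>{a..<b}. (?h x \<omega> i k - m i x (\<delta> x)) / k\<bar> \<le> e * (1 + (\<Sum>k\<in>{a..<b}. 1 / real k))"
    if "x \<in> F" for x i
  proof -
    obtain C q where "0 < C" "0 < q" "q < 1" "\<And>k. 1 \<le> k \<Longrightarrow> alpha_coeff M (\<phi> i) k \<le> C * q ^ k"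
      using rate[of i] by auto
    moreover have "x \<in> A" using that F by auto
    then have "0 \<le> \<delta> x" "norm x \<le> R" using \<delta> by (auto simp: A_def less_imp_le)
    note score_majorant_bound[OF K this(2,1)]
    ultimately show ?thesis unfolding m_def
      using \<phi>m \<phi>law dlaw dind \<phi>d by (intro regression_window_law) auto
  qed
  then have "AE \<omega> in M. \<forall>i. \<forall>x\<in>F. \<forall>e>0. \<exists>n0\<ge>1. \<forall>a\<ge>n0. \<forall>b\<ge>a.
      \<bar>\<Sum>k\<in>{a..<b}. (?h x \<omega> i k - m i x (\<delta> x)) / k\<bar> \<le> e * (1 + (\<Sum>k\<in>{a..<b}. 1 / real k))"
    using F(2) by (auto intro!: AE_finite_allI simp: AE_all_countable)
  then show ?thesis
    using bdd
  proof eventually_elim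
    fix \<omega>
    assume law: "\<forall>i. \<forall>x\<in>F. \<forall>e>0. \<exists>n0\<ge>1. \<forall>a\<ge>n0. \<forall>b\<ge>a.
        \<bar>\<Sum>k\<in>{a..<b}. (?h x \<omega> i k - m i x (\<delta> x)) / k\<bar> \<le> e * (1 + (\<Sum>k\<in>{a..<b}. 1 / real k))"
      and bd: "\<forall>i. \<forall>k\<ge>1. norm (\<phi> i k \<omega>) \<le> K"
    show "drift_window (\<lambda>i k. \<phi> i k \<omega>) (\<lambda>i k. d i k \<omega>) r R"
      unfolding drift_window_def
    proof (rule exI[of _ c], rule conjI[OF c0], rule exI[of _ \<rho>], rule conjI[OF \<rho>0], intro allI impI)
      fix T :: real assume T: "0 < T"
      define N where "N = real CARD('n)"
      have N: "0 < N" by (simp add: N_def)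
      \<comment> \<open>Chosen so that \<open>N * (e * (1 + s)) \<le> c * s\<close> as soon as
        \<open>T \<le> s\<close>; the mean drift \<open>- 2 * c * s\<close> then leaves
        \<open>- c * s\<close>.\<close>
      define e where "e = c / (N * (1 / T + 1))"
      have e: "0 < e" using c0 N T by (auto simp: e_def intro!: divide_pos_pos mult_pos_pos add_pos_pos)
      have "\<forall>\<^sub>F a in sequentially. \<forall>b\<ge>a.
        \<bar>\<Sum>k\<in>{a..<b}. (?h x \<omega> i k - m i x (\<delta> x)) / k\<bar> \<le> e * (1 + (\<Sum>k\<in>{a..<b}. 1 / real k))"
        if "x \<in> F" for x i
        using law that e unfolding eventually_sequentially by meson
      then have ev: "\<forall>\<^sub>F a in sequentially. \<forall>x\<in>F. \<forall>i\<in>UNIV. \<forall>b\<ge>a.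
        \<bar>\<Sum>k\<in>{a..<b}. (?h x \<omega> i k - m i x (\<delta> x)) / k\<bar> \<le> e * (1 + (\<Sum>k\<in>{a..<b}. 1 / real k))"
        using F(2) by (intro eventually_ball_finite ballI) auto
      show "\<forall>\<^sub>F a in sequentially. \<forall>b\<ge>a. \<forall>x z. T \<le> (\<Sum>k\<in>{a..<b}. 1 / real k) \<longrightarrow> r \<le> norm x \<longrightarrow> norm x \<le> R \<longrightarrow>
         (\<forall>i. \<forall>k\<in>{a..<b}. norm (z i k - x) \<le> \<rho>) \<longrightarrow>
         (\<Sum>k\<in>{a..<b}. (\<Sum>i\<in>UNIV. (\<phi> i k \<omega> \<bullet> x) * sign_score (\<phi> i k \<omega>, d i (k + 1) \<omega>) (z i k)) / real k)
           \<le> - c * (\<Sum>k\<in>{a..<b}. 1 / real k)"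
        using ev eventually_ge_at_top[of 1]
      proof (eventually_elim, intro allI impI)
        fix a b :: nat and x and z :: "'n \<Rightarrow> nat \<Rightarrow> real ^ 'l"
        assume win: "\<forall>x\<in>F. \<forall>i\<in>UNIV. \<forall>b\<ge>a.
            \<bar>\<Sum>k\<in>{a..<b}. (?h x \<omega> i k - m i x (\<delta> x)) / k\<bar> \<le> e * (1 + (\<Sum>k\<in>{a..<b}. 1 / real k))"
          and a1: "1 \<le> a" and ab: "a \<le> b" and sT: "T \<le> (\<Sum>k\<in>{a..<b}. 1 / real k)"
          and x: "r \<le> norm x" "norm x \<le> R"
          and z: "\<forall>i. \<forall>k\<in>{a..<b}. norm (z i k - x) \<le> \<rho>"
        define s where "s = (\<Sum>k\<in>{a..<b}. 1 / real k)"
        have "x \<in> A" using x by (simp add: A_def)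
        then obtain x0 where x0: "x0 \<in> F" "x \<in> ball x0 (\<delta> x0)" using F(3) by auto
        have x0R: "norm x0 \<le> R" using x0 F(1) by (auto simp: A_def)
        have "(\<Sum>k\<in>{a..<b}. (\<Sum>i\<in>UNIV. (\<phi> i k \<omega> \<bullet> x) * sign_score (\<phi> i k \<omega>, d i (k + 1) \<omega>) (z i k)) / real k)
          \<le> (\<Sum>k\<in>{a..<b}. (\<Sum>i\<in>UNIV. ?h x0 \<omega> i k) / real k)"
        proof (intro sum_mono divide_right_mono)
          fix k i assume k: "k \<in> {a..<b}"
          have p: "norm (\<phi> i k \<omega>) \<le> K" using bd k a1 by auto
          have "norm (z i k - x) \<le> \<delta> x0" using z k \<rho>F[OF x0(1)] by (meson order_trans)
          moreover have "norm (x - x0) \<le> \<delta> x0" using x0(2) by (simp add: dist_norm norm_minus_commute)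
          ultimately show "(\<phi> i k \<omega> \<bullet> x) * sign_score (\<phi> i k \<omega>, d i (k + 1) \<omega>) (z i k) \<le> ?h x0 \<omega> i k"
            using sign_score_perturb[OF p x0R] p unfolding score_majorant_def by simp
        qed simp
        also have "\<dots> = (\<Sum>i\<in>UNIV. \<Sum>k\<in>{a..<b}. (?h x0 \<omega> i k - m i x0 (\<delta> x0)) / k + m i x0 (\<delta> x0) * (1 / real k))"
          unfolding sum_divide_distrib by (subst sum.swap) (simp add: diff_divide_distrib)
        also have "\<dots> = (\<Sum>i\<in>UNIV. (\<Sum>k\<in>{a..<b}. (?h x0 \<omega> i k - m i x0 (\<delta> x0)) / k) + m i x0 (\<delta> x0) * s)"
          unfolding s_def by (simp add: sum.distrib sum_distrib_left)
        also have "\<dots> \<le> (\<Sum>i\<in>UNIV. e * (1 + s) + m i x0 (\<delta> x0) * s)"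
        proof (intro sum_mono add_right_mono)
          fix i
          show "(\<Sum>k\<in>{a..<b}. (?h x0 \<omega> i k - m i x0 (\<delta> x0)) / k) \<le> e * (1 + s)"
            using win x0(1) ab unfolding s_def by (meson UNIV_I abs_le_D1)
        qed
        also have "\<dots> = N * (e * (1 + s)) + (\<Sum>i\<in>UNIV. m i x0 (\<delta> x0)) * s"
          by (simp add: sum.distrib sum_distrib_right N_def)
        also have "\<dots> \<le> c * s + - 2 * c * s"
        proof (intro add_mono mult_right_mono cF x0)
          have "1 \<le> s * (1 / T)" using sT T by (simp add: s_def)
          then have "1 + s \<le> s * (1 / T + 1)" by (simp add: distrib_left)
          then have "N * (e * (1 + s)) \<le> N * (e * (s * (1 / T + 1)))"
            using N e by (intro mult_left_mono) auto
          also have "\<dots> = N * (1 / T + 1) * e * s" by (simp add: mult_ac)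
          also have "N * (1 / T + 1) * e = c"
          proof -
            have "N * (1 / T + 1) \<noteq> 0" using N T by (auto simp: add_pos_pos intro!: mult_pos_pos less_imp_neq[symmetric])
            then show ?thesis by (simp add: e_def)
          qed
          finally show "N * (e * (1 + s)) \<le> c * s" .
          show "0 \<le> s" using sT T by (simp add: s_def)
        qed
        finally show "(\<Sum>k\<in>{a..<b}. (\<Sum>i\<in>UNIV. (\<phi> i k \<omega> \<bullet> x) * sign_score (\<phi> i k \<omega>, d i (k + 1) \<omega>) (z i k)) / real k)
           \<le> - c * (\<Sum>k\<in>{a..<b}. 1 / real k)" by (simp add: s_def)
      qed
    qed
  qed
qed

section \<open>Consensus\<close>

locale gossip_network =
  fixes E :: "nat \<Rightarrow> ('n::finite \<times> 'n) set" and W :: "nat \<Rightarrow> real ^ 'n ^ 'n"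
  assumes self_loops: "\<And>i k. 1 \<le> k \<Longrightarrow> (i, i) \<in> E k"
    and weights: "\<And>i j k. 1 \<le> k \<Longrightarrow> (if (j, i) \<in> E k then 0 < W k $ i $ j else W k $ i $ j = 0)"
    and W_stochastic: "\<And>k. 1 \<le> k \<Longrightarrow> doubly_stochastic (W k)"
    and W_lower: "\<exists>\<kappa>. 0 < \<kappa> \<and> \<kappa> < 1 \<and> (\<forall>k\<ge>1. \<forall>i. \<forall>j\<in>nbrs E i k. \<kappa> \<le> W k $ i $ j)"
    and connected: "strongly_connected (persistent_edges E)"
    and B_connected: "\<exists>B\<ge>1. \<forall>e\<in>persistent_edges E. \<forall>k\<ge>1. e \<in> (\<Union>m\<in>{k..<k + B}. E m)"
begin

lemma W_nonneg: "1 \<le> k \<Longrightarrow> 0 \<le> W k $ i $ j"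
  and W_row: "1 \<le> k \<Longrightarrow> (\<Sum>j\<in>UNIV. W k $ i $ j) = 1"
  and W_col: "1 \<le> k \<Longrightarrow> (\<Sum>i\<in>UNIV. W k $ i $ j) = 1"
  using W_stochastic[of k] by (auto simp: doubly_stochastic_def)

lemma sum_nbrs:
  "1 \<le> k \<Longrightarrow> (\<Sum>j\<in>nbrs E i k. (W k $ i $ j * c j) *\<^sub>R (x j :: 'v::real_vector)) = (\<Sum>j\<in>UNIV. (W k $ i $ j * c j) *\<^sub>R x j)"
proof (rule sum.mono_neutral_left)
  assume k: "1 \<le> k"
  show "\<forall>j\<in>UNIV - nbrs E i k. (W k $ i $ j * c j) *\<^sub>R x j = 0"
  proof
    fix j assume "j \<in> UNIV - nbrs E i k"
    then show "(W k $ i $ j * c j) *\<^sub>R x j = 0" using weights[OF k, of j i] by (simp add: nbrs_def)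
  qed
qed auto

text \<open>Self loops keep the property where it has arrived, and each edge of a path in the
  persistent graph occurs within \<open>B\<close> steps. The property is a parameter because the
  same spreading serves transition weights, truncation levels and the final equality of the
  counters; \<open>L\<close> does not depend on it.\<close>

lemma flooding:
  "\<exists>L\<ge>1. \<forall>a\<ge>1. \<forall>P u. P a u \<longrightarrow> (\<forall>k\<ge>a. \<forall>i j. P k j \<longrightarrow> (j, i) \<in> E k \<longrightarrow> P (Suc k) i) \<longrightarrow>
     (\<forall>v. \<forall>k\<ge>a + L. P k v)"
proof -
  obtain B where B: "B \<ge> 1" "\<And>e k. e \<in> persistent_edges E \<Longrightarrow> k \<ge> 1 \<Longrightarrow> e \<in> (\<Union>m\<in>{k..<k + B}. E m)"
    using B_connected by blast
  have "\<forall>u v. \<exists>n. (u, v) \<in> persistent_edges E ^^ n"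
    using connected by (auto simp: strongly_connected_def rtrancl_power)
  then obtain h where h: "\<And>u v. (u, v) \<in> persistent_edges E ^^ h u v" by metis
  define H where "H = Max (range (\<lambda>(u, v). h u v))"
  have hH: "h u v \<le> H" for u v
    unfolding H_def by (rule Max_ge) (auto intro!: rev_image_eqI[of "(u, v)"])
  show ?thesis
  \<comment> \<open>\<open>H * B\<close> steps suffice for the spreading; the successor makes
    \<open>L\<close> positive also when \<open>H = 0\<close>.\<close>
  proof (intro exI[of _ "Suc (H * B)"] conjI allI impI)
    fix a P u v and k :: nat
    assume a: "1 \<le> a" and P: "P a u"
      and step: "\<forall>k\<ge>a. \<forall>i j. P k j \<longrightarrow> (j, i) \<in> E k \<longrightarrow> P (Suc k) i"
      and k: "a + Suc (H * B) \<le> k"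
    have stay: "P l w" if "P k w" "a \<le> k" "k \<le> l" for k l w
      using that(3,1)
    proof (induction l rule: dec_induct)
      case (step l)
      then show ?case using \<open>\<forall>k\<ge>a. _ k\<close> self_loops[of l w] that(2) a by auto
    qed simp
    have "\<forall>k\<ge>a + n * B. P k v" if "(u, v) \<in> persistent_edges E ^^ n" for n v
      using that
    proof (induction n arbitrary: v)
      case 0
      then show ?case using stay[OF P] by auto
    next
      case (Suc n)
      then obtain w where w: "(u, w) \<in> persistent_edges E ^^ n" "(w, v) \<in> persistent_edges E" by auto
      obtain m where m: "m \<in> {a + n * B..<a + n * B + B}" "(w, v) \<in> E m"
        using B(2)[OF w(2), of "a + n * B"] a by auto
      have "P m w" using Suc.IH[OF w(1)] m by auto
      then have "P (Suc m) v" using step m by auto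
      then show ?case using stay m by auto
    qed
    from this[OF h] have "\<forall>k\<ge>a + h u v * B. P k v" .
    moreover have "h u v * B \<le> H * B" using hH by (rule mult_right_mono) simp
    moreover have "a + h u v * B \<le> k" using \<open>h u v * B \<le> H * B\<close> k by linarith
    ultimately show "P k v" by blast
  qed simp
qed

end

section \<open>Contraction of the disagreement by products of weight matrices\<close>

text \<open>With the product weights \<open>a l * b m\<close> both sums become double sums, and
  their difference is a weighted sum of the \<open>x l - x m\<close>. The mass \<open>c\<close> is
  arbitrary because rows are later compared after removal of a common part, which may leave mass
  0.\<close>

lemma norm_convex_diff_le:
  fixes x :: "'n::finite \<Rightarrow> 'v::real_normed_vector"
  assumes a: "\<And>l. 0 \<le> a l" "(\<Sum>l\<in>UNIV. a l) = c" and b: "\<And>l. 0 \<le> b l" "(\<Sum>l\<in>UNIV. b l) = c"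
    and d: "\<And>i j. norm (x i - x j) \<le> \<delta>"
  shows "norm ((\<Sum>l\<in>UNIV. a l *\<^sub>R x l) - (\<Sum>l\<in>UNIV. b l *\<^sub>R x l)) \<le> c * \<delta>"
proof (cases "c = 0")
  case True
  have "a l = 0" "b l = 0" for l
    using a b True by (simp_all add: sum_nonneg_eq_0_iff)
  then show ?thesis using True by simp
next
  case False
  have c: "0 < c" using False a sum_nonneg[of UNIV a] by force
  have "c *\<^sub>R ((\<Sum>l\<in>UNIV. a l *\<^sub>R x l) - (\<Sum>l\<in>UNIV. b l *\<^sub>R x l)) =
      (\<Sum>m\<in>UNIV. b m) *\<^sub>R (\<Sum>l\<in>UNIV. a l *\<^sub>R x l) - (\<Sum>l\<in>UNIV. a l) *\<^sub>R (\<Sum>m\<in>UNIV. b m *\<^sub>R x m)"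
    by (simp add: a b scaleR_diff_right)
  also have "\<dots> = (\<Sum>l\<in>UNIV. \<Sum>m\<in>UNIV. (a l * b m) *\<^sub>R x l) - (\<Sum>l\<in>UNIV. \<Sum>m\<in>UNIV. (a l * b m) *\<^sub>R x m)"
  proof -
    have "(\<Sum>m\<in>UNIV. b m) *\<^sub>R (\<Sum>l\<in>UNIV. a l *\<^sub>R x l) = (\<Sum>l\<in>UNIV. \<Sum>m\<in>UNIV. (a l * b m) *\<^sub>R x l)"
      by (simp add: scaleR_sum_right scaleR_sum_left[symmetric] sum_distrib_left[symmetric] mult.commute)
    moreover have "(\<Sum>l\<in>UNIV. a l) *\<^sub>R (\<Sum>m\<in>UNIV. b m *\<^sub>R x m) = (\<Sum>l\<in>UNIV. \<Sum>m\<in>UNIV. (a l * b m) *\<^sub>R x m)"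
      by (subst sum.swap) (simp add: scaleR_sum_right sum_distrib_right[symmetric] scaleR_sum_left[symmetric])
    ultimately show ?thesis by (simp only:)
  qed
  also have "\<dots> = (\<Sum>l\<in>UNIV. \<Sum>m\<in>UNIV. (a l * b m) *\<^sub>R (x l - x m))"
    by (simp add: sum_subtractf scaleR_diff_right)
  also have "norm \<dots> \<le> (\<Sum>l\<in>UNIV. \<Sum>m\<in>UNIV. a l * b m * \<delta>)"
    by (intro order.trans[OF norm_sum] sum_mono) (use a b d in \<open>auto intro!: mult_left_mono\<close>)
  also have "\<dots> = c * c * \<delta>"
    by (simp add: a b sum_distrib_left[symmetric] sum_distrib_right[symmetric])
  finally show ?thesis using c by (simp add: mult.assoc)
qed

text \<open>The entries of the backward product \<open>W (a + t - 1) ... W a\<close>.\<close>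

primrec transit :: "(nat \<Rightarrow> real ^ 'n ^ 'n) \<Rightarrow> nat \<Rightarrow> nat \<Rightarrow> 'n::finite \<Rightarrow> 'n \<Rightarrow> real" where
  "transit W a 0 = (\<lambda>i j. of_bool (i = j))"
| "transit W a (Suc t) = (\<lambda>i j. \<Sum>l\<in>UNIV. W (a + t) $ i $ l * transit W a t l j)"

context gossip_network
begin

lemma transit_nonneg: "1 \<le> a \<Longrightarrow> 0 \<le> transit W a t i j"
  by (induction t arbitrary: i) (auto intro!: sum_nonneg mult_nonneg_nonneg W_nonneg)

lemma transit_row: "1 \<le> a \<Longrightarrow> (\<Sum>j\<in>UNIV. transit W a t i j) = 1"
proof (induction t arbitrary: i)
  case 0
  then show ?case by (simp add: of_bool_def sum.delta)
next
  case (Suc t)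
  have "(\<Sum>j\<in>UNIV. transit W a (Suc t) i j) = (\<Sum>l\<in>UNIV. W (a + t) $ i $ l * (\<Sum>j\<in>UNIV. transit W a t l j))"
    by (simp add: sum_distrib_left) (rule sum.swap)
  then show ?case using Suc W_row by simp
qed

text \<open>Each perturbation is carried on by rows of total weight one, so the errors add up
  without amplification.\<close>

lemma perturbed_transit:
  fixes x :: "'n \<Rightarrow> nat \<Rightarrow> 'v::real_normed_vector"
  assumes a: "1 \<le> a"
    and x: "\<And>k i. a \<le> k \<Longrightarrow> k < a + t \<Longrightarrow> x i (Suc k) = (\<Sum>j\<in>UNIV. W k $ i $ j *\<^sub>R x j k) + p i k"
    and p: "\<And>k i. a \<le> k \<Longrightarrow> k < a + t \<Longrightarrow> norm (p i k) \<le> \<beta>"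
  shows "norm (x i (a + t) - (\<Sum>j\<in>UNIV. transit W a t i j *\<^sub>R x j a)) \<le> t * \<beta>"
  using x p
proof (induction t arbitrary: i)
  case 0
  then show ?case by (simp add: of_bool_def if_distrib[of "\<lambda>c. c *\<^sub>R _"] sum.delta cong: if_cong)
next
  case (Suc t)
  have IH: "norm (x l (a + t) - (\<Sum>j\<in>UNIV. transit W a t l j *\<^sub>R x j a)) \<le> t * \<beta>" for l
    by (rule Suc.IH) (use Suc.prems in auto)
  have "(\<Sum>j\<in>UNIV. transit W a (Suc t) i j *\<^sub>R x j a) =
      (\<Sum>l\<in>UNIV. W (a + t) $ i $ l *\<^sub>R (\<Sum>j\<in>UNIV. transit W a t l j *\<^sub>R x j a))"
    by (simp add: scaleR_sum_left scaleR_sum_right) (rule sum.swap)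
  moreover have "x i (a + Suc t) = (\<Sum>l\<in>UNIV. W (a + t) $ i $ l *\<^sub>R x l (a + t)) + p i (a + t)"
    using Suc.prems(1)[of "a + t" i] by simp
  ultimately have "x i (a + Suc t) - (\<Sum>j\<in>UNIV. transit W a (Suc t) i j *\<^sub>R x j a) =
      (\<Sum>l\<in>UNIV. W (a + t) $ i $ l *\<^sub>R (x l (a + t) - (\<Sum>j\<in>UNIV. transit W a t l j *\<^sub>R x j a))) + p i (a + t)"
    by (simp add: scaleR_diff_right sum_subtractf)
  also have "norm \<dots> \<le> (\<Sum>l\<in>UNIV. W (a + t) $ i $ l * (t * \<beta>)) + \<beta>"
  proof (intro order.trans[OF norm_triangle_ineq] add_mono order.trans[OF norm_sum] sum_mono)
    show "norm (W (a + t) $ i $ l *\<^sub>R (x l (a + t) - (\<Sum>j\<in>UNIV. transit W a t l j *\<^sub>R x j a))) \<le> W (a + t) $ i $ l * (t * \<beta>)" for l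
      using IH[of l] W_nonneg[of "a + t" i l] a by (auto intro!: mult_left_mono)
    show "norm (p i (a + t)) \<le> \<beta>" using Suc.prems(2)[of "a + t" i] by simp
  qed
  also have "\<dots> = Suc t * \<beta>"
  proof -
    have "(\<Sum>l\<in>UNIV. W (a + t) $ i $ l * c) = c" for c
      using W_row[of "a + t" i] a by (simp add: sum_distrib_right[symmetric])
    then show ?thesis by (simp only:) (simp add: distrib_right)
  qed
  finally show ?case .
qed

lemma spread_step:
  fixes x :: "'n \<Rightarrow> nat \<Rightarrow> 'v::real_normed_vector"
  assumes k: "1 \<le> k" and x: "\<And>i. x i (Suc k) = (\<Sum>j\<in>UNIV. W k $ i $ j *\<^sub>R x j k) + p i k"
    and p: "\<And>i. norm (p i k) \<le> \<beta>" and d: "\<And>i j. norm (x i k - x j k) \<le> \<delta>"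
  shows "norm (x i (Suc k) - x j (Suc k)) \<le> \<delta> + 2 * \<beta>"
proof -
  have "norm ((\<Sum>l\<in>UNIV. W k $ i $ l *\<^sub>R x l k) - (\<Sum>l\<in>UNIV. W k $ j $ l *\<^sub>R x l k)) \<le> 1 * \<delta>"
    using k by (intro norm_convex_diff_le W_nonneg W_row d)
  moreover have "x i (Suc k) - x j (Suc k) = ((\<Sum>l\<in>UNIV. W k $ i $ l *\<^sub>R x l k) - (\<Sum>l\<in>UNIV. W k $ j $ l *\<^sub>R x l k)) + (p i k - p j k)"
    by (simp add: x)
  moreover have "norm (p i k - p j k) \<le> 2 * \<beta>"
    using norm_triangle_ineq4[of "p i k" "p j k"] p[of i] p[of j] by linarith
  ultimately show ?thesis by (metis (no_types, lifting) add_mono mult_1 norm_triangle_mono)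
qed

text \<open>A Doeblin condition: every entry of the \<open>L\<close>-step transition matrix is at
  least \<open>\<kappa> ^ L\<close>, so any two rows share mass \<gamma>, and only the remaining
  \<open>1 - \<gamma>\<close> transmits disagreement. Perturbations add at most
  \<open>L * \<beta>\<close> per agent.\<close>

lemma spread_contraction:
  obtains L \<gamma> where "1 \<le> L" "0 < \<gamma>" "\<gamma> \<le> 1"
    "\<And>a (x :: 'n \<Rightarrow> nat \<Rightarrow> 'v::real_normed_vector) p \<beta> \<delta> i j. 1 \<le> a \<Longrightarrow>
      (\<And>k i. a \<le> k \<Longrightarrow> x i (Suc k) = (\<Sum>j\<in>UNIV. W k $ i $ j *\<^sub>R x j k) + p i k) \<Longrightarrow>
      (\<And>k i. a \<le> k \<Longrightarrow> norm (p i k) \<le> \<beta>) \<Longrightarrow> (\<And>i j. norm (x i a - x j a) \<le> \<delta>) \<Longrightarrow>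
      norm (x i (a + L) - x j (a + L)) \<le> (1 - \<gamma>) * \<delta> + 2 * (L * \<beta>)"
proof -
  obtain \<kappa> where \<kappa>: "0 < \<kappa>" "\<kappa> < 1" "\<And>k i j. k \<ge> 1 \<Longrightarrow> (j, i) \<in> E k \<Longrightarrow> \<kappa> \<le> W k $ i $ j"
    using W_lower by (auto simp: nbrs_def)
  obtain L where L1: "L \<ge> 1" and L2: "\<forall>a\<ge>1. \<forall>P u. P a u \<longrightarrow>
      (\<forall>k\<ge>a. \<forall>i j. P k j \<longrightarrow> (j, i) \<in> E k \<longrightarrow> P (Suc k) i) \<longrightarrow> (\<forall>v. \<forall>k\<ge>a + L. P k v)"
    using flooding by (elim exE conjE) (rule that)
  define \<eta> where "\<eta> = \<kappa> ^ L"
  define \<gamma> where "\<gamma> = CARD('n) * \<eta>"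
  have \<eta>: "0 < \<eta>" using \<kappa> by (simp add: \<eta>_def)
  have low: "\<eta> \<le> transit W a L i j" if a: "1 \<le> a" for a i j
  proof -
    \<comment> \<open>The lower bound itself is what floods the network from \<open>j\<close>: along
      an active edge the receiver keeps at least the share \<kappa> of the sender's weight, and the
      exponent grows by one per step.\<close>
    define P where "P = (\<lambda>k i. \<kappa> ^ (k - a) \<le> transit W a (k - a) i j)"
    have P0: "P a j" by (simp add: P_def)
    have step: "\<forall>k\<ge>a. \<forall>i l. P k l \<longrightarrow> (l, i) \<in> E k \<longrightarrow> P (Suc k) i"
    proof (intro allI impI)
      fix k i l assume k: "a \<le> k" and "P k l" and e: "(l, i) \<in> E k"
      then have IH: "\<kappa> ^ (k - a) \<le> transit W a (k - a) l j" by (simp add: P_def)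
      have "\<kappa> ^ (Suc k - a) = \<kappa> * \<kappa> ^ (k - a)" using k by (simp add: Suc_diff_le)
      also have "\<dots> \<le> W k $ i $ l * transit W a (k - a) l j"
      proof (rule mult_mono)
        show "\<kappa> \<le> W k $ i $ l" using \<kappa>(3) e k a by simp
        then show "0 \<le> W k $ i $ l" using \<kappa>(1) by simp
      qed (use IH \<kappa> in auto)
      also have "\<dots> \<le> (\<Sum>l\<in>UNIV. W k $ i $ l * transit W a (k - a) l j)"
        using k a by (intro member_le_sum mult_nonneg_nonneg W_nonneg transit_nonneg) auto
      also have "\<dots> = transit W a (Suc k - a) i j" using k by (simp add: Suc_diff_le)
      finally show "P (Suc k) i" by (simp add: P_def)
    qed
    have "P (a + L) i"
      using L2[THEN spec, THEN mp, OF a, THEN spec[of _ P], THEN spec[of _ j], THEN mp, OF P0, THEN mp, OF step] by simp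
    then show ?thesis by (simp add: P_def \<eta>_def)
  qed
  have \<gamma>1: "\<gamma> \<le> 1"
  proof -
    have "\<gamma> = (\<Sum>j\<in>(UNIV::'n set). \<eta>)" by (simp add: \<gamma>_def)
    also have "\<dots> \<le> (\<Sum>j\<in>UNIV. transit W 1 L undefined j)" by (intro sum_mono low) simp
    finally show ?thesis by (simp add: transit_row)
  qed
  show ?thesis
  proof (rule that[OF L1 _ \<gamma>1])
    show "0 < \<gamma>" using \<eta> by (simp add: \<gamma>_def)
    fix a and x p :: "'n \<Rightarrow> nat \<Rightarrow> 'v" and \<beta> \<delta> i j
    assume a: "1 \<le> a" and x: "\<And>k i. a \<le> k \<Longrightarrow> x i (Suc k) = (\<Sum>j\<in>UNIV. W k $ i $ j *\<^sub>R x j k) + p i k"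
      and p: "\<And>k i. a \<le> k \<Longrightarrow> norm (p i k) \<le> \<beta>" and d: "\<And>i j. norm (x i a - x j a) \<le> \<delta>"
    let ?y = "\<lambda>i. \<Sum>l\<in>UNIV. transit W a L i l *\<^sub>R x l a"
    have r: "norm (x i (a + L) - ?y i) \<le> L * \<beta>" for i
      by (rule perturbed_transit[where p=p]) (use a x p in auto)
    have sum1: "(\<Sum>l\<in>UNIV. transit W a L i l - \<eta>) = 1 - \<gamma>" for i
      using transit_row[OF a] by (simp add: sum_subtractf \<gamma>_def)
    \<comment> \<open>Subtracting \<eta> from every entry of both rows does not change their
      difference but lowers the mass to \<open>1 - \<gamma>\<close>.\<close>
    have "norm ((\<Sum>l\<in>UNIV. (transit W a L i l - \<eta>) *\<^sub>R x l a) - (\<Sum>l\<in>UNIV. (transit W a L j l - \<eta>) *\<^sub>R x l a)) \<le> (1 - \<gamma>) * \<delta>"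
      by (rule norm_convex_diff_le) (use low[OF a] sum1 d in auto)
    then have "norm (?y i - ?y j) \<le> (1 - \<gamma>) * \<delta>"
      by (simp add: scaleR_diff_left sum_subtractf)
    moreover have "x i (a + L) - x j (a + L) = (?y i - ?y j) + ((x i (a + L) - ?y i) - (x j (a + L) - ?y j))" by simp
    moreover have "norm ((x i (a + L) - ?y i) - (x j (a + L) - ?y j)) \<le> 2 * (L * \<beta>)"
      using norm_triangle_ineq4[of "x i (a + L) - ?y i" "x j (a + L) - ?y j"] r[of i] r[of j] by linarith
    ultimately show "norm (x i (a + L) - x j (a + L)) \<le> (1 - \<gamma>) * \<delta> + 2 * (L * \<beta>)"
      by (metis (no_types, lifting) add_mono norm_triangle_mono)
  qed
qed



text \<open>On the grid \<open>n + t * L\<close> the contraction beats the perturbation, since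
  \<open>2 * (L * (K / real n)) < \<gamma> * \<epsilon>\<close>; between grid points the
  disagreement grows by at most the same left-hand side, hence by at most \<epsilon>. The threshold
  is common to all paths, which allows its use at restarts.\<close>

lemma spread_stays_small:
  assumes \<epsilon>: "0 < \<epsilon>" and K: "0 \<le> K"
  shows "\<forall>\<^sub>F n in sequentially. \<forall>(x :: 'n \<Rightarrow> nat \<Rightarrow> 'v::real_normed_vector) p.
    (\<forall>k\<ge>n. \<forall>i. x i (Suc k) = (\<Sum>j\<in>UNIV. W k $ i $ j *\<^sub>R x j k) + p i k) \<longrightarrow>
    (\<forall>k\<ge>n. \<forall>i. norm (p i k) \<le> K / real k) \<longrightarrow> (\<forall>i j. norm (x i n - x j n) \<le> \<epsilon>) \<longrightarrow>
    (\<forall>k\<ge>n. \<forall>i j. norm (x i k - x j k) \<le> 2 * \<epsilon>)"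
proof (rule spread_contraction[where 'v='v])
  fix L \<gamma> assume L: "1 \<le> L" and \<gamma>: "0 < \<gamma>" "\<gamma> \<le> 1" and con: "\<And>a (x :: 'n \<Rightarrow> nat \<Rightarrow> 'v) p \<beta> \<delta> i j. 1 \<le> a \<Longrightarrow>
      (\<And>k i. a \<le> k \<Longrightarrow> x i (Suc k) = (\<Sum>j\<in>UNIV. W k $ i $ j *\<^sub>R x j k) + p i k) \<Longrightarrow>
      (\<And>k i. a \<le> k \<Longrightarrow> norm (p i k) \<le> \<beta>) \<Longrightarrow> (\<And>i j. norm (x i a - x j a) \<le> \<delta>) \<Longrightarrow>
      norm (x i (a + L) - x j (a + L)) \<le> (1 - \<gamma>) * \<delta> + 2 * (L * \<beta>)"
  have "(\<lambda>n. 2 * (L * (K / real n))) \<longlonglongrightarrow> 2 * (real L * 0)"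
    by (intro tendsto_intros lim_const_over_n)
  then have "\<forall>\<^sub>F n in sequentially. 2 * (L * (K / real n)) < \<gamma> * \<epsilon>"
    using \<epsilon> \<gamma> by (intro order_tendstoD) auto
  then show ?thesis
    using eventually_ge_at_top[of 1]
  proof (eventually_elim, intro allI impI)
    fix n k i j and x p :: "'n \<Rightarrow> nat \<Rightarrow> 'v"
    assume small: "2 * (L * (K / real n)) < \<gamma> * \<epsilon>" and n: "1 \<le> n"
      and x: "\<forall>k\<ge>n. \<forall>i. x i (Suc k) = (\<Sum>j\<in>UNIV. W k $ i $ j *\<^sub>R x j k) + p i k"
      and p: "\<forall>k\<ge>n. \<forall>i. norm (p i k) \<le> K / real k"
      and d: "\<forall>i j. norm (x i n - x j n) \<le> \<epsilon>" and k: "n \<le> k"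
    have p': "norm (p i k) \<le> K / n" if "n \<le> k" for i k
    proof -
      have "K / real k \<le> K / n" using that n K by (intro divide_left_mono) auto
      then show ?thesis using p that by (meson order_trans)
    qed
    have grid: "\<forall>i j. norm (x i (n + t * L) - x j (n + t * L)) \<le> \<epsilon>" for t
    proof (induction t)
      case (Suc t)
      show ?case
      proof (intro allI)
        fix i j
        have "norm (x i (n + t * L + L) - x j (n + t * L + L)) \<le> (1 - \<gamma>) * \<epsilon> + 2 * (L * (K / n))"
          by (rule con[where p=p]) (use n x p' Suc in auto)
        also have "\<dots> \<le> \<epsilon>" using small by (simp add: algebra_simps)
        finally show "norm (x i (n + Suc t * L) - x j (n + Suc t * L)) \<le> \<epsilon>" by (simp add: algebra_simps)
      qed
    qed (use d in simp)
    have between: "\<forall>i j. norm (x i (n + t * L + s) - x j (n + t * L + s)) \<le> \<epsilon> + s * (2 * (K / n))" for t s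
    proof (induction s)
      case 0
      then show ?case using grid[of t] by simp
    next
      case (Suc s)
      have "norm (x i (Suc (n + t * L + s)) - x j (Suc (n + t * L + s))) \<le> \<epsilon> + s * (2 * (K / n)) + 2 * (K / n)" for i j
        by (rule spread_step[where p=p]) (use n x p' Suc in auto)
      moreover have "\<epsilon> + s * (2 * (K / n)) + 2 * (K / n) = \<epsilon> + real (Suc s) * (2 * (K / n))"
        by (simp only: of_nat_Suc distrib_right)
      ultimately show ?case by (simp only: add_Suc_right) auto
    qed
    define t where "t = (k - n) div L"
    define s where "s = (k - n) mod L"
    have "k = n + t * L + s" using k by (simp add: t_def s_def)
    moreover have "\<epsilon> + s * (2 * (K / n)) \<le> 2 * \<epsilon>"
    proof -
      have "s \<le> L" using L by (simp add: s_def less_imp_le)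
      then have "s * (2 * (K / n)) \<le> L * (2 * (K / n))" using K by (intro mult_right_mono) auto
      moreover have "\<gamma> * \<epsilon> \<le> 1 * \<epsilon>" using \<gamma> \<epsilon> by (intro mult_right_mono) auto
      moreover have "L * (2 * (K / n)) = 2 * (L * (K / real n))" by simp
      ultimately have "s * (2 * (K / n)) \<le> \<epsilon>" using small by (metis less_imp_le mult_1 order_trans)
      then show ?thesis by simp
    qed
    ultimately show "norm (x i k - x j k) \<le> 2 * \<epsilon>" using between[of t s] by (meson order_trans)
  qed
qed

text \<open>For one given path with arbitrary initial disagreement, geometric decay along the grid
  brings it below \<open>\<epsilon> / 2\<close> at some late time, and
  \<open>spread_stays_small\<close> takes over from there.\<close>

lemma spread_vanishes:
  fixes x :: "'n \<Rightarrow> nat \<Rightarrow> 'v::real_normed_vector"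
  assumes K: "0 \<le> K"
    and x: "\<forall>k\<ge>n. \<forall>i. x i (Suc k) = (\<Sum>j\<in>UNIV. W k $ i $ j *\<^sub>R x j k) + p i k"
    and p: "\<forall>k\<ge>n. \<forall>i. norm (p i k) \<le> K / real k" and \<epsilon>: "0 < \<epsilon>"
  shows "\<forall>\<^sub>F a in sequentially. \<forall>k\<ge>a. \<forall>i j. norm (x i k - x j k) \<le> \<epsilon>"
proof (rule spread_contraction[where 'v='v])
  fix L \<gamma> assume L: "1 \<le> L" and \<gamma>: "0 < \<gamma>" "\<gamma> \<le> 1" and con: "\<And>a (x :: 'n \<Rightarrow> nat \<Rightarrow> 'v) p \<beta> \<delta> i j. 1 \<le> a \<Longrightarrow>
      (\<And>k i. a \<le> k \<Longrightarrow> x i (Suc k) = (\<Sum>j\<in>UNIV. W k $ i $ j *\<^sub>R x j k) + p i k) \<Longrightarrow>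
      (\<And>k i. a \<le> k \<Longrightarrow> norm (p i k) \<le> \<beta>) \<Longrightarrow> (\<And>i j. norm (x i a - x j a) \<le> \<delta>) \<Longrightarrow>
      norm (x i (a + L) - x j (a + L)) \<le> (1 - \<gamma>) * \<delta> + 2 * (L * \<beta>)"
  have "(\<lambda>n. 2 * (L * (K / real n))) \<longlonglongrightarrow> 2 * (real L * 0)"
    by (intro tendsto_intros lim_const_over_n)
  then have "\<forall>\<^sub>F n in sequentially. 2 * (L * (K / real n)) < \<gamma> * (\<epsilon> / 4)"
    using \<epsilon> \<gamma> by (intro order_tendstoD) auto
  from eventually_conj[OF this spread_stays_small[where 'v='v, OF half_gt_zero[OF \<epsilon>] K]]
  obtain n1 where "\<forall>m\<ge>n1. 2 * (L * (K / real m)) < \<gamma> * (\<epsilon> / 4) \<and> (\<forall>(x :: 'n \<Rightarrow> nat \<Rightarrow> 'v) p.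
    (\<forall>k\<ge>m. \<forall>i. x i (Suc k) = (\<Sum>j\<in>UNIV. W k $ i $ j *\<^sub>R x j k) + p i k) \<longrightarrow>
    (\<forall>k\<ge>m. \<forall>i. norm (p i k) \<le> K / real k) \<longrightarrow> (\<forall>i j. norm (x i m - x j m) \<le> \<epsilon> / 2) \<longrightarrow>
    (\<forall>k\<ge>m. \<forall>i j. norm (x i k - x j k) \<le> 2 * (\<epsilon> / 2)))"
    unfolding eventually_sequentially by (elim exE) (rule that)
  note n1 = this[THEN spec, THEN mp, THEN conjunct1] this[THEN spec, THEN mp, THEN conjunct2]
  define m where "m = max 1 (max n n1)"
  have m: "1 \<le> m" "n \<le> m" "n1 \<le> m" by (auto simp: m_def)
  define D where "D = 2 * (\<Sum>i\<in>UNIV. norm (x i m))"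
  have D: "norm (x i m - x j m) \<le> D" for i j
  proof -
    have "norm (x l m) \<le> (\<Sum>i\<in>UNIV. norm (x i m))" for l by (rule member_le_sum) auto
    from this[of i] this[of j] show ?thesis
      using norm_triangle_ineq4[of "x i m" "x j m"] unfolding D_def by linarith
  qed
  have p': "norm (p i k) \<le> K / m" if "m \<le> k" for i k
  proof -
    have "K / real k \<le> K / m" using that m K by (intro divide_left_mono) auto
    then show ?thesis using p that m by (meson order_trans)
  qed
  \<comment> \<open>The remainder \<open>\<epsilon> / 4\<close> reproduces itself: contraction frees
    \<open>\<gamma> * (\<epsilon> / 4)\<close>, which exceeds what the perturbation adds over
    \<open>L\<close> steps.\<close>
  have grid: "\<forall>i j. norm (x i (m + t * L) - x j (m + t * L)) \<le> (1 - \<gamma>) ^ t * D + \<epsilon> / 4" for t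
  proof (induction t)
    case 0
    show ?case using D \<epsilon> by (auto intro: order_trans[OF D])
  next
    case (Suc t)
    show ?case
    proof (intro allI)
      fix i j
      have "norm (x i (m + t * L + L) - x j (m + t * L + L)) \<le> (1 - \<gamma>) * ((1 - \<gamma>) ^ t * D + \<epsilon> / 4) + 2 * (L * (K / m))"
        by (rule con[where p=p]) (use m x p' Suc in auto)
      also have "(1 - \<gamma>) * ((1 - \<gamma>) ^ t * D + \<epsilon> / 4) = (1 - \<gamma>) ^ Suc t * D + (\<epsilon> / 4 - \<gamma> * (\<epsilon> / 4))"
        by (simp add: distrib_left left_diff_distrib mult.assoc)
      also have "\<dots> + 2 * (L * (K / m)) \<le> (1 - \<gamma>) ^ Suc t * D + \<epsilon> / 4" using n1(1)[OF m(3)] by linarith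
      finally show "norm (x i (m + Suc t * L) - x j (m + Suc t * L)) \<le> (1 - \<gamma>) ^ Suc t * D + \<epsilon> / 4" by (simp add: algebra_simps)
    qed
  qed
  have "(\<lambda>t. (1 - \<gamma>) ^ t * D) \<longlonglongrightarrow> 0 * D"
    using \<gamma> by (intro tendsto_intros LIMSEQ_power_zero) auto
  then have "\<forall>\<^sub>F t in sequentially. (1 - \<gamma>) ^ t * D < \<epsilon> / 4"
    using \<epsilon> by (intro order_tendstoD) auto
  then obtain t where t: "(1 - \<gamma>) ^ t * D < \<epsilon> / 4" by (auto simp: eventually_sequentially)
  have "norm (x i k - x j k) \<le> 2 * (\<epsilon> / 2)" if "m + t * L \<le> k" for i j k
  proof (rule n1(2)[of "m + t * L", THEN spec[of _ x], THEN spec[of _ p], rule_format])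
    show "norm (x i (m + t * L) - x j (m + t * L)) \<le> \<epsilon> / 2" for i j
    proof -
      have "norm (x i (m + t * L) - x j (m + t * L)) \<le> (1 - \<gamma>) ^ t * D + \<epsilon> / 4" using grid by blast
      then show ?thesis using t by linarith
    qed
  qed (use m x p that in auto)
  then show ?thesis unfolding eventually_sequentially by (intro exI[of _ "m + t * L"]) auto
qed

end

section \<open>Harmonic windows and the Lyapunov argument\<close>

text \<open>The harmonic series diverges, and the first end point at which the sum reaches
  \<open>T\<close> overshoots by at most its last term, which is at most
  \<open>1 / real a\<close>.\<close>

lemma harmonic_window:
  assumes T: "0 < T" and a: "1 \<le> a" "1 / real a \<le> T"
  shows "\<exists>b>a. T \<le> (\<Sum>k\<in>{a..<b}. 1 / real k) \<and> (\<Sum>k\<in>{a..<b}. 1 / real k) \<le> 2 * T"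
proof -
  let ?S = "\<lambda>b. \<Sum>k\<in>{a..<b}. 1 / real k"
  have "\<exists>b. T \<le> ?S b"
  proof (rule ccontr)
    assume "\<not> ?thesis"
    then have lt: "?S b < T" for b by (simp add: not_le)
    have "summable (\<lambda>k. 1 / real (k + a))"
    proof (rule summableI_nonneg_bounded[where x=T])
      fix n
      have "(\<Sum>k<n. 1 / real (k + a)) = ?S (n + a)"
        by (rule sum.reindex_bij_witness[of _ "\<lambda>k. k - a" "\<lambda>k. k + a"]) auto
      then show "(\<Sum>k<n. 1 / real (k + a)) \<le> T" using lt[of "n + a"] by simp
    qed simp
    then have "summable (\<lambda>k. 1 / real k)" by (subst (asm) summable_iff_shift)
    then show False using not_summable_harmonic[where 'a=real] by (simp add: inverse_eq_divide)
  qed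
  define b where "b = (LEAST b. T \<le> ?S b)"
  have b: "T \<le> ?S b" unfolding b_def by (rule LeastI_ex) fact
  have "a < b"
  proof (rule ccontr)
    assume "\<not> a < b"
    then show False using b T by simp
  qed
  then obtain c where c: "b = Suc c" "a \<le> c" by (cases b) auto
  have "\<not> T \<le> ?S c" using not_less_Least[of c "\<lambda>b. T \<le> ?S b"] c by (simp add: b_def[symmetric])
  moreover have "1 / real c \<le> T"
    using a c by (intro order.trans[OF _ a(2)] divide_left_mono) auto
  ultimately have "?S b \<le> 2 * T" using c by simp
  then show ?thesis using b \<open>a < b\<close> by blast
qed

text \<open>The end \<open>b\<close> of the window may depend on \<open>a\<close>, and only the two
  ends are compared: inside a window the norm may rise, hence the separate oscillation bound \<tau>.
  The decrease is asked for in the annulus only, since the drift estimate is silent near 0 and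
  outside \<open>R\<close>.\<close>

definition descends :: "(nat \<Rightarrow> 'v::real_normed_vector) \<Rightarrow> real \<Rightarrow> real \<Rightarrow> real \<Rightarrow> real \<Rightarrow> nat \<Rightarrow> bool" where
  "descends m \<tau> r R \<eta> a \<longleftrightarrow> (\<exists>b>a. (\<forall>k\<in>{a..b}. norm (m k - m a) \<le> \<tau>) \<and>
      (r \<le> norm (m a) \<longrightarrow> norm (m a) \<le> R \<longrightarrow> (norm (m b))\<^sup>2 \<le> (norm (m a))\<^sup>2 - \<eta>))"

text \<open>The induction runs from window to window and keeps the norm at their starting points
  below \<open>r + \<tau>\<close>. From below radius \<open>r\<close> a window gains at most \<tau>;
  from the shell up to \<open>r + \<tau>\<close>, which lies within \<open>R\<close>, it ends no
  farther out than it began. Inside the window containing \<open>k\<close> another \<tau> is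
  lost.\<close>

lemma lyapunov_trap:
  fixes m :: "nat \<Rightarrow> 'v::real_normed_vector"
  assumes step: "\<And>a. n \<le> a \<Longrightarrow> descends m \<tau> r R e a"
    and e: "0 \<le> e" and R: "r + \<tau> \<le> R" and \<tau>: "0 \<le> \<tau>" and init: "norm (m n) \<le> r" and k: "n \<le> k"
  shows "norm (m k) \<le> r + 2 * \<tau>"
proof -
  have "norm (m k) \<le> r + 2 * \<tau>" if "n \<le> a" "a \<le> k" "norm (m a) \<le> r + \<tau>" for a
    using that
  proof (induction "k - a" arbitrary: a rule: less_induct)
    case less
    obtain b where b: "a < b" "\<And>k. k \<in> {a..b} \<Longrightarrow> norm (m k - m a) \<le> \<tau>"
      "r \<le> norm (m a) \<Longrightarrow> norm (m a) \<le> R \<Longrightarrow> (norm (m b))\<^sup>2 \<le> (norm (m a))\<^sup>2 - e"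
      using step[OF less.prems(1)] unfolding descends_def by blast
    have near: "norm (m k) \<le> norm (m a) + \<tau>" if "k \<in> {a..b}" for k
      using b(2)[OF that] norm_triangle_sub[of "m k" "m a"] by linarith
    show ?case
    proof (cases "k \<le> b")
      case True
      then show ?thesis using near[of k] less.prems by simp
    next
      case False
      have "norm (m b) \<le> r + \<tau>"
      proof (cases "r \<le> norm (m a)")
        case True
        then have "(norm (m b))\<^sup>2 \<le> (norm (m a))\<^sup>2" using b(3) less.prems R e by linarith
        then have "norm (m b) \<le> norm (m a)" by (rule power2_le_imp_le) simp
        then show ?thesis using less.prems by simp
      next
        case False
        then show ?thesis using near[of b] b(1) by simp
      qed
      then show ?thesis using less.hyps[of b] b(1) False less.prems by simp
    qed
  qed
  from this[of n] show ?thesis using init k \<tau> by simp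
qed

text \<open>As long as the norm exceeds \<open>r\<close>, each window takes \<open>e\<close> off the
  squared norm, which starts below \<open>R\<^sup>2\<close> and cannot become negative.\<close>

lemma lyapunov_entry:
  fixes m :: "nat \<Rightarrow> 'v::real_normed_vector"
  assumes step: "\<And>a. n \<le> a \<Longrightarrow> descends m \<tau> r R e a"
    and e: "0 < e" and R: "\<And>k. n \<le> k \<Longrightarrow> norm (m k) \<le> R"
  shows "\<exists>a\<ge>n. norm (m a) \<le> r"
proof (rule ccontr)
  assume "\<not> ?thesis"
  then have far: "r \<le> norm (m a)" if "n \<le> a" for a using that by force
  have "\<exists>a\<ge>n. (norm (m a))\<^sup>2 \<le> R\<^sup>2 - real j * e" for j
  proof (induction j)
    case 0
    show ?case using R[of n] by (intro exI[of _ n]) (auto intro!: power_mono)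
  next
    case (Suc j)
    then obtain a where a: "n \<le> a" "(norm (m a))\<^sup>2 \<le> R\<^sup>2 - real j * e" by blast
    obtain b where b: "b > a" "(norm (m b))\<^sup>2 \<le> (norm (m a))\<^sup>2 - e"
      using step[OF a(1)] far[OF a(1)] R[OF a(1)] unfolding descends_def by blast
    have "(norm (m b))\<^sup>2 \<le> R\<^sup>2 - real (Suc j) * e" using a b by (simp add: distrib_right)
    then show ?case using a b by (intro exI[of _ b]) auto
  qed
  moreover obtain j :: nat where "R\<^sup>2 / e < j" using reals_Archimedean2 by blast
  then have "R\<^sup>2 - real j * e < 0" using e by (simp add: field_simps)
  ultimately show False by (metis le_less_trans not_less zero_le_power2)
qed

section \<open>The recursion without truncation\<close>

lemma abs_sign_score: "\<bar>sign_score z x\<bar> = 1"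
  by (simp add: sign_score_def)

context gossip_network
begin

text \<open>\<open>x\<close> stands for the errors of the estimates, and its values at time
  \<open>n\<close> are free. The relation covers both the algorithm after its last truncation and
  the virtual path launched at a restart.\<close>

definition sa_path :: "('n \<Rightarrow> nat \<Rightarrow> 'b::real_inner) \<Rightarrow> ('n \<Rightarrow> nat \<Rightarrow> real) \<Rightarrow> nat \<Rightarrow> ('n \<Rightarrow> nat \<Rightarrow> 'b) \<Rightarrow> bool" where
  "sa_path p e n x \<longleftrightarrow> (\<forall>k\<ge>n. \<forall>i. x i (Suc k) =
     (\<Sum>j\<in>UNIV. W k $ i $ j *\<^sub>R x j k) + (sign_score (p i k, e i (k + 1)) (x i k) / real k) *\<^sub>R p i k)"

definition average :: "('n \<Rightarrow> nat \<Rightarrow> 'b::real_vector) \<Rightarrow> nat \<Rightarrow> 'b" where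
  "average x k = (1 / CARD('n)) *\<^sub>R (\<Sum>i\<in>UNIV. x i k)"

lemma norm_diff_average_le:
  fixes x :: "'n \<Rightarrow> nat \<Rightarrow> 'b::real_normed_vector"
  assumes "\<And>i j. norm (x i k - x j k) \<le> \<delta>"
  shows "norm (x i k - average x k) \<le> \<delta>"
proof -
  have "x i k - average x k = (1 / CARD('n)) *\<^sub>R (\<Sum>j\<in>UNIV. x i k - x j k)"
    by (simp add: average_def sum_subtractf scaleR_diff_right sum_constant_scaleR)
  also have "norm \<dots> \<le> (1 / CARD('n)) * (\<Sum>j\<in>(UNIV::'n set). \<delta>)"
    by (simp only: norm_scaleR) (intro mult_mono order.trans[OF norm_sum] sum_mono assms, auto)
  finally show ?thesis by simp
qed

text \<open>Column sums equal to one: gossip preserves the network average, which therefore moves by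
  the corrections alone.\<close>

lemma average_step:
  assumes x: "sa_path p e n x" and k: "1 \<le> k" "n \<le> k"
  shows "average x (Suc k) - average x k =
    (1 / CARD('n)) *\<^sub>R (\<Sum>i\<in>UNIV. (sign_score (p i k, e i (k + 1)) (x i k) / real k) *\<^sub>R p i k)"
proof -
  have "(\<Sum>i\<in>UNIV. \<Sum>j\<in>UNIV. W k $ i $ j *\<^sub>R x j k) = (\<Sum>j\<in>UNIV. (\<Sum>i\<in>UNIV. W k $ i $ j) *\<^sub>R x j k)"
    by (subst sum.swap) (simp add: scaleR_sum_left)
  also have "\<dots> = (\<Sum>j\<in>UNIV. x j k)" using k W_col by simp
  finally show ?thesis
    using x k by (simp add: average_def sa_path_def sum.distrib scaleR_add_right)
qed

lemma average_diff:
  assumes x: "sa_path p e n x" and a: "1 \<le> a" "n \<le> a" and ab: "a \<le> b"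
  shows "average x b - average x a = (\<Sum>k\<in>{a..<b}.
    (1 / CARD('n)) *\<^sub>R (\<Sum>i\<in>UNIV. (sign_score (p i k, e i (k + 1)) (x i k) / real k) *\<^sub>R p i k))"
  using ab
proof (induction b rule: dec_induct)
  case (step b)
  have "average x (Suc b) - average x a = (average x (Suc b) - average x b) + (average x b - average x a)" by simp
  then show ?case
    using step a average_step[OF x, of b] by (simp add: add.commute)
qed simp

lemma norm_average_diff_le:
  assumes x: "sa_path p e n x" and a: "1 \<le> a" "n \<le> a" and ab: "a \<le> b"
    and p: "\<forall>i. \<forall>k\<ge>1. norm (p i k) \<le> K"
  shows "norm (average x b - average x a) \<le> K * (\<Sum>k\<in>{a..<b}. 1 / real k)"
proof -
  have "norm (average x b - average x a) \<le> (\<Sum>k\<in>{a..<b}. (1 / CARD('n)) * (\<Sum>i\<in>(UNIV::'n set). K / real k))"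
    unfolding average_diff[OF x a ab]
  proof (intro order.trans[OF norm_sum] sum_mono)
    fix k assume k: "k \<in> {a..<b}"
    have "norm (\<Sum>i\<in>UNIV. (sign_score (p i k, e i (k + 1)) (x i k) / real k) *\<^sub>R p i k) \<le> (\<Sum>i\<in>(UNIV::'n set). K / real k)"
    proof (intro order.trans[OF norm_sum] sum_mono)
      fix i
      have "norm ((sign_score (p i k, e i (k + 1)) (x i k) / real k) *\<^sub>R p i k) = norm (p i k) / real k"
        by (simp add: abs_sign_score abs_divide)
      also have "\<dots> \<le> K / real k" using p k a by (intro divide_right_mono) auto
      finally show "norm ((sign_score (p i k, e i (k + 1)) (x i k) / real k) *\<^sub>R p i k) \<le> K / real k" .
    qed
    then show "norm ((1 / CARD('n)) *\<^sub>R (\<Sum>i\<in>UNIV. (sign_score (p i k, e i (k + 1)) (x i k) / real k) *\<^sub>R p i k))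
        \<le> (1 / CARD('n)) * (\<Sum>i\<in>(UNIV::'n set). K / real k)"
      by (simp only: norm_scaleR) (intro mult_mono, auto)
  qed
  then show ?thesis by (simp add: sum_distrib_left)
qed

text \<open>The squared norm of the average changes by
  \<open>2 * (y \<bullet> \<Delta>) + (norm \<Delta>)\<^sup>2\<close>. The drift bounds the first
  term by \<open>- 2 * (c / N * s)\<close>, and the short window bounds the second by half of this
  amount. The disagreement and the motion of the average each use half of the radius \<rho>.\<close>

lemma sa_path_window:
  fixes p :: "'n \<Rightarrow> nat \<Rightarrow> 'b::real_inner"
  assumes drift: "drift_window p e r R" and p: "\<forall>i. \<forall>k\<ge>1. norm (p i k) \<le> K" and K: "0 < K"
    and \<tau>: "0 < \<tau>"
  shows "\<exists>\<epsilon>>0. \<exists>\<eta>>0. \<forall>\<^sub>F a in sequentially. \<forall>n x. n \<le> a \<longrightarrow> sa_path p e n x \<longrightarrow>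
    (\<forall>k\<ge>a. \<forall>i j. norm (x i k - x j k) \<le> \<epsilon>) \<longrightarrow>
    descends (average x) \<tau> r R \<eta> a"
proof -
  obtain c \<rho> where c: "0 < c" and \<rho>: "0 < \<rho>" and win: "\<forall>T>0. \<forall>\<^sub>F a in sequentially. \<forall>b\<ge>a. \<forall>x z.
     T \<le> (\<Sum>k\<in>{a..<b}. 1 / real k) \<longrightarrow> r \<le> norm x \<longrightarrow> norm x \<le> R \<longrightarrow>
     (\<forall>i. \<forall>k\<in>{a..<b}. norm (z i k - x) \<le> \<rho>) \<longrightarrow>
     (\<Sum>k\<in>{a..<b}. (\<Sum>i\<in>UNIV. (p i k \<bullet> x) * sign_score (p i k, e i (k + 1)) (z i k)) / real k)
       \<le> - c * (\<Sum>k\<in>{a..<b}. 1 / real k)"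
    using drift unfolding drift_window_def by (elim exE conjE) (rule that)
  define N where "N = real CARD('n)"
  have N: "0 < N" by (simp add: N_def)
  \<comment> \<open>The three bounds keep, in this order, the oscillation below \<tau>, the motion
    of the average below \<open>\<rho> / 2\<close>, and the quadratic term below
    \<open>c / N * s\<close>.\<close>
  define T where "T = min (\<tau> / (2 * K)) (min (\<rho> / (4 * K)) (c / (2 * K\<^sup>2 * N)))"
  have T: "0 < T" unfolding T_def using \<tau> K \<rho> c N by auto
  have T1: "K * (2 * T) \<le> \<tau>"
  proof -
    have "T \<le> \<tau> / (2 * K)" by (simp add: T_def)
    then show ?thesis using K by (simp add: field_simps)
  qed
  have T2: "K * (2 * T) \<le> \<rho> / 2"
  proof -
    have "T \<le> \<rho> / (4 * K)" by (simp add: T_def)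
    then show ?thesis using K by (simp add: field_simps)
  qed
  have T3: "K\<^sup>2 * (2 * T) \<le> c / N"
  proof -
    have "T \<le> c / (2 * K\<^sup>2 * N)" by (simp add: T_def)
    then have "K\<^sup>2 * (2 * T) \<le> K\<^sup>2 * (2 * (c / (2 * K\<^sup>2 * N)))" by (intro mult_left_mono) auto
    also have "\<dots> = c / N" using K N by simp
    finally show ?thesis .
  qed
  have "(\<lambda>a. 1 / real a) \<longlonglongrightarrow> 0" by (rule lim_const_over_n)
  then have "\<forall>\<^sub>F a in sequentially. 1 / real a < T" using T by (intro order_tendstoD)
  moreover note win[THEN spec, THEN mp, OF T] eventually_ge_at_top[of "1 :: nat"]
  ultimately have ev: "\<forall>\<^sub>F a in sequentially. \<forall>n x. n \<le> a \<longrightarrow> sa_path p e n x \<longrightarrow>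
    (\<forall>k\<ge>a. \<forall>i j. norm (x i k - x j k) \<le> \<rho> / 2) \<longrightarrow>
    descends (average x) \<tau> r R (c / N * T) a"
  proof (eventually_elim, intro allI impI)
    fix a n and x :: "'n \<Rightarrow> nat \<Rightarrow> 'b"
    assume aT: "1 / real a < T" and a1: "1 \<le> a" and na: "n \<le> a" and x: "sa_path p e n x"
      and win: "\<forall>b\<ge>a. \<forall>x z.
         T \<le> (\<Sum>k\<in>{a..<b}. 1 / real k) \<longrightarrow> r \<le> norm x \<longrightarrow> norm x \<le> R \<longrightarrow>
         (\<forall>i. \<forall>k\<in>{a..<b}. norm (z i k - x) \<le> \<rho>) \<longrightarrow>
         (\<Sum>k\<in>{a..<b}. (\<Sum>i\<in>UNIV. (p i k \<bullet> x) * sign_score (p i k, e i (k + 1)) (z i k)) / real k)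
           \<le> - c * (\<Sum>k\<in>{a..<b}. 1 / real k)"
      and spread: "\<forall>k\<ge>a. \<forall>i j. norm (x i k - x j k) \<le> \<rho> / 2"
    obtain b where ab: "a < b" and sT: "T \<le> (\<Sum>k\<in>{a..<b}. 1 / real k)" "(\<Sum>k\<in>{a..<b}. 1 / real k) \<le> 2 * T"
      using harmonic_window[OF T a1] aT by auto
    define s where "s = (\<Sum>k\<in>{a..<b}. 1 / real k)"
    define y where "y = average x a"
    have diff: "norm (average x k - y) \<le> K * (2 * T)" if "k \<in> {a..b}" for k
    proof -
      have "norm (average x k - y) \<le> K * (\<Sum>k\<in>{a..<k}. 1 / real k)"
        unfolding y_def by (rule norm_average_diff_le[OF x a1 na _ p]) (use that in auto)
      also have "\<dots> \<le> K * s" unfolding s_def using K that by (intro mult_left_mono sum_mono2) auto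
      also have "\<dots> \<le> K * (2 * T)" using K sT by (intro mult_left_mono) (auto simp: s_def)
      finally show ?thesis .
    qed
    have "(norm (average x b))\<^sup>2 \<le> (norm y)\<^sup>2 - c / N * T" if y: "r \<le> norm y" "norm y \<le> R"
    proof -
      define \<Delta> where "\<Delta> = average x b - y"
      have near: "norm (x i k - y) \<le> \<rho>" if "k \<in> {a..<b}" for i k
      proof -
        have "norm (x i k - average x k) \<le> \<rho> / 2"
          using spread that by (intro norm_diff_average_le) auto
        moreover have "norm (average x k - y) \<le> \<rho> / 2" using diff[of k] that T2 by auto
        moreover have "x i k - y = (x i k - average x k) + (average x k - y)" by simp
        ultimately show ?thesis using norm_triangle_ineq[of "x i k - average x k" "average x k - y"] by simp
      qed
      \<comment> \<open>The drift window is used with the average frozen at \<open>y\<close> and the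
        agents' actual iterates inside the signs.\<close>
      have "y \<bullet> \<Delta> = (1 / N) * (\<Sum>k\<in>{a..<b}. (\<Sum>i\<in>UNIV. (p i k \<bullet> y) * sign_score (p i k, e i (k + 1)) (x i k)) / real k)"
        unfolding \<Delta>_def y_def average_diff[OF x a1 na less_imp_le[OF ab]] N_def
        by (simp add: inner_sum_right sum_distrib_left sum_divide_distrib inner_commute mult_ac)
      also have "\<dots> \<le> (1 / N) * (- c * s)"
        using win[rule_format, of b y x] ab sT y near N unfolding s_def by (intro mult_left_mono) auto
      finally have inner: "y \<bullet> \<Delta> \<le> - (c / N * s)" by simp
      have s0: "0 \<le> s" using sT T by (simp add: s_def)
      have "norm \<Delta> \<le> K * s"
        unfolding \<Delta>_def y_def s_def by (rule norm_average_diff_le[OF x a1 na _ p]) (use ab in auto)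
      then have "(norm \<Delta>)\<^sup>2 \<le> (K * s)\<^sup>2" by (rule power_mono) simp
      also have "\<dots> = K\<^sup>2 * s * s" by (simp add: power2_eq_square)
      also have "\<dots> \<le> K\<^sup>2 * (2 * T) * s" using sT s0 by (intro mult_right_mono mult_left_mono) (auto simp: s_def)
      also have "\<dots> \<le> c / N * s" using T3 s0 by (intro mult_right_mono)
      finally have sq: "(norm \<Delta>)\<^sup>2 \<le> c / N * s" .
      have "average x b = y + \<Delta>" by (simp add: \<Delta>_def)
      then have "(norm (average x b))\<^sup>2 = (norm y)\<^sup>2 + 2 * (y \<bullet> \<Delta>) + (norm \<Delta>)\<^sup>2"
        by (simp add: power2_norm_eq_inner inner_add_left inner_add_right inner_commute)
      also have "\<dots> \<le> (norm y)\<^sup>2 - c / N * s" using inner sq by linarith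
      also have "\<dots> \<le> (norm y)\<^sup>2 - c / N * T"
        using sT(1) c N by (intro diff_left_mono mult_left_mono) (auto simp: s_def)
      finally show ?thesis .
    qed
    moreover have "\<forall>k\<in>{a..b}. norm (average x k - y) \<le> \<tau>" using diff T1 by (meson order_trans)
    ultimately show "descends (average x) \<tau> r R (c / N * T) a"
      using ab unfolding y_def descends_def by blast
  qed
  moreover have "0 < c / N * T" using c N T by simp
  ultimately show ?thesis
    using \<rho> by (intro exI[of _ "\<rho> / 2"] conjI exI[of _ "c / N * T"]) auto
qed

text \<open>The corrections appear as an applied abstraction so that both facts fit the premises of
  the spread lemmas with the same perturbation.\<close>

lemma sa_path_perturbation:
  assumes x: "sa_path p e n x" and n: "1 \<le> n" and p: "\<forall>i. \<forall>k\<ge>1. norm (p i k) \<le> K"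
  shows "\<forall>k\<ge>n. \<forall>i. x i (Suc k) = (\<Sum>j\<in>UNIV. W k $ i $ j *\<^sub>R x j k) +
      (\<lambda>i k. (sign_score (p i k, e i (k + 1)) (x i k) / real k) *\<^sub>R p i k) i k"
    and "\<forall>k\<ge>n. \<forall>i. norm ((\<lambda>i k. (sign_score (p i k, e i (k + 1)) (x i k) / real k) *\<^sub>R p i k) i k) \<le> K / real k"
proof -
  show "\<forall>k\<ge>n. \<forall>i. x i (Suc k) = (\<Sum>j\<in>UNIV. W k $ i $ j *\<^sub>R x j k) +
      (\<lambda>i k. (sign_score (p i k, e i (k + 1)) (x i k) / real k) *\<^sub>R p i k) i k"
    using x by (simp add: sa_path_def)
  show "\<forall>k\<ge>n. \<forall>i. norm ((\<lambda>i k. (sign_score (p i k, e i (k + 1)) (x i k) / real k) *\<^sub>R p i k) i k) \<le> K / real k"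
  proof (intro allI impI)
    fix k i assume "n \<le> k"
    then have "norm (p i k) / real k \<le> K / real k" using p n by (intro divide_right_mono) auto
    then show "norm ((\<lambda>i k. (sign_score (p i k, e i (k + 1)) (x i k) / real k) *\<^sub>R p i k) i k) \<le> K / real k"
      by (simp add: abs_sign_score abs_divide)
  qed
qed

text \<open>The average is trapped within \<open>r + 2 * (1 / 4)\<close> and the agents stay within
  \<open>2 * \<delta> \<le> 1 / 2\<close> of it, together \<open>r + 1\<close>. Neither \<epsilon>
  nor the threshold time depends on the path.\<close>

lemma sa_path_bounded:
  fixes p :: "'n \<Rightarrow> nat \<Rightarrow> 'b::real_inner"
  assumes drift: "drift_window p e r (r + 1)" and r: "0 \<le> r"
    and p: "\<forall>i. \<forall>k\<ge>1. norm (p i k) \<le> K" and K: "0 < K"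
  shows "\<exists>\<epsilon>>0. \<forall>\<^sub>F n in sequentially. \<forall>x. sa_path p e n x \<longrightarrow>
    (\<forall>i j. norm (x i n - x j n) \<le> \<epsilon>) \<longrightarrow> norm (average x n) \<le> r \<longrightarrow> (\<forall>k\<ge>n. \<forall>i. norm (x i k) \<le> r + 1)"
proof -
  have quarter: "0 < (1 / 4 :: real)" by simp
  obtain \<epsilon> \<eta> where \<epsilon>: "0 < \<epsilon>" and \<eta>: "0 < \<eta>" and win: "\<forall>\<^sub>F a in sequentially. \<forall>n x. n \<le> a \<longrightarrow> sa_path p e n x \<longrightarrow>
    (\<forall>k\<ge>a. \<forall>i j. norm (x i k - x j k) \<le> \<epsilon>) \<longrightarrow>
    descends (average x) (1 / 4) r (r + 1) \<eta> a"
    using sa_path_window[OF drift p K quarter] by (elim exE conjE) (rule that)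
  define \<delta> where "\<delta> = min \<epsilon> (1 / 2) / 2"
  have \<delta>: "0 < \<delta>" using \<epsilon> by (simp add: \<delta>_def)
  have \<delta>2: "2 * \<delta> \<le> \<epsilon>" "2 * \<delta> \<le> 1 / 2" by (simp_all add: \<delta>_def)
  obtain n0 where "\<forall>a\<ge>n0. \<forall>n x. n \<le> a \<longrightarrow> sa_path p e n x \<longrightarrow>
    (\<forall>k\<ge>a. \<forall>i j. norm (x i k - x j k) \<le> \<epsilon>) \<longrightarrow> descends (average x) (1 / 4) r (r + 1) \<eta> a"
    using win unfolding eventually_sequentially by (elim exE) (rule that)
  then have n0: "\<And>a n x. n0 \<le> a \<Longrightarrow> n \<le> a \<Longrightarrow> sa_path p e n x \<Longrightarrow>
    \<forall>k\<ge>a. \<forall>i j. norm (x i k - x j k) \<le> \<epsilon> \<Longrightarrow> descends (average x) (1 / 4) r (r + 1) \<eta> a"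
    by blast
  have "\<forall>\<^sub>F n in sequentially. \<forall>x. sa_path p e n x \<longrightarrow>
    (\<forall>i j. norm (x i n - x j n) \<le> \<delta>) \<longrightarrow> norm (average x n) \<le> r \<longrightarrow> (\<forall>k\<ge>n. \<forall>i. norm (x i k) \<le> r + 1)"
    using spread_stays_small[where 'v='b, OF \<delta> less_imp_le[OF K]] eventually_ge_at_top[of n0] eventually_ge_at_top[of 1]
  proof (eventually_elim, intro allI impI)
    fix n k i and x :: "'n \<Rightarrow> nat \<Rightarrow> 'b"
    assume small: "\<forall>(x :: 'n \<Rightarrow> nat \<Rightarrow> 'b) p. (\<forall>k\<ge>n. \<forall>i. x i (Suc k) = (\<Sum>j\<in>UNIV. W k $ i $ j *\<^sub>R x j k) + p i k) \<longrightarrow>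
        (\<forall>k\<ge>n. \<forall>i. norm (p i k) \<le> K / real k) \<longrightarrow> (\<forall>i j. norm (x i n - x j n) \<le> \<delta>) \<longrightarrow>
        (\<forall>k\<ge>n. \<forall>i j. norm (x i k - x j k) \<le> 2 * \<delta>)"
      and n: "n0 \<le> n" "1 \<le> n" and x: "sa_path p e n x"
      and init: "\<forall>i j. norm (x i n - x j n) \<le> \<delta>" and r0: "norm (average x n) \<le> r" and k: "n \<le> k"
    have spread: "\<forall>k\<ge>n. \<forall>i j. norm (x i k - x j k) \<le> 2 * \<delta>"
      using small[THEN spec[of _ x], THEN spec, THEN mp, OF sa_path_perturbation(1)[OF x n(2) p],
          THEN mp, OF sa_path_perturbation(2)[OF x n(2) p], THEN mp, OF init] .
    have "norm (average x k) \<le> r + 2 * (1 / 4)"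
    proof (rule lyapunov_trap[where m="average x" and n=n and R="r + 1" and e=\<eta>])
      fix a assume "n \<le> a"
      then show "descends (average x) (1 / 4) r (r + 1) \<eta> a"
        using n spread \<delta>2(1) by (intro n0[of a n x] x allI impI) (auto intro: order_trans[OF _ \<delta>2(1)])
    qed (use \<eta> r0 k in auto)
    moreover have "norm (x i k - average x k) \<le> 2 * \<delta>" using spread k by (intro norm_diff_average_le) auto
    ultimately show "norm (x i k) \<le> r + 1"
      using norm_triangle_sub[of "x i k" "average x k"] \<delta>2(2) by linarith
  qed
  then show ?thesis using \<delta> by blast
qed

text \<open>The a priori bound \<open>R0\<close> closes the annulus from outside, so the average
  must enter the ball of radius \<open>\<beta> / 4\<close>. The trap then keeps it within
  \<open>\<beta> / 2\<close>, and the disagreement adds at most \<open>\<beta> / 4\<close>.\<close>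

lemma sa_path_converges:
  fixes p :: "'n \<Rightarrow> nat \<Rightarrow> 'b::real_inner"
  assumes drift: "\<And>r R. 0 < r \<Longrightarrow> drift_window p e r R"
    and p: "\<forall>i. \<forall>k\<ge>1. norm (p i k) \<le> K" and K: "0 < K"
    and x: "sa_path p e n x" and n: "1 \<le> n" and bounded: "\<And>i k. n \<le> k \<Longrightarrow> norm (x i k) \<le> R0"
  shows "x i \<longlonglongrightarrow> 0"
  unfolding LIMSEQ_iff
proof (intro allI impI)
  fix \<beta> :: real assume \<beta>: "0 < \<beta>"
  define r where "r = \<beta> / 4"
  define R where "R = max R0 (r + \<beta>)"
  have r: "0 < r" and eighth: "0 < \<beta> / 8" using \<beta> by (simp_all add: r_def)
  obtain \<epsilon> \<eta> where \<epsilon>: "0 < \<epsilon>" and \<eta>: "0 < \<eta>" and win: "\<forall>\<^sub>F a in sequentially. \<forall>n x. n \<le> a \<longrightarrow> sa_path p e n x \<longrightarrow>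
    (\<forall>k\<ge>a. \<forall>i j. norm (x i k - x j k) \<le> \<epsilon>) \<longrightarrow>
    descends (average x) (\<beta> / 8) r R \<eta> a"
    using sa_path_window[OF drift[OF r] p K eighth, of R] by (elim exE conjE) (rule that)
  have "\<forall>\<^sub>F a in sequentially. \<forall>k\<ge>a. \<forall>i j. norm (x i k - x j k) \<le> min \<epsilon> (\<beta> / 4)"
    by (rule spread_vanishes[OF less_imp_le[OF K] sa_path_perturbation[OF x n p]]) (use \<epsilon> \<beta> in auto)
  then obtain n1 where "\<forall>a\<ge>n1. \<forall>k\<ge>a. \<forall>i j. norm (x i k - x j k) \<le> min \<epsilon> (\<beta> / 4)"
    unfolding eventually_sequentially by (elim exE) (rule that)
  then have n1: "\<And>k i j. n1 \<le> k \<Longrightarrow> norm (x i k - x j k) \<le> min \<epsilon> (\<beta> / 4)" by blast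
  obtain n0 where "\<forall>a\<ge>n0. \<forall>n x. n \<le> a \<longrightarrow> sa_path p e n x \<longrightarrow>
    (\<forall>k\<ge>a. \<forall>i j. norm (x i k - x j k) \<le> \<epsilon>) \<longrightarrow> descends (average x) (\<beta> / 8) r R \<eta> a"
    using win unfolding eventually_sequentially by (elim exE) (rule that)
  then have n0: "\<And>a n x. n0 \<le> a \<Longrightarrow> n \<le> a \<Longrightarrow> sa_path p e n x \<Longrightarrow>
    \<forall>k\<ge>a. \<forall>i j. norm (x i k - x j k) \<le> \<epsilon> \<Longrightarrow> descends (average x) (\<beta> / 8) r R \<eta> a"
    by blast
  define m where "m = max n (max n0 n1)"
  have m: "n \<le> m" "n0 \<le> m" "n1 \<le> m" by (auto simp: m_def)
  have step: "descends (average x) (\<beta> / 8) r R \<eta> a" if "m \<le> a" for a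
    using m that n1 by (intro n0[of a n x] x allI impI) auto
  have avg: "norm (average x k) \<le> R" if "m \<le> k" for k
  proof -
    have "norm (average x k) \<le> (1 / CARD('n)) * (\<Sum>i\<in>(UNIV::'n set). R0)"
      unfolding average_def norm_scaleR
      by (intro mult_mono order.trans[OF norm_sum] sum_mono bounded) (use m that in auto)
    then show ?thesis by (simp add: R_def)
  qed
  obtain a where a: "m \<le> a" "norm (average x a) \<le> r"
    using lyapunov_entry[of m "average x", OF step \<eta> avg] by blast
  show "\<exists>no. \<forall>k\<ge>no. norm (x i k - 0) < \<beta>"
  proof (intro exI allI impI)
    fix k assume k: "a \<le> k"
    have "norm (average x k) \<le> r + 2 * (\<beta> / 8)"
    proof (rule lyapunov_trap[where m="average x" and n=a and R=R and e=\<eta>])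
      show "r + \<beta> / 8 \<le> R" using \<beta> by (simp add: R_def)
    qed (use step a k \<eta> \<beta> in auto)
    moreover have "norm (x i k - average x k) \<le> \<beta> / 4"
      using n1[of k] m a k by (intro norm_diff_average_le) (metis le_trans min.bounded_iff)
    ultimately show "norm (x i k - 0) < \<beta>"
      using norm_triangle_sub[of "x i k" "average x k"] \<beta> by (simp add: r_def)
  qed
qed

section \<open>Truncations\<close>

text \<open>Supplies the virtual path of the truncation argument, which runs on for all times
  whether or not the algorithm truncates.\<close>

lemma sa_path_exists: "\<exists>X. sa_path p e n X \<and> (\<forall>i. X i n = z i)"
proof -
  define Z where "Z = rec_nat z (\<lambda>t x i. (\<Sum>j\<in>UNIV. W (n + t) $ i $ j *\<^sub>R x j) +
     (sign_score (p i (n + t), e i (n + t + 1)) (x i) / real (n + t)) *\<^sub>R p i (n + t))"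
  have Z: "Z 0 = z" "\<And>t i. Z (Suc t) i = (\<Sum>j\<in>UNIV. W (n + t) $ i $ j *\<^sub>R Z t j) +
     (sign_score (p i (n + t), e i (n + t + 1)) (Z t i) / real (n + t)) *\<^sub>R p i (n + t)"
    by (simp_all add: Z_def)
  have "sa_path p e n (\<lambda>i k. Z (k - n) i)"
    unfolding sa_path_def
  proof (intro allI impI)
    fix k i assume "n \<le> k"
    then show "Z (Suc k - n) i = (\<Sum>j\<in>UNIV. W k $ i $ j *\<^sub>R Z (k - n) j) +
        (sign_score (p i k, e i (k + 1)) (Z (k - n) i) / real k) *\<^sub>R p i k"
      using Z(2)[of "k - n" i] by (simp add: Suc_diff_le)
  qed
  then show ?thesis using Z(1) by (intro exI[of _ "\<lambda>i k. Z (k - n) i"]) simp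
qed

end

text \<open>All quantities belong to one outcome. The binary observation is already expressed
  through noise and error; what remains of the probability model are the almost sure properties
  \<open>p_bound\<close> and \<open>drift\<close>.\<close>

locale truncated_gossip = gossip_network E W
  for E :: "nat \<Rightarrow> ('n::finite \<times> 'n) set" and W :: "nat \<Rightarrow> real ^ 'n ^ 'n" +
  fixes p :: "'n \<Rightarrow> nat \<Rightarrow> 'b::real_inner" and e :: "'n \<Rightarrow> nat \<Rightarrow> real" and target :: 'b
    and \<theta> \<theta>' :: "'n \<Rightarrow> nat \<Rightarrow> 'b" and \<sigma> \<sigma>hat :: "'n \<Rightarrow> nat \<Rightarrow> nat" and K :: real
  assumes init_\<sigma>: "\<And>i. \<sigma> i 1 = 0"
    and alg_\<sigma>hat: "\<And>i k. 1 \<le> k \<Longrightarrow> \<sigma>hat i k = (MAX j\<in>nbrs E i k. \<sigma> j k)"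
    and alg_\<theta>': "\<And>i k. 1 \<le> k \<Longrightarrow> \<theta>' i (k + 1) = of_bool (\<sigma> i k = \<sigma>hat i k) *\<^sub>R
        ((\<Sum>j\<in>nbrs E i k. (W k $ i $ j * of_bool (\<sigma> j k = \<sigma>hat i k)) *\<^sub>R \<theta> j k) +
         (sign_score (p i k, e i (k + 1)) (\<theta> i k - target) / real k) *\<^sub>R p i k)"
    and alg_\<theta>: "\<And>i k. 1 \<le> k \<Longrightarrow>
      \<theta> i (k + 1) = of_bool (norm (\<theta>' i (k + 1)) \<le> real (\<sigma>hat i k)) *\<^sub>R \<theta>' i (k + 1)"
    and alg_\<sigma>: "\<And>i k. 1 \<le> k \<Longrightarrow>
      \<sigma> i (k + 1) = \<sigma>hat i k + of_bool (norm (\<theta>' i (k + 1)) > real (\<sigma>hat i k))"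
    and K: "0 < K" and p_bound: "\<forall>i. \<forall>k\<ge>1. norm (p i k) \<le> K"
    and drift: "\<And>r R. 0 < r \<Longrightarrow> drift_window p e r R"
begin

lemma \<sigma>hat_ge: "1 \<le> k \<Longrightarrow> (j, i) \<in> E k \<Longrightarrow> \<sigma> j k \<le> \<sigma>hat i k"
  unfolding alg_\<sigma>hat by (rule Max_ge) (auto simp: nbrs_def)

lemma \<sigma>hat_le: "1 \<le> k \<Longrightarrow> (\<And>j. \<sigma> j k \<le> s) \<Longrightarrow> \<sigma>hat i k \<le> s"
  unfolding alg_\<sigma>hat using self_loops[of k i] by (subst Max_le_iff) (auto simp: nbrs_def)

lemma \<sigma>_Suc_ge: "1 \<le> k \<Longrightarrow> (j, i) \<in> E k \<Longrightarrow> \<sigma> j k \<le> \<sigma> i (Suc k)"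
  using \<sigma>hat_ge[of k j i] alg_\<sigma>[of k i] by simp

lemma \<sigma>_mono:
  assumes "1 \<le> k" "k \<le> l" shows "\<sigma> i k \<le> \<sigma> i l"
  using assms(2)
proof (induction l rule: dec_induct)
  case (step l)
  then show ?case using assms(1) \<sigma>_Suc_ge[of l i i] self_loops[of l i] by simp
qed simp

text \<open>Counters grow by at most one per step, so a high level is reached late, when the step
  sizes are small. This ties a large level to a large time in the truncation argument.\<close>

lemma \<sigma>_less_time: "1 \<le> k \<Longrightarrow> \<sigma> i k < k"
proof (induction k arbitrary: i rule: dec_induct)
  case base
  show ?case using init_\<sigma> by simp
next
  case (step k)
  have "\<sigma> j k \<le> k - 1" for j using step.IH[of j] by linarith
  then have "\<sigma>hat i k \<le> k - 1" by (intro \<sigma>hat_le step.hyps)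
  moreover have "\<sigma> i (Suc k) \<le> \<sigma>hat i k + 1" using alg_\<sigma>[OF step.hyps(1), of i] by simp
  ultimately show ?case using step.hyps by linarith
qed

text \<open>With equal counters every indicator test succeeds, and row sums equal to one let the
  target be subtracted throughout.\<close>

lemma untruncated_step:
  assumes k: "1 \<le> k" and s: "\<And>j. \<sigma> j k = s"
  shows "\<sigma>hat i k = s" and "\<theta>' i (Suc k) - target = (\<Sum>j\<in>UNIV. W k $ i $ j *\<^sub>R (\<theta> j k - target)) +
      (sign_score (p i k, e i (k + 1)) (\<theta> i k - target) / real k) *\<^sub>R p i k"
proof -
  show h: "\<sigma>hat i k = s"
    using \<sigma>hat_le[OF k, of s i] \<sigma>hat_ge[OF k self_loops[OF k, of i]] s by simp
  have "(\<Sum>j\<in>UNIV. W k $ i $ j *\<^sub>R (\<theta> j k - target)) = (\<Sum>j\<in>UNIV. W k $ i $ j *\<^sub>R \<theta> j k) - target"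
    using W_row[OF k, of i] by (simp add: scaleR_diff_right sum_subtractf scaleR_sum_left[symmetric])
  moreover have "(\<Sum>j\<in>nbrs E i k. W k $ i $ j *\<^sub>R \<theta> j k) = (\<Sum>j\<in>UNIV. W k $ i $ j *\<^sub>R \<theta> j k)"
    using sum_nbrs[OF k, of i "\<lambda>_. 1" "\<lambda>j. \<theta> j k"] by simp
  ultimately show "\<theta>' i (Suc k) - target = (\<Sum>j\<in>UNIV. W k $ i $ j *\<^sub>R (\<theta> j k - target)) +
      (sign_score (p i k, e i (k + 1)) (\<theta> i k - target) / real k) *\<^sub>R p i k"
    using alg_\<theta>'[OF k, of i] h s by simp
qed

text \<open>
  When the level \<open>s\<close> is first reached, at time \<open>\<tau>\<close>, the agents at level \<open>s\<close> have just been reset to 0;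
  they stay near 0 until the whole network has reached this level.
\<close>

lemma level_reset:
  assumes \<tau>: "1 \<le> t" and below: "\<And>i. \<sigma> i t < s" and s: "real L * K / real (Suc t) \<le> real s" and j: "j \<le> L"
  shows "\<sigma> i (Suc t + j) \<le> s \<and> (\<sigma> i (Suc t + j) = s \<longrightarrow> norm (\<theta> i (Suc t + j)) \<le> j * K / real (Suc t))"
  using j
proof (induction j arbitrary: i)
  case 0
  \<comment> \<open>A counter can equal \<open>s\<close> at time \<open>Suc t\<close> only through a
    truncation in this very step, and a truncation sets the estimate to 0.\<close>
  have h: "\<sigma>hat i t < s"
  proof -
    have "\<sigma>hat i t \<le> s - 1" using below by (intro \<sigma>hat_le[OF \<tau>]) (metis Suc_diff_1 less_Suc_eq_le gr_implies_not0 gr0I)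
    then show ?thesis using below[of i] by linarith
  qed
  then show ?case using alg_\<sigma>[OF \<tau>, of i] alg_\<theta>[OF \<tau>, of i] by auto
next
  case (Suc j)
  define k where "k = Suc t + j"
  have k: "1 \<le> k" by (simp add: k_def)
  have IH: "\<sigma> i k \<le> s" "\<sigma> i k = s \<Longrightarrow> norm (\<theta> i k) \<le> j * K / real (Suc t)" for i
    using Suc by (auto simp: k_def)
  have h: "\<sigma>hat i k \<le> s" by (rule \<sigma>hat_le[OF k IH(1)])
  have eqk: "Suc t + Suc j = k + 1" by (simp add: k_def)
  show ?case
  proof (cases "\<sigma>hat i k = s")
    case False
    then show ?thesis unfolding eqk using h alg_\<sigma>[OF k, of i] alg_\<theta>[OF k, of i] K by auto
  next
    case hs: True
    \<comment> \<open>An agent lifted to level \<open>s\<close> by its neighbours discards its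
      state, and an agent at level \<open>s\<close> ignores neighbours below it. So only corrections
      made at level \<open>s\<close> accumulate, each at most
      \<open>K / real (Suc t)\<close>.\<close>
    have small: "norm (\<theta>' i (k + 1)) \<le> real (Suc j) * K / real (Suc t)"
    proof (cases "\<sigma> i k = s")
      case False
      then have "\<theta>' i (k + 1) = 0" using alg_\<theta>'[OF k, of i] hs by simp
      then show ?thesis using K by simp
    next
      case True
      have "\<theta>' i (k + 1) = (\<Sum>j\<in>UNIV. (W k $ i $ j * of_bool (\<sigma> j k = s)) *\<^sub>R \<theta> j k) +
         (sign_score (p i k, e i (k + 1)) (\<theta> i k - target) / real k) *\<^sub>R p i k"
        unfolding alg_\<theta>'[OF k] hs sum_nbrs[OF k] using True by simp
      also have "norm \<dots> \<le> (\<Sum>l\<in>UNIV. W k $ i $ l * (j * K / real (Suc t))) + K / real (Suc t)"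
      proof (intro order.trans[OF norm_triangle_ineq] add_mono order.trans[OF norm_sum] sum_mono)
        fix l
        show "norm ((W k $ i $ l * of_bool (\<sigma> l k = s)) *\<^sub>R \<theta> l k) \<le> W k $ i $ l * (j * K / real (Suc t))"
          using IH(2)[of l] W_nonneg[OF k, of i l] K by (cases "\<sigma> l k = s") (auto intro!: mult_left_mono simp del: of_nat_Suc times_divide_eq_right)
        have "norm (p i k) / real k \<le> K / real (Suc t)"
          using p_bound k K by (intro frac_le) (auto simp: k_def)
        then show "norm ((sign_score (p i k, e i (k + 1)) (\<theta> i k - target) / real k) *\<^sub>R p i k) \<le> K / real (Suc t)"
          by (simp add: abs_sign_score abs_divide)
      qed
      also have "\<dots> = j * K / real (Suc t) + K / real (Suc t)"
        using W_row[OF k, of i] by (simp only: sum_distrib_right[symmetric] mult_1)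
      also have "\<dots> = real (Suc j) * K / real (Suc t)"
        by (simp add: add_divide_distrib distrib_right)
      finally show ?thesis .
    qed
    also have "real (Suc j) * K / real (Suc t) \<le> L * K / real (Suc t)"
      using Suc.prems K by (intro divide_right_mono mult_right_mono) auto
    \<comment> \<open>At most \<open>L\<close> such corrections cannot exceed \<open>s\<close>, so
      no agent moves on to level \<open>s + 1\<close> during this period.\<close>
    finally have "norm (\<theta>' i (k + 1)) \<le> real s" using s by linarith
    then show ?thesis
      unfolding eqk using small hs alg_\<sigma>[OF k, of i] alg_\<theta>[OF k, of i] by simp
  qed
qed

text \<open>Unbounded counters are refuted at a single level \<open>s\<close>. The trapping radius
  \<open>r + 1\<close> is fixed before \<open>s\<close>, so \<open>s\<close> can be taken above
  every norm the virtual path may produce.\<close>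

lemma finitely_many_truncations: "\<exists>S. \<forall>i. \<forall>k\<ge>1. \<sigma> i k \<le> S"
proof (rule ccontr)
  assume "\<not> ?thesis"
  then have unbounded: "\<exists>i. \<exists>k\<ge>1. S < \<sigma> i k" for S by (metis not_le)
  obtain L where "\<forall>a\<ge>1. \<forall>P u. P a u \<longrightarrow>
      (\<forall>k\<ge>a. \<forall>i j. P k j \<longrightarrow> (j, i) \<in> E k \<longrightarrow> P (Suc k) i) \<longrightarrow> (\<forall>v. \<forall>k\<ge>a + L. P k v)"
    using flooding by (elim exE conjE) (rule that)
  note flood = this[THEN spec, THEN mp]
  \<comment> \<open>At a restart the estimates are near 0, so the errors are near
    \<open>- target\<close>; the extra 1 covers the distance \<open>w \<le> 1\<close> from
    0.\<close>
  define r where "r = norm target + 1"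
  have r: "0 < r" by (simp add: r_def add_nonneg_pos)
  obtain \<epsilon> where \<epsilon>: "0 < \<epsilon>" and trap: "\<forall>\<^sub>F n in sequentially. \<forall>x. sa_path p e n x \<longrightarrow>
    (\<forall>i j. norm (x i n - x j n) \<le> \<epsilon>) \<longrightarrow> norm (average x n) \<le> r \<longrightarrow> (\<forall>k\<ge>n. \<forall>i. norm (x i k) \<le> r + 1)"
    using sa_path_bounded[OF drift[OF r] less_imp_le[OF r] p_bound K] by (elim exE conjE) (rule that)
  then obtain n0 where "\<forall>n\<ge>n0. \<forall>x. sa_path p e n x \<longrightarrow>
    (\<forall>i j. norm (x i n - x j n) \<le> \<epsilon>) \<longrightarrow> norm (average x n) \<le> r \<longrightarrow> (\<forall>k\<ge>n. \<forall>i. norm (x i k) \<le> r + 1)"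
    unfolding eventually_sequentially by (elim exE) (rule that)
  then have n0: "\<And>n x k i. n0 \<le> n \<Longrightarrow> sa_path p e n x \<Longrightarrow> \<forall>i j. norm (x i n - x j n) \<le> \<epsilon> \<Longrightarrow>
      norm (average x n) \<le> r \<Longrightarrow> n \<le> k \<Longrightarrow> norm (x i k) \<le> r + 1" by blast
  \<comment> \<open>In order: the restart, which comes after time \<open>s\<close>, lies beyond the
    threshold \<open>n0\<close>; untruncated iterates stay below the level; the level is positive;
    the restart lies within distance 1 of 0; its disagreement is at most \<epsilon>.\<close>
  obtain s :: nat where s: "max (real n0) (max (norm target + (r + 1)) (max 1 (max (L * K) (2 * (L * K) / \<epsilon>)))) \<le> real s"
    using real_arch_simple by blast
  then have s_n0: "n0 \<le> s" and s_r: "norm target + (r + 1) \<le> s" and s1: "1 \<le> s"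
    and sL: "L * K \<le> s" and sL\<epsilon>: "2 * (L * K) / \<epsilon> \<le> s" by simp_all
  define \<tau> where "\<tau> = (LEAST k. 1 \<le> k \<and> (\<exists>i. s \<le> \<sigma> i k))"
  have "\<exists>k. 1 \<le> k \<and> (\<exists>i. s \<le> \<sigma> i k)" using unbounded[of s] by (meson less_imp_le)
  then have \<tau>: "1 \<le> \<tau> \<and> (\<exists>i. s \<le> \<sigma> i \<tau>)" unfolding \<tau>_def by (rule LeastI_ex)
  then obtain u where u: "s \<le> \<sigma> u \<tau>" by blast
  have s\<tau>: "s < \<tau>" using \<sigma>_less_time[of \<tau> u] \<tau> u by linarith
  then obtain t where t: "\<tau> = Suc t" "1 \<le> t" using s1 by (cases \<tau>) auto
  have below: "\<sigma> i t < s" for i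
  proof -
    have "t < \<tau>" by (simp add: t)
    then have "\<not> (1 \<le> t \<and> (\<exists>i. s \<le> \<sigma> i t))" unfolding \<tau>_def by (rule not_less_Least)
    then show ?thesis using t by (auto simp: not_le)
  qed
  \<comment> \<open>Since \<open>s < \<tau>\<close>, the \<open>L\<close> steps after the reset,
    each of size at most \<open>K / \<tau>\<close>, displace an estimate by at most
    \<open>w\<close>.\<close>
  define w where "w = L * K / s"
  have LK: "L * K / real (Suc t) \<le> w"
    unfolding w_def using s\<tau> t s1 K by (intro divide_left_mono) auto
  have LK1: "w \<le> 1" using sL s1 by (simp add: w_def)
  have LK\<epsilon>: "2 * w \<le> \<epsilon>" unfolding w_def using sL\<epsilon> s1 \<epsilon> by (simp add: field_simps)
  define n where "n = \<tau> + L"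
  have n1: "1 \<le> n" "n0 \<le> n" using \<tau> s\<tau> s_n0 by (auto simp: n_def)
  have reset: "\<sigma> i n \<le> s \<and> (\<sigma> i n = s \<longrightarrow> norm (\<theta> i n) \<le> L * K / real (Suc t))" for i
    unfolding n_def t(1) by (rule level_reset[where L=L, OF t(2) below]) (use LK LK1 s1 in linarith, simp)
  define P where "P = (\<lambda>k i. s \<le> \<sigma> i k)"
  have P0: "P \<tau> u" using u by (simp add: P_def)
  have "\<forall>k\<ge>\<tau>. \<forall>i j. P k j \<longrightarrow> (j, i) \<in> E k \<longrightarrow> P (Suc k) i"
    unfolding P_def using \<sigma>_Suc_ge \<tau> by (meson order_trans)
  then have "P n i" for i
    using flood[of \<tau>, THEN spec[of _ P], THEN spec[of _ u], THEN mp, OF _ P0, THEN mp] \<tau> by (simp add: n_def)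
  then have level: "\<sigma> i n = s" for i using reset[of i] by (simp add: P_def le_antisym)
  have near: "norm (\<theta> i n) \<le> w" for i using reset[of i] level LK by (meson order_trans)
  obtain X where X: "sa_path p e n X" "\<And>i. X i n = \<theta> i n - target"
    using sa_path_exists[of p e n "\<lambda>i. \<theta> i n - target"] by blast
  have bound: "norm (X i k) \<le> r + 1" if "n \<le> k" for i k
  proof (rule n0[OF n1(2) X(1) _ _ that], intro allI)
    show "norm (X i n - X j n) \<le> \<epsilon>" for i j
    proof -
      have eq: "X i n - X j n = \<theta> i n - \<theta> j n" by (simp add: X(2))
      show ?thesis unfolding eq
        using norm_triangle_ineq4[of "\<theta> i n" "\<theta> j n"] near[of i] near[of j] LK\<epsilon> by linarith
    qed
    have "norm (X i n) \<le> r" for i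
      using norm_triangle_ineq4[of "\<theta> i n" target] near[of i] LK1 unfolding X(2) r_def by linarith
    then have "norm (average X n) \<le> (1 / CARD('n)) * (\<Sum>i\<in>(UNIV::'n set). r)"
      unfolding average_def norm_scaleR
      by (intro mult_mono order.trans[OF norm_sum] sum_mono) auto
    then show "norm (average X n) \<le> r" by simp
  qed
  \<comment> \<open>The bound on the virtual path at the next time rules out a truncation, and
    without truncation the algorithm takes exactly the step of that path.\<close>
  have track: "(\<forall>i. \<sigma> i k = s) \<and> (\<forall>i. \<theta> i k - target = X i k)" if "n \<le> k" for k
    using that
  proof (induction k rule: dec_induct)
    case base
    then show ?case using level X(2) by simp
  next
    case (step k)
    have k: "1 \<le> k" using step.hyps n1 by simp
    have \<theta>': "\<theta>' i (Suc k) - target = X i (Suc k)" for i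
      using untruncated_step(2)[OF k, of s i] step X(1) by (simp add: sa_path_def)
    have "norm (\<theta>' i (Suc k)) \<le> s" for i
    proof -
      have "norm (\<theta>' i (Suc k)) \<le> norm target + norm (X i (Suc k))"
        using norm_triangle_ineq[of target "X i (Suc k)"] \<theta>'[of i] by (simp add: algebra_simps)
      then show ?thesis using bound[of "Suc k" i] step.hyps s_r by linarith
    qed
    moreover have "\<sigma>hat i k = s" for i using untruncated_step(1)[OF k] step by blast
    ultimately show ?case using alg_\<sigma>[OF k] alg_\<theta>[OF k] \<theta>' by (simp add: not_less)
  qed
  obtain i k where ik: "1 \<le> k" "s < \<sigma> i k" using unbounded by blast
  have "\<sigma> i k \<le> \<sigma> i (max n k)" using ik by (intro \<sigma>_mono) auto
  then show False using track[of "max n k"] ik by simp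
qed

text \<open>Bounded nondecreasing counters become constant, and flooding forces the same constant on
  all agents. Afterwards nothing is truncated, and the common level provides the a priori bound for
  the Lyapunov argument.\<close>

lemma truncated_gossip_converges: "\<theta> i \<longlonglongrightarrow> target"
proof -
  obtain S where S: "\<And>i k. 1 \<le> k \<Longrightarrow> \<sigma> i k \<le> S" using finitely_many_truncations by blast
  obtain L where "\<forall>a\<ge>1. \<forall>P u. P a u \<longrightarrow>
      (\<forall>k\<ge>a. \<forall>i j. P k j \<longrightarrow> (j, i) \<in> E k \<longrightarrow> P (Suc k) i) \<longrightarrow> (\<forall>v. \<forall>k\<ge>a + L. P k v)"
    using flooding by (elim exE conjE) (rule that)
  note flood = this[THEN spec, THEN mp]
  have "\<exists>k\<ge>1. \<forall>l\<ge>k. \<sigma> i l = \<sigma> i k" for i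
  proof -
    define m where "m = (GREATEST v. \<exists>k\<ge>1. \<sigma> i k = v)"
    have "\<exists>k\<ge>1. \<sigma> i k = m" unfolding m_def
      by (rule GreatestI_ex_nat[where b=S]) (use S in auto)
    then obtain k where k: "1 \<le> k" "\<sigma> i k = m" by blast
    have "\<sigma> i l \<le> m" if "1 \<le> l" for l
      unfolding m_def by (rule Greatest_le_nat[where b=S]) (use S that in auto)
    then have "\<sigma> i l = m" if "k \<le> l" for l using \<sigma>_mono[OF k(1) that, of i] k that by (simp add: le_antisym)
    then show ?thesis using k by auto
  qed
  then obtain c where c: "\<And>i. 1 \<le> c i" "\<And>i l. c i \<le> l \<Longrightarrow> \<sigma> i l = \<sigma> i (c i)" by metis
  define n where "n = Max (range c)"
  have cn: "c i \<le> n" for i unfolding n_def by (rule Max_ge) auto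
  have n: "1 \<le> n" using c(1)[of undefined] cn[of undefined] by linarith
  have const: "\<sigma> i l = \<sigma> i n" if "n \<le> l" for i l
    using c(2)[of i l] c(2)[of i n] cn[of i] that by simp
  have le: "\<sigma> u n \<le> \<sigma> v n" for u v
  proof -
    define P where "P = (\<lambda>k i. \<sigma> u n \<le> \<sigma> i k)"
    have P0: "P n u" by (simp add: P_def)
    have "\<forall>k\<ge>n. \<forall>i j. P k j \<longrightarrow> (j, i) \<in> E k \<longrightarrow> P (Suc k) i"
      unfolding P_def using \<sigma>_Suc_ge n by (meson order_trans)
    then have "P (n + L) v"
      using flood[of n, THEN spec[of _ P], THEN spec[of _ u], THEN mp, OF _ P0, THEN mp] n by simp
    then show ?thesis using const[of "n + L" v] by (simp add: P_def)
  qed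
  define s where "s = \<sigma> i n"
  have level: "\<sigma> j k = s" if "n \<le> k" for j k
    using const[OF that, of j] le[of j i] le[of i j] by (simp add: s_def)
  have step: "norm (\<theta>' j (Suc k)) \<le> s \<and> \<theta> j (Suc k) = \<theta>' j (Suc k)" if "n \<le> k" for j k
  proof -
    have k: "1 \<le> k" using that n by simp
    have "\<sigma>hat j k = s" using untruncated_step(1)[OF k] level[OF that] by blast
    then show ?thesis using alg_\<sigma>[OF k, of j] alg_\<theta>[OF k, of j] level[of "k + 1" j] that
      by (auto simp: of_bool_def split: if_splits)
  qed
  define x where "x = (\<lambda>i k. \<theta> i k - target)"
  \<comment> \<open>The path starts one step late because the level bounds only estimates produced
    by a step without truncation.\<close>
  have path: "sa_path p e (Suc n) x"
    unfolding sa_path_def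
  proof (intro allI impI)
    fix k j assume k: "Suc n \<le> k"
    then show "x j (Suc k) = (\<Sum>l\<in>UNIV. W k $ j $ l *\<^sub>R x l k) + (sign_score (p j k, e j (k + 1)) (x j k) / real k) *\<^sub>R p j k"
      unfolding x_def using step[of k j] untruncated_step(2)[of k s j] level by auto
  qed
  have bound: "norm (x j k) \<le> s + norm target" if "Suc n \<le> k" for j k
  proof -
    have "norm (\<theta> j k) \<le> s" using step[of "k - 1" j] that by (cases k) auto
    then show ?thesis unfolding x_def using norm_triangle_ineq4[of "\<theta> j k" target] by linarith
  qed
  have "x i \<longlonglongrightarrow> 0"
    by (rule sa_path_converges[OF drift p_bound K path _ bound]) auto
  then show ?thesis unfolding x_def by (simp add: LIM_zero_iff)
qed

end

section \<open>Convergence of the estimates\<close>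

text \<open>A smaller annulus inherits the rate and the radius; this lets a countable family of
  annuli serve all pairs of radii.\<close>

lemma drift_window_mono:
  assumes "drift_window p e r R" "r \<le> r'" "R' \<le> R"
  shows "drift_window p e r' R'"
proof -
  obtain c \<rho> where c: "0 < c" "0 < \<rho>" and win: "\<forall>T>0. \<forall>\<^sub>F a in sequentially. \<forall>b\<ge>a. \<forall>x z.
     T \<le> (\<Sum>k\<in>{a..<b}. 1 / real k) \<longrightarrow> r \<le> norm x \<longrightarrow> norm x \<le> R \<longrightarrow>
     (\<forall>i. \<forall>k\<in>{a..<b}. norm (z i k - x) \<le> \<rho>) \<longrightarrow>
     (\<Sum>k\<in>{a..<b}. (\<Sum>i\<in>UNIV. (p i k \<bullet> x) * sign_score (p i k, e i (k + 1)) (z i k)) / real k)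
       \<le> - c * (\<Sum>k\<in>{a..<b}. 1 / real k)"
    using assms(1) unfolding drift_window_def by (elim exE conjE) (rule that)
  show ?thesis
    unfolding drift_window_def
  proof (rule exI[of _ c], rule conjI[OF c(1)], rule exI[of _ \<rho>], rule conjI[OF c(2)], intro allI impI)
    fix T :: real assume "0 < T"
    from win[THEN spec, THEN mp, OF this]
    show "\<forall>\<^sub>F a in sequentially. \<forall>b\<ge>a. \<forall>x z.
       T \<le> (\<Sum>k\<in>{a..<b}. 1 / real k) \<longrightarrow> r' \<le> norm x \<longrightarrow> norm x \<le> R' \<longrightarrow>
       (\<forall>i. \<forall>k\<in>{a..<b}. norm (z i k - x) \<le> \<rho>) \<longrightarrow>
       (\<Sum>k\<in>{a..<b}. (\<Sum>i\<in>UNIV. (p i k \<bullet> x) * sign_score (p i k, e i (k + 1)) (z i k)) / real k)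
         \<le> - c * (\<Sum>k\<in>{a..<b}. 1 / real k)"
      by eventually_elim (use assms(2,3) in \<open>meson order_trans\<close>)
  qed
qed

text \<open>The density is positive near 0, and this neighbourhood meets the interval in positive
  length even if 0 is an end point. This sharpens the median condition to strict inequalities on
  both sides of 0.\<close>

lemma density_interval_pos:
  fixes f :: "real \<Rightarrow> real"
  assumes \<nu>: "\<nu> = density lborel (\<lambda>x. ennreal (f x))" and prob: "prob_space \<nu>"
    and cont: "continuous_on UNIV f" and f: "\<And>x. 0 \<le> f x" "0 < f 0"
    and ab: "a \<le> 0" "0 \<le> b" "a < b"
  shows "0 < measure \<nu> {a<..<b}"
proof -
  interpret prob_space \<nu> by fact
  have [measurable]: "f \<in> borel_measurable borel" using cont by (rule borel_measurable_continuous_onI)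
  have "isCont f 0" using cont by (simp add: continuous_on_eq_continuous_at)
  then obtain \<delta> where \<delta>: "0 < \<delta>" "\<And>x. \<bar>x\<bar> < \<delta> \<Longrightarrow> 0 < f x"
    using order_tendstoD(1)[of f "f 0" "at 0" 0] f(2)
    unfolding isCont_def eventually_at by (auto simp: dist_real_def) (metis abs_zero)
  define I where "I = {max a (- \<delta>)<..<min b \<delta>}"
  have "emeasure \<nu> {a<..<b} \<noteq> 0"
  proof
    assume "emeasure \<nu> {a<..<b} = 0"
    then have "(\<integral>\<^sup>+x. ennreal (f x) * indicator {a<..<b} x \<partial>lborel) = 0"
      unfolding \<nu> by (subst (asm) emeasure_density) auto
    then have "AE x in lborel. ennreal (f x) * indicator {a<..<b} x = 0"
      by (subst (asm) nn_integral_0_iff_AE) auto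
    then have "AE x in lborel. x \<notin> I"
    proof eventually_elim
      fix x assume "ennreal (f x) * indicator {a<..<b} x = 0"
      then show "x \<notin> I" using \<delta>(2)[of x] unfolding I_def by (auto simp: indicator_def ennreal_eq_0_iff abs_less_iff split: if_splits)
    qed
    then have "emeasure lborel I = 0"
      by (subst (asm) AE_iff_measurable[of I]) (auto simp: I_def)
    moreover have "emeasure lborel I = ennreal (min b \<delta> - max a (- \<delta>))"
      unfolding I_def using ab \<delta>(1) by (intro emeasure_lborel_Ioo) auto
    ultimately show False using ab \<delta>(1) by (auto simp: ennreal_eq_0_iff)
  qed
  then show ?thesis by (simp add: emeasure_eq_measure zero_less_measure_iff)
qed

lemma inner_outer_prod: "x \<bullet> (outer_prod y y *v x) = (y \<bullet> x)\<^sup>2"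
proof -
  have "outer_prod y y *v x = (y \<bullet> x) *\<^sub>R y"
    by (simp add: vec_eq_iff outer_prod_def matrix_vector_mult_def inner_vec_def sum_distrib_left mult_ac)
  then show ?thesis by (simp add: power2_eq_square inner_commute)
qed

text \<open>Lets the quadratic form pass under the expectation in the excitation condition.\<close>

lemma bounded_linear_quadratic_form: "bounded_linear (\<lambda>A :: real ^ 'l ^ 'l. x \<bullet> (A *v x))"
  unfolding linear_conv_bounded_linear[symmetric]
  by (rule linearI) (simp_all add: matrix_vector_mult_add_rdistrib inner_add_right scaleR_matrix_vector_assoc[symmetric])

section \<open>Deriving the pathwise hypotheses from the probabilistic conditions\<close>

theorem theorem1:
  fixes M :: "'a measure"
    and E :: "nat \<Rightarrow> ('n::finite \<times> 'n) set"
    and W :: "nat \<Rightarrow> real ^ 'n ^ 'n"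
    and \<theta>star :: "real ^ 'l"
    and \<phi> :: "'n \<Rightarrow> nat \<Rightarrow> 'a \<Rightarrow> real ^ 'l"
    and d y :: "'n \<Rightarrow> nat \<Rightarrow> 'a \<Rightarrow> real"
    and \<theta>init :: "'n \<Rightarrow> real ^ 'l"
    and \<theta> \<theta>' :: "'n \<Rightarrow> nat \<Rightarrow> 'a \<Rightarrow> real ^ 'l"
    and \<sigma> \<sigma>hat :: "'n \<Rightarrow> nat \<Rightarrow> 'a \<Rightarrow> nat"
    and q :: "'n \<Rightarrow> real ^ 'l \<Rightarrow> real"
    and F f :: "'n \<Rightarrow> real \<Rightarrow> real"
  assumes prob: "prob_space M"
    \<comment> \<open>network\<close>
    and self_loops: "\<And>i k. 1 \<le> k \<Longrightarrow> (i, i) \<in> E k"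
    and weights: "\<And>i j k. 1 \<le> k \<Longrightarrow>
      (if (j, i) \<in> E k then 0 < W k $ i $ j else W k $ i $ j = 0)"
    \<comment> \<open>observation model\<close>
    and model: "\<And>i k \<omega>. 1 \<le> k \<Longrightarrow> \<omega> \<in> space M \<Longrightarrow>
      y i (k + 1) \<omega> = \<phi> i k \<omega> \<bullet> \<theta>star + d i (k + 1) \<omega>"
    \<comment> \<open>algorithm\<close>
    and init_\<theta>: "\<And>i \<omega>. \<omega> \<in> space M \<Longrightarrow> \<theta> i 1 \<omega> = \<theta>init i"
    and init_\<sigma>: "\<And>i \<omega>. \<omega> \<in> space M \<Longrightarrow> \<sigma> i 1 \<omega> = 0"
    and alg_\<sigma>hat: "\<And>i k \<omega>. 1 \<le> k \<Longrightarrow> \<omega> \<in> space M \<Longrightarrow>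
      \<sigma>hat i k \<omega> = (MAX j\<in>nbrs E i k. \<sigma> j k \<omega>)"
    and alg_\<theta>': "\<And>i k \<omega>. 1 \<le> k \<Longrightarrow> \<omega> \<in> space M \<Longrightarrow>
      \<theta>' i (k + 1) \<omega> =
        of_bool (\<sigma> i k \<omega> = \<sigma>hat i k \<omega>) *\<^sub>R
        ((\<Sum>j\<in>nbrs E i k. (W k $ i $ j * of_bool (\<sigma> j k \<omega> = \<sigma>hat i k \<omega>)) *\<^sub>R \<theta> j k \<omega>) +
         (1 / real k * (1 - 2 * of_bool (y i (k + 1) \<omega> < \<phi> i k \<omega> \<bullet> \<theta> i k \<omega>))) *\<^sub>R \<phi> i k \<omega>)"
    and alg_\<theta>: "\<And>i k \<omega>. 1 \<le> k \<Longrightarrow> \<omega> \<in> space M \<Longrightarrow>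
      \<theta> i (k + 1) \<omega> =
        of_bool (norm (\<theta>' i (k + 1) \<omega>) \<le> real (\<sigma>hat i k \<omega>)) *\<^sub>R \<theta>' i (k + 1) \<omega>"
    and alg_\<sigma>: "\<And>i k \<omega>. 1 \<le> k \<Longrightarrow> \<omega> \<in> space M \<Longrightarrow>
      \<sigma> i (k + 1) \<omega> =
        \<sigma>hat i k \<omega> + of_bool (norm (\<theta>' i (k + 1) \<omega>) > real (\<sigma>hat i k \<omega>))"
    \<comment> \<open>C1\<close>
    and stationary: "\<And>i. strictly_stationary M (\<phi> i)"
    and q_nonneg: "\<And>i x. 0 \<le> q i x"
    and \<phi>_density: "\<And>i k. 1 \<le> k \<Longrightarrow> distributed M lborel (\<phi> i k) (\<lambda>x. ennreal (q i x))"
    and mixing: "\<And>i. alpha_mixing M (\<phi> i)"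
    and mixing_rate: "\<And>i. \<exists>C \<rho>. 0 < C \<and> 0 < \<rho> \<and> \<rho> < 1 \<and>
      (\<forall>k\<ge>1. alpha_coeff M (\<phi> i) k \<le> C * \<rho> ^ k)"
    and \<phi>_bounded: "\<And>i. \<exists>K>0. AE \<omega> in M. \<forall>k\<ge>1. norm (\<phi> i k \<omega>) \<le> K"
    \<comment> \<open>C2\<close>
    and excitation: "\<And>k. 1 \<le> k \<Longrightarrow>
      positive_definite (\<integral>\<omega>. (\<Sum>i\<in>UNIV. outer_prod (\<phi> i k \<omega>) (\<phi> i k \<omega>)) \<partial>M)"
    \<comment> \<open>C3\<close>
    and d_indep: "\<And>i. prob_space.indep_vars M (\<lambda>_. borel) (d i) {2..}"
    and d_cdf: "\<And>i k. 2 \<le> k \<Longrightarrow> cdf (distr M borel (d i k)) = F i"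
    and f_nonneg: "\<And>i x. 0 \<le> f i x"
    and d_density: "\<And>i k. 2 \<le> k \<Longrightarrow> distributed M lborel (d i k) (\<lambda>x. ennreal (f i x))"
    and F_median: "\<And>i. F i 0 = 1 / 2"
    and f_cont: "\<And>i. continuous_on UNIV (f i)"
    and f_pos: "\<And>i. 0 < f i 0"
    and \<phi>_d_indep: "\<And>i. prob_space.indep_set M
      (generated_events M (\<phi> i) {1..}) (generated_events M (d i) {2..})"
    \<comment> \<open>C4\<close>
    and W_stochastic: "\<And>k. 1 \<le> k \<Longrightarrow> doubly_stochastic (W k)"
    and W_lower: "\<exists>\<kappa>. 0 < \<kappa> \<and> \<kappa> < 1 \<and> (\<forall>k\<ge>1. \<forall>i. \<forall>j\<in>nbrs E i k. \<kappa> \<le> W k $ i $ j)"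
    and connected: "strongly_connected (persistent_edges E)"
    and B_connected: "\<exists>B\<ge>1. \<forall>e\<in>persistent_edges E. \<forall>k\<ge>1. e \<in> (\<Union>m\<in>{k..<k + B}. E m)"
  shows "\<forall>i. AE \<omega> in M. (\<lambda>k. \<theta> i k \<omega>) \<longlonglongrightarrow> \<theta>star"
proof -
  interpret prob_space M by (rule prob)
  interpret gossip_network E W
    by unfold_locales (fact self_loops weights W_stochastic W_lower connected B_connected)+
  define \<mu> where "\<mu> = (\<lambda>i. distr M borel (\<phi> i 1))"
  define \<nu> where "\<nu> = (\<lambda>i. distr M borel (d i 2))"
  have \<phi>m: "\<phi> i k \<in> borel_measurable M" if "1 \<le> k" for i k
    using distributed_measurable[OF \<phi>_density[OF that]] by simp
  have dm: "d i k \<in> borel_measurable M" if "2 \<le> k" for i k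
    using distributed_measurable[OF d_density[OF that]] by simp
  have \<phi>q: "distr M borel (\<phi> i k) = density lborel (\<lambda>x. ennreal (q i x))" if "1 \<le> k" for i k
  proof -
    have "distr M borel (\<phi> i k) = distr M lborel (\<phi> i k)" by (rule distr_cong) simp_all
    then show ?thesis using distributed_distr_eq_density[OF \<phi>_density[OF that]] by simp
  qed
  have df: "distr M borel (d i k) = density lborel (\<lambda>x. ennreal (f i x))" if "2 \<le> k" for i k
  proof -
    have "distr M borel (d i k) = distr M lborel (d i k)" by (rule distr_cong) simp_all
    then show ?thesis using distributed_distr_eq_density[OF d_density[OF that]] by simp
  qed
  have \<phi>law: "distr M borel (\<phi> i k) = \<mu> i" if "1 \<le> k" for i k
    using \<phi>q[OF that] \<phi>q[of 1] by (simp add: \<mu>_def)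
  have \<nu>f: "\<nu> i = density lborel (\<lambda>x. ennreal (f i x))" for i by (simp add: \<nu>_def df)
  have dlaw: "distr M borel (d i k) = \<nu> i" if "2 \<le> k" for i k
    using df[OF that] \<nu>f by simp
  have p\<nu>: "prob_space (\<nu> i)" for i unfolding \<nu>_def by (rule prob_space_distr) (simp add: dm)
  have s\<nu>: "sets (\<nu> i) = sets borel" for i by (simp add: \<nu>_def)
  have noatom: "AE t in \<nu> i. t \<noteq> u" for i u
  proof -
    have "f i \<in> borel_measurable borel" using f_cont by (rule borel_measurable_continuous_onI)
    then show ?thesis unfolding \<nu>f using AE_lborel_singleton[of u] by (subst AE_density) auto
  qed
  have median: "measure (\<nu> i) {..0} = 1 / 2" for i
    using F_median[of i] d_cdf[of 2 i] by (simp add: cdf_def \<nu>_def fun_eq_iff)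
  have interval: "0 < measure (\<nu> i) {a<..<b}" if "a \<le> 0" "0 \<le> b" "a < b" for i a b
    using that by (intro density_interval_pos[OF \<nu>f p\<nu> f_cont f_nonneg f_pos])
  have median_pos: "1 / 2 < measure (\<nu> i) {..<u}" if "0 < u" for i u
  proof -
    interpret \<nu>: prob_space "\<nu> i" by (rule p\<nu>)
    have "measure (\<nu> i) ({..0} \<union> {0<..<u}) = measure (\<nu> i) {..0} + measure (\<nu> i) {0<..<u}"
      by (rule \<nu>.finite_measure_Union) (auto simp: s\<nu>)
    also have "{..0} \<union> {0<..<u} = {..<u}" using that by auto
    finally show ?thesis using interval[of 0 u i] that median[of i] by simp
  qed
  have median_neg: "measure (\<nu> i) {..<u} < 1 / 2" if "u < 0" for i u
  proof -
    interpret \<nu>: prob_space "\<nu> i" by (rule p\<nu>)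
    have "measure (\<nu> i) {..<u} + measure (\<nu> i) {u<..<0} = measure (\<nu> i) ({..<u} \<union> {u<..<0})"
      by (rule \<nu>.finite_measure_Union[symmetric]) (auto simp: s\<nu>)
    also have "\<dots> \<le> measure (\<nu> i) {..0}" using that by (intro \<nu>.finite_measure_mono) (auto simp: s\<nu>)
    finally show ?thesis using interval[of u 0 i] that median[of i] by simp
  qed
  have "\<forall>i. \<exists>Ki. 0 < Ki \<and> (AE \<omega> in M. \<forall>k\<ge>1. norm (\<phi> i k \<omega>) \<le> Ki)"
    using \<phi>_bounded by blast
  from choice[OF this] obtain Kf where "\<forall>i. 0 < Kf i \<and> (AE \<omega> in M. \<forall>k\<ge>1. norm (\<phi> i k \<omega>) \<le> Kf i)" ..
  then have Kf: "\<And>i. 0 < Kf i" "\<And>i. AE \<omega> in M. \<forall>k\<ge>1. norm (\<phi> i k \<omega>) \<le> Kf i" by blast+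
  define K where "K = (\<Sum>i\<in>UNIV. Kf i)"
  have KfK: "Kf i \<le> K" for i unfolding K_def using Kf(1) by (intro member_le_sum) (auto intro: less_imp_le)
  have K: "0 < K" using Kf(1) KfK by (meson less_le_trans)
  have "AE \<omega> in M. \<forall>k\<ge>1. norm (\<phi> i k \<omega>) \<le> K" for i
    using Kf(2)[of i] by eventually_elim (use KfK in \<open>meson order_trans\<close>)
  then have bdd: "AE \<omega> in M. \<forall>i. \<forall>k\<ge>1. norm (\<phi> i k \<omega>) \<le> K"
    by (rule eventually_all_finite)
  \<comment> \<open>A direction almost surely orthogonal to the regressors of every agent would
    annihilate the expected quadratic form.\<close>
  have exc: "\<exists>i. \<not> (AE p in \<mu> i. p \<bullet> x = 0)" if x: "x \<noteq> 0" for x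
  proof (rule ccontr)
    assume "\<not> ?thesis"
    then have null: "AE p in \<mu> i. p \<bullet> x = 0" for i by blast
    have "AE \<omega> in M. \<phi> i 1 \<omega> \<bullet> x = 0" for i
      using null[of i] unfolding \<mu>_def by (subst (asm) AE_distr_iff[OF \<phi>m[OF order_refl]]) auto
    then have ae: "AE \<omega> in M. \<forall>i. \<phi> i 1 \<omega> \<bullet> x = 0"
      by (rule eventually_all_finite)
    let ?O = "\<lambda>\<omega>. \<Sum>i\<in>UNIV. outer_prod (\<phi> i 1 \<omega>) (\<phi> i 1 \<omega>)"
    have pos: "0 < x \<bullet> ((\<integral>\<omega>. ?O \<omega> \<partial>M) *v x)"
      using excitation[of 1] x by (simp add: positive_definite_def)
    \<comment> \<open>The Bochner integral of a non-integrable function is 0 by convention, and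
      positive definiteness excludes this value as well, so both cases are contradictory.\<close>
    show False
    proof (cases "integrable M ?O")
      case True
      have "x \<bullet> ((\<integral>\<omega>. ?O \<omega> \<partial>M) *v x) = (\<integral>\<omega>. x \<bullet> (?O \<omega> *v x) \<partial>M)"
        by (rule integral_bounded_linear[OF bounded_linear_quadratic_form True, symmetric])
      also have "\<dots> = (\<integral>\<omega>. (\<Sum>i\<in>UNIV. (\<phi> i 1 \<omega> \<bullet> x)\<^sup>2) \<partial>M)"
      proof -
        have "x \<bullet> (?O \<omega> *v x) = (\<Sum>i\<in>UNIV. (\<phi> i 1 \<omega> \<bullet> x)\<^sup>2)" for \<omega>
          by (simp only: linear_sum[OF bounded_linear.linear[OF bounded_linear_quadratic_form[of x]]] inner_outer_prod)
        then show ?thesis by simp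
      qed
      also have "\<dots> = 0"
        by (rule integral_eq_zero_AE) (use ae in eventually_elim, simp)
      finally show False using pos by simp
    next
      case False
      then have "(\<integral>\<omega>. ?O \<omega> \<partial>M) = 0" by (rule not_integrable_integral_eq)
      then show False using pos by simp
    qed
  qed
  \<comment> \<open>Every annulus around 0 is contained in one of these countably many, so a single
    null set has to be discarded.\<close>
  have "AE \<omega> in M. drift_window (\<lambda>i k. \<phi> i k \<omega>) (\<lambda>i k. d i k \<omega>) (1 / real (Suc m)) (real m)" for m
  proof (rule drift_window_AE[where \<mu>=\<mu> and \<nu>=\<nu> and K=K])
    show "0 \<le> K" using K by simp
    show "0 < 1 / real (Suc m)" by simp
  qed (fact \<phi>m \<phi>law dlaw d_indep \<phi>_d_indep mixing_rate noatom median_pos median_neg bdd exc)+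
  then have "AE \<omega> in M. \<forall>m. drift_window (\<lambda>i k. \<phi> i k \<omega>) (\<lambda>i k. d i k \<omega>) (1 / real (Suc m)) (real m)"
    by (simp add: AE_all_countable)
  then have "AE \<omega> in M. \<forall>i. (\<lambda>k. \<theta> i k \<omega>) \<longlonglongrightarrow> \<theta>star"
    using bdd AE_space
  proof eventually_elim
    fix \<omega>
    assume dw: "\<forall>m. drift_window (\<lambda>i k. \<phi> i k \<omega>) (\<lambda>i k. d i k \<omega>) (1 / real (Suc m)) (real m)"
      and b: "\<forall>i. \<forall>k\<ge>1. norm (\<phi> i k \<omega>) \<le> K" and \<omega>: "\<omega> \<in> space M"
    have drift: "drift_window (\<lambda>i k. \<phi> i k \<omega>) (\<lambda>i k. d i k \<omega>) r R" if "0 < r" for r R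
    proof -
      obtain m :: nat where m: "max (1 / r) R \<le> real m" using real_arch_simple by blast
      have "1 / r \<le> real (Suc m)" using m by simp
      then have "1 / real (Suc m) \<le> r" using that by (simp add: field_simps)
      moreover have "R \<le> real m" using m by simp
      ultimately show ?thesis by (rule drift_window_mono[OF dw[THEN spec[of _ m]]])
    qed
    interpret truncated_gossip E W "\<lambda>i k. \<phi> i k \<omega>" "\<lambda>i k. d i k \<omega>" \<theta>star "\<lambda>i k. \<theta> i k \<omega>" "\<lambda>i k. \<theta>' i k \<omega>"
      "\<lambda>i k. \<sigma> i k \<omega>" "\<lambda>i k. \<sigma>hat i k \<omega>" K
    proof (unfold_locales, goal_cases)
      case (1 i)
      show ?case by (rule init_\<sigma>[OF \<omega>])
    next
      case (2 i k)
      show ?case by (rule alg_\<sigma>hat[OF 2 \<omega>])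
    next
      case k: (3 i k)
      \<comment> \<open>Substituting the model into the comparison leaves an event about the noise
        and the error, as \<open>sign_score\<close> expects.\<close>
      have "y i (k + 1) \<omega> < \<phi> i k \<omega> \<bullet> \<theta> i k \<omega> \<longleftrightarrow> d i (k + 1) \<omega> < \<phi> i k \<omega> \<bullet> (\<theta> i k \<omega> - \<theta>star)"
        using model[OF k \<omega>, of i] by (auto simp: inner_diff_right)
      then show ?case
        using alg_\<theta>'[OF k \<omega>, of i] by (simp add: sign_score_def)
    next
      case (4 i k)
      show ?case by (rule alg_\<theta>[OF 4 \<omega>])
    next
      case (5 i k)
      show ?case by (rule alg_\<sigma>[OF 5 \<omega>])
    next
      case 6
      show ?case by (rule K)
    next
      case 7
      show ?case by (rule b)
    next
      case (8 r R)
      show ?case by (rule drift[OF 8])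
    qed
    show "\<forall>i. (\<lambda>k. \<theta> i k \<omega>) \<longlonglongrightarrow> \<theta>star" using truncated_gossip_converges by blast
  qed
  then show ?thesis by (intro allI) (erule AE_mp, auto)
qed

end
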